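(* Let $q$ be a prime power, let $\mathcal{H}$ be the Hermitian curve over $\mathbb{F}_{q^2}$, let $T=\{P,Q,R\}$ be a Hermitian triangle of type $d$, and let $$h_d(q)=\frac{d-1}{12d}(q+1)(2q^2-5q+5-d).$$ (a) For any one specified point of $T$, the number of effective divisors of the form $aP+bQ+cR$ having a basepoint at that point is $$N_1(T)=\frac{1}{24}\left(q^6-2q^5+4q^3-q^2-2q\right).$$ (b) For any two specified points of $T$, the number of effective divisors of the form $aP+bQ+cR$ having basepoints at both of these points is $$N_2(T)=\frac{1}{120}\left(2q^6+q^5-20q^4-25q^3+138q^2-96q\right)+h_d(q).$$ (c) The number $N_3(T)=\#G_0(P,Q,R)$ of pure gaps for $(P,Q,R)$ is $$\#G_0(P,Q,R)=\frac{1}{120}\left(q^6+3q^5-15q^4-75q^3+254q^2-168q\right)+h_d(q).$$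
   Context: The Hermitian curve $\mathcal{H}$ over $\mathbb{F}_{q^2}$ is the smooth projective plane curve $X^{q+1}-Y^qZ-YZ^q=0$. Write $P_\infty=(0:1:0)$ and $P_{\alpha\beta}=(\alpha:\beta:1)$ for its rational points. A Hermitian triangle is a set $T$ of three distinct $\mathbb{F}_{q^2}$-rational points of $\mathcal{H}$. $T$ is in standard form if $T=\{P_\infty,P_{00},P_{\alpha\beta}\}$ with either $\alpha=0$ or $\alpha=\beta$. $T$ is of type $d$ if there is $\sigma\in\operatorname{Aut}(\mathcal{H})$ such that $\sigma(T)=\{P_\infty,P_{00},P_{\alpha\beta}\}$ is in standard form and $1-\alpha$ has multiplicative order $d$; every Hermitian triangle has a well-defined type, which is a positive divisor of $q+1$. For a divisor $A$, $L(A)=\{f\in\mathbb{F}_{q^2}(\mathcal{H})^\times:\operatorname{div}(f)\ge -A\}\cup\{0\}$. A divisor $D$ has a basepoint at a rational point $S$ if $L(D)=L(D-S)$. "Effective" means that $a,b,c$ are nonnegative integers. The set of pure gaps $G_0(P,Q,R)$ is the set of triples $(a,b,c)$ of nonnegative integers such that $aP+bQ+cR$ has a basepoint at each of $P$, $Q$, and $R$. *)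

theory Defs
  imports
    "HOL-Library.Cardinality"
    "HOL-Library.Poly_Mapping"
    "HOL-Computational_Algebra.Fraction_Field"
    "HOL-Number_Theory.Prime_Powers"
    "HOL-Algebra.Algebraic_Closure_Type"
begin

text \<open>
  The ground field with \<open>q\<^sup>2\<close> elements is a type of the following class, so that the curve, its
  coordinate ring and its function field can be types depending on the ground field alone.
\<close>

class square_field = field + finite +
  assumes card_square: "\<exists>r. card (UNIV :: 'a set) = r\<^sup>2"

definition qq :: "'a::square_field itself \<Rightarrow> nat" where
  "qq _ = (THE r. CARD('a) = r\<^sup>2)"

lemma qq_square: "CARD('a::square_field) = (qq TYPE('a))\<^sup>2"
proof -
  obtain r where r: "CARD('a) = r\<^sup>2"
    using card_square by blast
  then have "\<exists>!r. CARD('a) = r\<^sup>2"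
    by (intro ex1I[of _ r]) (auto dest: power2_eq_imp_eq)
  then show ?thesis
    unfolding qq_def by (rule theI')
qed

lemma qq_eqI: "CARD('a::square_field) = r\<^sup>2 \<Longrightarrow> qq TYPE('a) = r"
  using qq_square[where 'a = 'a] by (metis power2_eq_imp_eq zero_le)

lemma qq_ge_2: "qq TYPE('a::square_field) \<ge> 2"
proof (rule ccontr)
  assume "\<not> ?thesis"
  then have "qq TYPE('a) \<le> 1" by simp
  then have "(qq TYPE('a))\<^sup>2 \<le> 1" by (metis power_mono power_one zero_le)
  moreover have "card {0, 1 :: 'a} \<le> CARD('a)"
    by (intro card_mono) auto
  ultimately show False
    using qq_square[where 'a = 'a] by simp
qed

text \<open>
  An element of \<^typ>\<open>'a poly poly\<close> is a polynomial in \<open>y\<close> whose coefficients are polynomials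
  in \<open>x\<close>. The affine coordinate ring of the chart \<open>Z = 1\<close> is the quotient by the prime element
  \<open>x\<^sup>q\<^sup>+\<^sup>1 - y\<^sup>q - y\<close>, and the function field is its field of fractions. The lemmas
  with \<open>phi\<close> prove primality by comparing leading terms after
  \<open>x \<mapsto> T\<^sup>q\<close>, \<open>y \<mapsto> u T\<^sup>q\<^sup>+\<^sup>1\<close> (the pole orders at infinity).
\<close>

definition herm_poly :: "'a::square_field poly poly" where
  "herm_poly = [:monom 1 (qq TYPE('a) + 1):] - monom 1 (qq TYPE('a)) - monom 1 1"

context
begin

private definition phi1 :: "nat \<Rightarrow> 'a::field poly \<Rightarrow> 'a poly poly" where
  "phi1 q a = (\<Sum>i\<le>degree a. monom [:coeff a i:] (q * i))"

private lemma phi1_alt: "phi1 q a = poly (map_poly (\<lambda>c. [:[:c:]:]) a) (monom 1 q)"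
proof -
  have d: "degree (map_poly (\<lambda>c. [:[:c:]:]) a) = degree a"
    by (rule degree_map_poly) auto
  show ?thesis
    unfolding phi1_def poly_altdef d
    by (intro sum.cong refl) (simp add: coeff_map_poly monom_power smult_monom)
qed

private definition phi :: "nat \<Rightarrow> 'a::field poly poly \<Rightarrow> 'a poly poly" where
  "phi q G = poly (map_poly (phi1 q) G) (monom [:0, 1:] (q + 1))"

private lemma map_poly_hom_mult:
  fixes f :: "'b::comm_ring_1 \<Rightarrow> 'c::comm_ring_1"
  assumes "f 0 = 0" "\<And>x y. f (x + y) = f x + f y" "\<And>x y. f (x * y) = f x * f y"
  shows "map_poly f (p * r) = map_poly f p * map_poly f r"
proof -
  have s: "f (sum g A) = (\<Sum>x\<in>A. f (g x))" if "finite A" for g :: "nat \<Rightarrow> 'b" and A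
    using that by (induction rule: finite_induct) (simp_all add: assms)
  show ?thesis
    by (rule poly_eqI) (simp add: coeff_map_poly coeff_mult assms s)
qed

private lemma map_poly_hom_add:
  fixes f :: "'b::comm_ring_1 \<Rightarrow> 'c::comm_ring_1"
  assumes "f 0 = 0" "\<And>x y. f (x + y) = f x + f y"
  shows "map_poly f (p + r) = map_poly f p + map_poly f r"
  by (rule poly_eqI) (simp add: coeff_map_poly assms)

private lemma phi1_add: "phi1 q (a + b) = phi1 q a + phi1 q b"
  unfolding phi1_alt by (subst map_poly_hom_add) auto

private lemma phi1_mult: "phi1 q (a * b) = phi1 q a * phi1 q b"
  unfolding phi1_alt by (subst map_poly_hom_mult) auto

private lemma phi1_0: "phi1 q 0 = 0"
  by (simp add: phi1_def)

private lemma phi1_monom: "phi1 q (monom c n) = monom [:c:] (q * n)"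
  unfolding phi1_alt
  by (simp add: map_poly_monom poly_monom monom_power smult_monom)

private lemma phi1_one: "phi1 q 1 = 1"
  using phi1_monom[of q 1 0] by (simp add: monom_0 one_pCons)

private lemma phi_mult: "phi q (G * H) = phi q G * phi q H"
  unfolding phi_def by (subst map_poly_hom_mult) (auto simp: phi1_0 phi1_add phi1_mult)

private lemma phi_add: "phi q (G + H) = phi q G + phi q H"
  unfolding phi_def by (subst map_poly_hom_add) (auto simp: phi1_0 phi1_add)

private lemma one_monom_power: "[:0, 1:] ^ n = (monom 1 n :: 'a::comm_semiring_1 poly)"
  by (induction n) (simp_all add: monom_Suc monom_0 one_pCons)

private lemma phi_monom: "phi q (monom a n) = phi1 q a * monom (monom 1 n) ((q + 1) * n)"
  unfolding phi_def
  by (simp add: map_poly_monom phi1_0 poly_monom monom_power one_monom_power)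

private lemma phi_sum: "finite A \<Longrightarrow> phi q (sum g A) = (\<Sum>x\<in>A. phi q (g x))"
  by (induction rule: finite_induct) (simp_all add: phi_add, simp add: phi_def)

private lemma phi_uminus: "phi q (- G) = - phi q G"
proof -
  have "phi q (- G) + phi q G = phi q 0"
    by (subst phi_add[symmetric]) simp
  then show ?thesis
    by (simp add: phi_def eq_neg_iff_add_eq_0)
qed

private lemma phi_expand:
  "phi q G = (\<Sum>j\<le>degree G. \<Sum>i\<le>degree (coeff G j).
     monom (monom (coeff (coeff G j) i) j) (q * i + (q + 1) * j))"
proof -
  have "phi q G = phi q (\<Sum>j\<le>degree G. monom (coeff G j) j)"
    by (simp add: poly_as_sum_of_monoms)
  also have "\<dots> = (\<Sum>j\<le>degree G. phi1 q (coeff G j) * monom (monom 1 j) ((q + 1) * j))"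
    by (simp add: phi_sum phi_monom)
  also have "\<dots> = (\<Sum>j\<le>degree G. \<Sum>i\<le>degree (coeff G j).
     monom (monom (coeff (coeff G j) i) j) (q * i + (q + 1) * j))"
    unfolding phi1_def sum_distrib_right
    by (intro sum.cong refl) (simp add: mult_monom smult_monom)
  finally show ?thesis .
qed

private lemma weight_inj:
  assumes "j < q" "j' < q" "q * i + (q + 1) * j = q * i' + (q + 1) * j'"
  shows "i = i' \<and> j = (j'::nat)"
proof -
  have "(q * i + (q + 1) * j) mod q = j" if "j < q" for i j
  proof -
    have "q * i + (q + 1) * j = j + q * (i + j)" by (simp add: algebra_simps)
    then show ?thesis using that by simp
  qed
  then have "j = j'" using assms by metis
  then show ?thesis using assms by auto
qed

private lemma phi_coeff_weight:
  fixes G :: "'a::field poly poly"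
  assumes "degree G < q" "j0 < q"
  shows "coeff (phi q G) (q * i0 + (q + 1) * j0) = monom (coeff (coeff G j0) i0) j0"
proof -
  have "coeff (phi q G) (q * i0 + (q + 1) * j0) = (\<Sum>j\<le>degree G. \<Sum>i\<le>degree (coeff G j).
      if i = i0 \<and> j = j0 then monom (coeff (coeff G j) i) j else 0)"
    unfolding phi_expand coeff_sum coeff_monom
  proof (intro sum.cong refl if_cong)
    fix j i
    assume "j \<in> {..degree G}"
    then have "j < q" using assms by simp
    then show "(q * i + (q + 1) * j = q * i0 + (q + 1) * j0) = (i = i0 \<and> j = j0)"
      using weight_inj[OF _ assms(2)] by blast
  qed
  also have "\<dots> = (\<Sum>j\<le>degree G. if j = j0 then
      (if i0 \<le> degree (coeff G j) then monom (coeff (coeff G j) i0) j else 0) else 0)"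
    by (intro sum.cong refl) auto
  also have "\<dots> = monom (coeff (coeff G j0) i0) j0"
    by (auto simp: coeff_eq_0)
  finally show ?thesis .
qed

private lemma phi_coeff_reduced:
  fixes G :: "'a::field poly poly"
  assumes "degree G < q"
  shows "\<exists>c j. coeff (phi q G) n = monom c j"
proof (cases "\<exists>i j. j < q \<and> n = q * i + (q + 1) * j")
  case False
  have "coeff (phi q G) n = 0"
    unfolding phi_expand coeff_sum coeff_monom
  proof (intro sum.neutral ballI if_not_P)
    fix j i
    assume "j \<in> {..degree G}"
    then have "j < q" using assms by simp
    then show "q * i + (q + 1) * j \<noteq> n" using False by blast
  qed
  then show ?thesis
    by (intro exI[of _ 0]) simp
next
  case True
  then show ?thesis
    using phi_coeff_weight[OF assms] by blast
qed

private lemma phi_reduced_nz: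
  fixes G :: "'a::field poly poly"
  assumes "degree G < q" "G \<noteq> 0"
  shows "phi q G \<noteq> 0"
proof
  assume z: "phi q G = 0"
  define j0 where "j0 = degree G"
  define i0 where "i0 = degree (coeff G j0)"
  have "coeff (coeff G j0) i0 = 0"
    using phi_coeff_weight[of G q j0 i0] assms z by (simp add: j0_def monom_eq_0_iff)
  then show False
    using assms by (simp add: i0_def j0_def)
qed

private lemma phi_reduced_lead:
  fixes G :: "'a::field poly poly"
  assumes "degree G < q" "G \<noteq> 0"
  shows "poly (lead_coeff (phi q G)) 1 \<noteq> 0"
proof -
  obtain c j where "lead_coeff (phi q G) = monom c j"
    using phi_coeff_reduced[OF assms(1)] by blast
  moreover have "lead_coeff (phi q G) \<noteq> 0"
    using phi_reduced_nz[OF assms] by simp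
  ultimately show ?thesis
    by (auto simp: poly_monom)
qed

lemma degree_herm_poly: "degree (herm_poly :: 'a::square_field poly poly) = qq TYPE('a)"
  and lead_coeff_herm_poly: "lead_coeff (herm_poly :: 'a::square_field poly poly) = -1"
proof -
  have q: "qq TYPE('a) \<ge> 2" by (rule qq_ge_2)
  have le: "degree (herm_poly :: 'a poly poly) \<le> qq TYPE('a)"
    by (rule degree_le) (use q in \<open>auto simp: herm_poly_def coeff_pCons split: nat.splits\<close>)
  have c: "coeff (herm_poly :: 'a poly poly) (qq TYPE('a)) = -1"
    using q by (auto simp: herm_poly_def coeff_pCons split: nat.splits)
  show d: "degree (herm_poly :: 'a poly poly) = qq TYPE('a)"
    using le c le_degree[of "herm_poly :: 'a poly poly" "qq TYPE('a)"] by simp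
  show "lead_coeff (herm_poly :: 'a poly poly) = -1"
    by (simp add: d c)
qed

private lemma phi_herm_poly_lead:
  "poly (lead_coeff (phi (qq TYPE('a)) (herm_poly :: 'a::square_field poly poly))) 1 = 0"
proof -
  define q where "q = qq TYPE('a)"
  have q: "q \<ge> 2" unfolding q_def by (rule qq_ge_2)
  have 1: "(herm_poly :: 'a poly poly) = monom (monom 1 (q + 1)) 0 + (- monom 1 q + - monom 1 1)"
    by (simp add: herm_poly_def q_def monom_0)
  have 2: "phi q (monom (monom 1 (q + 1)) 0) = (monom 1 (q * (q + 1)) :: 'a poly poly)"
    by (simp only: phi_monom phi1_monom mult_monom) (simp add: monom_0 one_pCons)
  have 3: "phi q (monom 1 n) = (monom (monom 1 n) ((q + 1) * n) :: 'a poly poly)" for n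
    by (simp add: phi_monom phi1_one)
  have "phi q (herm_poly :: 'a poly poly) =
      monom 1 (q * (q + 1)) - monom (monom 1 q) ((q + 1) * q) - monom (monom 1 1) (q + 1)"
    unfolding 1 phi_add phi_uminus 2 3 by simp
  then have e: "phi q (herm_poly :: 'a poly poly) =
      monom (1 - monom 1 q) (q * (q + 1)) - monom (monom 1 1) (q + 1)"
    by (simp add: diff_monom mult.commute)
  have "q + 1 < 2 * (q + 1)" by simp
  also have "\<dots> \<le> q * (q + 1)" by (rule mult_right_mono) (use q in auto)
  finally have gt: "q + 1 < q * (q + 1)" .
  have "coeff (1 - monom 1 q :: 'a poly) 0 = 1"
    using q by simp
  then have nz: "(1 - monom 1 q :: 'a poly) \<noteq> 0"
    by (metis coeff_0 zero_neq_one)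
  have c: "coeff (phi q (herm_poly :: 'a poly poly)) (q * (q + 1)) = 1 - monom 1 q"
    unfolding e using gt q by (simp del: mult_Suc_right add: algebra_simps)
  have "degree (phi q (herm_poly :: 'a poly poly)) \<le> q * (q + 1)"
    unfolding e
    by (intro degree_diff_le order.trans[OF degree_monom_le] order.refl less_imp_le gt)
  moreover have "q * (q + 1) \<le> degree (phi q (herm_poly :: 'a poly poly))"
    by (rule le_degree) (simp only: c nz not_False_eq_True)
  ultimately have "lead_coeff (phi q (herm_poly :: 'a poly poly)) = 1 - monom 1 q"
    using c by simp
  then show ?thesis
    by (simp add: q_def poly_monom)
qed

private lemma herm_poly_reduce:
  fixes G :: "'a::square_field poly poly"
  obtains Q R where "G = herm_poly * Q + R" "degree R < qq TYPE('a)"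
proof -
  let ?h = "herm_poly :: 'a poly poly"
  obtain Q R where QR: "pseudo_divmod G ?h = (Q, R)" by fastforce
  have h0: "?h \<noteq> 0" using lead_coeff_herm_poly[where 'a = 'a] by auto
  define k where "k = Suc (degree G) - degree ?h"
  have 1: "smult ((-1) ^ k) G = ?h * Q + R" and 2: "R = 0 \<or> degree R < degree ?h"
    using pseudo_divmod[OF h0 QR] by (simp_all add: lead_coeff_herm_poly k_def)
  have "((-1) ^ k * (-1) ^ k :: 'a poly) = 1"
    by (simp add: power_mult_distrib[symmetric])
  then have "G = smult ((-1) ^ k) (smult ((-1) ^ k) G)"
    by (simp only: smult_smult smult_1_left)
  also have "\<dots> = ?h * smult ((-1) ^ k) Q + smult ((-1) ^ k) R"
    by (simp only: 1 smult_add_right mult_smult_right)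
  finally have "G = ?h * smult ((-1) ^ k) Q + smult ((-1) ^ k) R" .
  moreover have "degree (smult ((-1) ^ k) R) < qq TYPE('a)"
    using 2 degree_smult_le[of "(-1) ^ k" R] qq_ge_2[where 'a = 'a] degree_herm_poly[where 'a = 'a]
    by (cases "R = 0") auto
  ultimately show thesis by (rule that)
qed

lemma prime_elem_herm_poly: "prime_elem (herm_poly :: 'a::square_field poly poly)"
proof (rule prime_elemI)
  let ?h = "herm_poly :: 'a poly poly"
  show h0: "?h \<noteq> 0" using lead_coeff_herm_poly[where 'a = 'a] by auto
  show "\<not> is_unit ?h"
  proof
    assume "is_unit ?h"
    then obtain c where "?h = [:c:]" by (blast elim: is_unit_polyE)
    then have "degree ?h = 0" by (metis degree_pCons_0)
    then show False
      using degree_herm_poly[where 'a = 'a] qq_ge_2[where 'a = 'a] by simp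
  qed
  fix G H :: "'a poly poly"
  assume "?h dvd G * H"
  define q where "q = qq TYPE('a)"
  obtain Q R where R: "G = ?h * Q + R" "degree R < q"
    using herm_poly_reduce[of G] unfolding q_def by blast
  obtain Q' R' where R': "H = ?h * Q' + R'" "degree R' < q"
    using herm_poly_reduce[of H] unfolding q_def by blast
  have "G * H = ?h * (Q * H + R * Q') + R * R'"
    by (simp add: R(1) R'(1) algebra_simps)
  with \<open>?h dvd G * H\<close> have "?h dvd R * R'"
    by (metis dvd_add_right_iff dvd_triv_left)
  then obtain S where S: "R * R' = ?h * S" by (elim dvdE)
  have "R = 0 \<or> R' = 0"
  proof (rule ccontr)
    assume nz: "\<not> ?thesis"
    have "phi q R * phi q R' = phi q ?h * phi q S"
      by (simp only: phi_mult[symmetric] S)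
    then have "lead_coeff (phi q R) * lead_coeff (phi q R') = lead_coeff (phi q ?h) * lead_coeff (phi q S)"
      by (simp only: lead_coeff_mult[symmetric])
    then have "poly (lead_coeff (phi q R)) 1 * poly (lead_coeff (phi q R')) 1
      = poly (lead_coeff (phi q ?h)) 1 * poly (lead_coeff (phi q S)) 1"
      by (simp only: poly_mult[symmetric])
    then show False
      using phi_herm_poly_lead[where 'a = 'a] phi_reduced_lead[OF R(2)] phi_reduced_lead[OF R'(2)] nz
      by (simp add: q_def)
  qed
  then show "?h dvd G \<or> ?h dvd H"
    using R(1) R'(1) by auto
qed

end

quotient_type (overloaded) 'a herm_ring = "'a::square_field poly poly" /
  "\<lambda>G H. herm_poly dvd G - H"
  morphisms rep_herm_ring coord
proof (rule equivpI)
  show "reflp (\<lambda>G H. (herm_poly :: 'a poly poly) dvd G - H)"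
    by (rule reflpI) simp
  show "symp (\<lambda>G H. (herm_poly :: 'a poly poly) dvd G - H)"
    by (rule sympI) (metis dvd_minus_iff minus_diff_eq)
  show "transp (\<lambda>G H. (herm_poly :: 'a poly poly) dvd G - H)"
    by (rule transpI) (metis dvd_add diff_add_cancel add_diff_eq)
qed

instantiation herm_ring :: (square_field) idom
begin

lift_definition zero_herm_ring :: "'a herm_ring" is 0 .
lift_definition one_herm_ring :: "'a herm_ring" is 1 .
lift_definition plus_herm_ring :: "'a herm_ring \<Rightarrow> 'a herm_ring \<Rightarrow> 'a herm_ring" is "(+)"
  by (metis add_diff_add dvd_add)
lift_definition uminus_herm_ring :: "'a herm_ring \<Rightarrow> 'a herm_ring" is uminus
  by (metis dvd_minus_iff minus_diff_minus)
lift_definition minus_herm_ring :: "'a herm_ring \<Rightarrow> 'a herm_ring \<Rightarrow> 'a herm_ring" is "(-)"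
  by (metis diff_diff_eq2 dvd_diff add_diff_eq diff_diff_add add.commute diff_add_eq)
lift_definition times_herm_ring :: "'a herm_ring \<Rightarrow> 'a herm_ring \<Rightarrow> 'a herm_ring" is "(*)"
proof -
  fix a b c d :: "'a poly poly"
  assume "herm_poly dvd a - b" "herm_poly dvd c - d"
  moreover have "a * c - b * d = (a - b) * c + b * (c - d)" by (simp add: algebra_simps)
  ultimately show "herm_poly dvd a * c - b * d" by simp
qed

instance
proof
  fix a b c :: "'a herm_ring"
  show "a + b + c = a + (b + c)" by transfer (simp add: algebra_simps)
  show "a + b = b + a" by transfer (simp add: algebra_simps)
  show "0 + a = a" by transfer simp
  show "- a + a = 0" by transfer simp
  show "a - b = a + - b" by transfer simp
  show "0 * a = 0" "a * 0 = 0" by (transfer; simp)+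
  show "a * (b + c) = a * b + a * c" by transfer (simp add: algebra_simps)
  show "a * b * c = a * (b * c)" by transfer (simp add: algebra_simps)
  show "a * b = b * a" by transfer (simp add: algebra_simps)
  show "1 * a = a" by transfer simp
  show "(a + b) * c = a * c + b * c" by transfer (simp add: algebra_simps)
  show "(0::'a herm_ring) \<noteq> 1"
  proof transfer
    have "\<not> (herm_poly :: 'a poly poly) dvd 1"
      using prime_elem_herm_poly by (rule prime_elem_not_unit)
    then show "\<not> (herm_poly :: 'a poly poly) dvd 0 - 1" by simp
  qed
  show "a \<noteq> 0 \<Longrightarrow> b \<noteq> 0 \<Longrightarrow> a * b \<noteq> 0"
    by transfer (simp add: prime_elem_dvd_mult_iff[OF prime_elem_herm_poly])
qed

end

type_synonym 'a herm_field = "'a herm_ring fract"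

definition herm_const :: "'a::square_field \<Rightarrow> 'a herm_field" where
  "herm_const c = Fract (coord [:[:c:]:]) 1"

text \<open>
  The points of the curve are its geometric points, with coordinates in the algebraic closure of
  the ground field; the divisor of a function has to be bounded at all of them, not only at the
  rational ones. A projective point is the set of its homogeneous coordinate vectors.
\<close>

type_synonym 'a geom_point = "('a alg_closure \<times> 'a alg_closure \<times> 'a alg_closure) set"

definition proj_point :: "'k::field \<Rightarrow> 'k \<Rightarrow> 'k \<Rightarrow> ('k \<times> 'k \<times> 'k) set" where
  "proj_point x y z = {(l * x, l * y, l * z) | l. l \<noteq> 0}"

definition herm_curve :: "'a::square_field geom_point set" where
  "herm_curve = {proj_point x y z | x y z. (x, y, z) \<noteq> (0, 0, 0) \<and>
     x ^ (qq TYPE('a) + 1) - y ^ qq TYPE('a) * z - y * z ^ qq TYPE('a) = 0}"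

definition rational_points :: "'a::square_field geom_point set" where
  "rational_points = {S \<in> herm_curve. \<exists>x y z. S = proj_point (to_ac x) (to_ac y) (to_ac z)}"

definition P_inf :: "'a::square_field geom_point" where
  "P_inf = proj_point 0 1 0"

definition P_aff :: "'a::square_field \<Rightarrow> 'a \<Rightarrow> 'a geom_point" where
  "P_aff \<alpha> \<beta> = proj_point (to_ac \<alpha>) (to_ac \<beta>) 1"

text \<open>
  A form of degree \<open>n\<close> in \<open>X, Y, Z\<close> over the ground field is given by \<open>n\<close> and its dehomogenisation
  \<open>G\<close> at \<open>Z = 1\<close>, a polynomial of total degree at most \<open>n\<close>.
\<close>

definition total_degree_le :: "nat \<Rightarrow> 'a::zero poly poly \<Rightarrow> bool" where
  "total_degree_le n G \<longleftrightarrow> (\<forall>i j. coeff (coeff G j) i \<noteq> 0 \<longrightarrow> i + j \<le> n)"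

fun form_eval ::
  "nat \<Rightarrow> 'a::field poly poly \<Rightarrow> 'a alg_closure \<times> 'a alg_closure \<times> 'a alg_closure \<Rightarrow> 'a alg_closure"
where
  "form_eval n G (x, y, z) =
     (\<Sum>j\<le>n. \<Sum>i\<le>n - j. to_ac (coeff (coeff G j) i) * x ^ i * y ^ j * z ^ (n - i - j))"

text \<open>
  \<open>f\<close> is regular at \<open>S\<close> with value \<open>z\<close>: it is a quotient of two forms of the same degree whose
  denominator does not vanish at \<open>S\<close>, and this quotient takes the value \<open>z\<close> at \<open>S\<close>.
\<close>

definition has_value :: "'a::square_field herm_field \<Rightarrow> 'a geom_point \<Rightarrow> 'a alg_closure \<Rightarrow> bool" where
  "has_value f S z \<longleftrightarrow> (\<exists>n G H. \<exists>v\<in>S. total_degree_le n G \<and> total_degree_le n H \<and>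
     f = Fract (coord G) (coord H) \<and> form_eval n H v \<noteq> 0 \<and> z = form_eval n G v / form_eval n H v)"

definition local_ring :: "'a::square_field geom_point \<Rightarrow> 'a herm_field set" where
  "local_ring S = {f. \<exists>z. has_value f S z}"

definition max_ideal :: "'a::square_field geom_point \<Rightarrow> 'a herm_field set" where
  "max_ideal S = {f. has_value f S 0}"

definition uniformizer :: "'a::square_field geom_point \<Rightarrow> 'a herm_field \<Rightarrow> bool" where
  "uniformizer S t \<longleftrightarrow> max_ideal S = {t * g | g. g \<in> local_ring S}"

text \<open>
  This is the valuation of the local ring at the closed point below \<open>S\<close>. It is also the order
  at \<open>S\<close> over the algebraic closure, because the ground field is perfect.
\<close>

definition ord_at :: "'a::square_field geom_point \<Rightarrow> 'a herm_field \<Rightarrow> int" where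
  "ord_at S f = (THE n. \<exists>t u. uniformizer S t \<and> u \<in> local_ring S \<and> inverse u \<in> local_ring S \<and>
     u \<noteq> 0 \<and> f = u * t powi n)"

type_synonym 'a divisor = "'a geom_point \<Rightarrow>\<^sub>0 int"

definition rr_space :: "'a::square_field divisor \<Rightarrow> 'a herm_field set" where
  "rr_space A = {f. f \<noteq> 0 \<and> (\<forall>S\<in>herm_curve. ord_at S f \<ge> - Poly_Mapping.lookup A S)} \<union> {0}"

definition has_basepoint :: "'a::square_field divisor \<Rightarrow> 'a geom_point \<Rightarrow> bool" where
  "has_basepoint D S \<longleftrightarrow> rr_space D = rr_space (D - Poly_Mapping.single S 1)"

definition div_of ::
  "'a::square_field geom_point \<Rightarrow> 'a geom_point \<Rightarrow> 'a geom_point \<Rightarrow> nat \<Rightarrow> nat \<Rightarrow> nat \<Rightarrow> 'a divisor"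
where
  "div_of P Q R a b c =
     Poly_Mapping.single P (int a) + Poly_Mapping.single Q (int b) + Poly_Mapping.single R (int c)"

definition effective_divisors ::
  "'a::square_field geom_point \<Rightarrow> 'a geom_point \<Rightarrow> 'a geom_point \<Rightarrow> 'a divisor set"
where
  "effective_divisors P Q R = {div_of P Q R a b c | a b c. True}"

definition pure_gaps ::
  "'a::square_field geom_point \<Rightarrow> 'a geom_point \<Rightarrow> 'a geom_point \<Rightarrow> (nat \<times> nat \<times> nat) set"
where
  "pure_gaps P Q R = {(a, b, c). has_basepoint (div_of P Q R a b c) P \<and>
     has_basepoint (div_of P Q R a b c) Q \<and> has_basepoint (div_of P Q R a b c) R}"

text \<open>
  An automorphism over the ground field is a bijection of the geometric points together with an
  automorphism of the function field (the comorphism \<open>f \<mapsto> f \<circ> \<sigma>\<close>), such that \<open>f\<close> is regular at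
  \<open>\<sigma> S\<close> with value \<open>z\<close> exactly if \<open>f \<circ> \<sigma>\<close> is regular at \<open>S\<close> with value \<open>z\<close>.
\<close>

definition herm_field_automorphism ::
  "('a::square_field herm_field \<Rightarrow> 'a herm_field) \<Rightarrow> bool"
where
  "herm_field_automorphism \<phi> \<longleftrightarrow> bij \<phi> \<and> (\<forall>f g. \<phi> (f + g) = \<phi> f + \<phi> g) \<and>
     (\<forall>f g. \<phi> (f * g) = \<phi> f * \<phi> g) \<and> (\<forall>c. \<phi> (herm_const c) = herm_const c)"

definition herm_automorphism :: "('a::square_field geom_point \<Rightarrow> 'a geom_point) \<Rightarrow> bool" where
  "herm_automorphism \<sigma> \<longleftrightarrow> bij_betw \<sigma> herm_curve herm_curve \<and>
     (\<exists>\<phi>. herm_field_automorphism \<phi> \<and>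
       (\<forall>S\<in>herm_curve. \<forall>f z. has_value f (\<sigma> S) z \<longleftrightarrow> has_value (\<phi> f) S z))"

definition hermitian_triangle :: "'a::square_field geom_point set \<Rightarrow> bool" where
  "hermitian_triangle T \<longleftrightarrow> T \<subseteq> rational_points \<and> card T = 3"

definition mult_order :: "'a::field \<Rightarrow> nat" where
  "mult_order x = (LEAST n. 0 < n \<and> x ^ n = 1)"

definition has_type :: "'a::square_field geom_point set \<Rightarrow> nat \<Rightarrow> bool" where
  "has_type T d \<longleftrightarrow> (\<exists>\<sigma> \<alpha> \<beta>. herm_automorphism \<sigma> \<and> \<sigma> ` T = {P_inf, P_aff 0 0, P_aff \<alpha> \<beta>} \<and>
     (\<alpha> = 0 \<or> \<alpha> = \<beta>) \<and> mult_order (1 - \<alpha>) = d)"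

definition h_fun :: "nat \<Rightarrow> nat \<Rightarrow> real" where
  "h_fun d q = (real d - 1) / (12 * real d) * (real q + 1) * (2 * real q ^ 2 - 5 * real q + 5 - real d)"

end

theory Submission
  imports "HOL-Number_Theory.Residues" Defs
begin

text \<open>
  The tangent at a rational point meets the curve there with multiplicity \<open>q + 1\<close>, so multiples of
  the points of a triangle can be moved to a divisor \<open>m H - i P - j Q - k R\<close> with \<open>i, j, k \<le> q + 1\<close>,
  where \<open>H\<close> is the class of a line, and the Riemann-Roch space consists of the forms of degree \<open>m\<close>
  vanishing to orders \<open>i, j, k\<close>. For orders up to \<open>q + 1\<close> vanishing on the curve is the same as
  vanishing on the tangent line. Hence everything depends only on the restrictions of a form to the
  three tangents, and three binary forms of degree \<open>m\<close> come from a ternary form exactly if they agree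
  where the tangents meet. If these are the sides of a triangle of lines, a binary form vanishing to
  order \<open>m\<close> at the marked point of its line has its two corner values in a fixed ratio; going round
  once, the ratios multiply to \<open>(1 - \<alpha>)\<^sup>m\<close>, and this is how the type enters.
\<close>

\<comment> \<open>Functions have coefficients in the ground field, but orders are tested at all
  geometric points, so each local ring belongs to a closed point. Its uniformizer is the minimal
  polynomial of the x-coordinate: \<open>x^(q+1) - y^q - y\<close> has y-derivative -1, so x is a
  local coordinate on the whole affine curve. Riemann-Roch spaces are found directly: a function
  without affine poles is a polynomial in x and y, and trading \<open>x^(q+1)\<close> for
  \<open>y^q + y\<close> bounds its degree by its pole order at infinity. A basepoint means that
  order i forces order i + 1, which the tangent detects only for i \<le> q; a coefficient with i = q
  + 1 is rewritten with i = 0 instead. The degree m is the sum of three positive quotients and the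
  criterion depends on them only through m, whence the weight (m - 1)(m - 2)/2 of each level m \<le>
  q + 1. The type enters only through the question whether d divides m, and \<open>h_fun d q\<close>
  is the weight of the levels m \<le> q that d does not divide. Concurrent tangents (\<alpha> = 0)
  impose a different gluing condition, but the criterion is the same with d = 1.\<close>
subclass (in square_field) finite_field
proof
  show "\<exists>n>0. of_nat n = (0 :: 'a)"
    using finite_imp_CHAR_pos[OF finite_UNIV] by (intro exI[of _ "CHAR('a)"]) auto
qed

section \<open>Evaluation of forms\<close>

lemma map_poly_hom_add:
  fixes f :: "'b::comm_ring_1 \<Rightarrow> 'c::comm_ring_1"
  assumes "f 0 = 0" "\<And>x y. f (x + y) = f x + f y"
  shows "map_poly f (p + r) = map_poly f p + map_poly f r"
  by (rule poly_eqI) (simp add: coeff_map_poly assms)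

lemma poly_map_poly_hom_mult:
  fixes f :: "'b::comm_ring_1 \<Rightarrow> 'c::comm_ring_1"
  assumes "f 0 = 0" "\<And>x y. f (x + y) = f x + f y" "\<And>x y. f (x * y) = f x * f y"
  shows "poly (map_poly f (p * r)) c = poly (map_poly f p) c * poly (map_poly f r) c"
proof (induction p)
  case (pCons a p)
  have s: "map_poly f (smult a r) = smult (f a) (map_poly f r)"
    by (rule poly_eqI) (simp add: coeff_map_poly assms)
  have t: "map_poly f (pCons b p) = pCons (f b) (map_poly f p)" for b p
    by (rule poly_eqI) (simp add: coeff_map_poly coeff_pCons assms split: nat.splits)
  show ?case
    using pCons.IH by (simp add: map_poly_hom_add assms(1,2) s t algebra_simps)
qed simp

abbreviation ac_poly :: "'a::field poly \<Rightarrow> 'a alg_closure \<Rightarrow> 'a alg_closure" where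
  "ac_poly p a \<equiv> poly (map_poly to_ac p) a"

lemma ac_poly_add: "ac_poly (p + r) a = ac_poly p a + ac_poly r a"
  by (simp add: map_poly_hom_add)

lemma ac_poly_mult: "ac_poly (p * r) a = ac_poly p a * ac_poly r a"
  by (simp add: poly_map_poly_hom_mult)

lemma ac_poly_to_ac: "ac_poly p (to_ac a) = to_ac (poly p a)"
  by (induction p) (auto simp: map_poly_pCons)

definition ev :: "'a alg_closure \<Rightarrow> 'a alg_closure \<Rightarrow> 'a::field poly poly \<Rightarrow> 'a alg_closure" where
  "ev a b G = poly (map_poly (\<lambda>c. ac_poly c a) G) b"

lemma ev_add: "ev a b (G + H) = ev a b G + ev a b H"
  by (simp add: ev_def map_poly_hom_add ac_poly_add)

lemma ev_mult: "ev a b (G * H) = ev a b G * ev a b H"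
  by (simp add: ev_def poly_map_poly_hom_mult ac_poly_add ac_poly_mult)

lemma ev_pCons: "ev a b (pCons c G) = ac_poly c a + b * ev a b G"
  by (simp add: ev_def map_poly_pCons)

lemma ev_0 [simp]: "ev a b 0 = 0"
  by (simp add: ev_def)

lemma ev_const: "ev a b [:c:] = ac_poly c a"
  by (simp add: ev_pCons)

lemma ev_1 [simp]: "ev a b 1 = 1"
  by (simp add: one_pCons ev_pCons map_poly_pCons)

lemma ev_uminus: "ev a b (- G) = - ev a b G"
  using ev_add[of a b "- G" G] by (simp add: eq_neg_iff_add_eq_0)

lemma ev_diff: "ev a b (G - H) = ev a b G - ev a b H"
  using ev_add[of a b G "- H"] by (simp add: ev_uminus)

lemma monom_eq_power: "monom 1 n = ([:0, 1:] :: 'a::comm_semiring_1 poly) ^ n"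
  by (simp add: monom_altdef)

lemma ac_poly_monom: "ac_poly (monom c n) a = to_ac c * a ^ n"
  by (simp add: map_poly_monom poly_monom)

lemma ev_monom: "ev a b (monom c n) = ac_poly c a * b ^ n"
  by (simp add: ev_def map_poly_monom poly_monom)

lemma poly_sum_atMost:
  fixes p :: "'a::comm_semiring_1 poly"
  assumes "degree p \<le> n"
  shows "poly p x = (\<Sum>i\<le>n. coeff p i * x ^ i)"
  unfolding poly_altdef using assms
  by (intro sum.mono_neutral_left) (auto simp: coeff_eq_0)

lemma total_degree_le_degree: "total_degree_le n G \<Longrightarrow> degree G \<le> n"
proof (rule degree_le, intro allI impI)
  fix j assume G: "total_degree_le n G" and "n < j"
  then have "coeff (coeff G j) i = 0" for i
    unfolding total_degree_le_def by (metis add_leE not_le)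
  then show "coeff G j = 0" by (simp add: poly_eq_iff)
qed

lemma total_degree_le_degree_coeff: "total_degree_le n G \<Longrightarrow> degree (coeff G j) \<le> n - j"
  unfolding total_degree_le_def by (intro degree_le) fastforce

text \<open>The degree bound matters because \<open>form_eval\<close> only sums the monomials with
  \<open>i + j \<le> n\<close>; homogeneity then produces the factor \<open>z ^ n\<close>.\<close>

lemma form_eval_affine:
  assumes "total_degree_le n G"
  shows "form_eval n G (z * a, z * b, z) = z ^ n * ev a b G"
proof -
  have "ev a b G = (\<Sum>j\<le>n. ac_poly (coeff G j) a * b ^ j)"
    unfolding ev_def
    by (subst poly_sum_atMost[of _ n])
      (auto simp: coeff_map_poly intro: order.trans[OF map_poly_degree_leq total_degree_le_degree[OF assms]])
  also have "\<dots> = (\<Sum>j\<le>n. \<Sum>i\<le>n - j. to_ac (coeff (coeff G j) i) * a ^ i * b ^ j)"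
    by (subst poly_sum_atMost[OF order.trans[OF map_poly_degree_leq total_degree_le_degree_coeff[OF assms]]])
      (simp add: coeff_map_poly sum_distrib_right)
  finally have "z ^ n * ev a b G =
      (\<Sum>j\<le>n. \<Sum>i\<le>n - j. z ^ n * (to_ac (coeff (coeff G j) i) * a ^ i * b ^ j))"
    by (simp add: sum_distrib_left)
  also have "\<dots> = form_eval n G (z * a, z * b, z)"
    unfolding form_eval.simps
  proof (intro sum.cong refl)
    fix j i assume "j \<in> {..n}" "i \<in> {..n - j}"
    then have "n = i + j + (n - i - j)" by simp
    then have "z ^ n = z ^ i * z ^ j * z ^ (n - i - j)" by (metis power_add)
    then show "z ^ n * (to_ac (coeff (coeff G j) i) * a ^ i * b ^ j) =
        to_ac (coeff (coeff G j) i) * (z * a) ^ i * (z * b) ^ j * z ^ (n - i - j)"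
      by (simp add: power_mult_distrib mult_ac)
  qed
  finally show ?thesis ..
qed

text \<open>Only the monomial \<open>Y ^ n\<close> survives at this point, so values at infinity
  depend on a single coefficient, later called \<open>corner\<close>.\<close>

lemma form_eval_infinity:
  "form_eval n G (0, b, 0) = to_ac (coeff (coeff G n) 0) * b ^ n"
proof -
  have "form_eval n G (0, b, 0) = (\<Sum>j\<le>n. if j = n then to_ac (coeff (coeff G j) 0) * b ^ j else 0)"
    unfolding form_eval.simps
  proof (intro sum.cong refl)
    fix j assume j: "j \<in> {..n}"
    have "(\<Sum>i\<le>n - j. to_ac (coeff (coeff G j) i) * 0 ^ i * b ^ j * 0 ^ (n - i - j)) =
        (\<Sum>i\<le>n - j. if i = 0 then (if j = n then to_ac (coeff (coeff G j) 0) * b ^ j else 0) else 0)"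
      using j by (intro sum.cong refl) (auto simp: power_0_left)
    then show "(\<Sum>i\<le>n - j. to_ac (coeff (coeff G j) i) * 0 ^ i * b ^ j * 0 ^ (n - i - j)) =
        (if j = n then to_ac (coeff (coeff G j) 0) * b ^ j else 0)"
      by simp
  qed
  then show ?thesis by simp
qed

lemma total_degree_le_mono: "total_degree_le m G \<Longrightarrow> m \<le> n \<Longrightarrow> total_degree_le n G"
  unfolding total_degree_le_def by fastforce

lemma total_degree_le_add: "total_degree_le n G \<Longrightarrow> total_degree_le n H \<Longrightarrow> total_degree_le n (G + H)"
  unfolding total_degree_le_def by (metis add.right_neutral coeff_add)

lemma total_degree_le_uminus: "total_degree_le n G \<Longrightarrow> total_degree_le n (- G)"
  unfolding total_degree_le_def by simp

lemma total_degree_le_diff: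
  fixes G H :: "'a::ab_group_add poly poly"
  shows "total_degree_le n G \<Longrightarrow> total_degree_le n H \<Longrightarrow> total_degree_le n (G - H)"
  unfolding total_degree_le_def by (metis coeff_diff diff_zero)

lemma total_degree_le_0 [simp]: "total_degree_le n 0"
  by (simp add: total_degree_le_def)

lemma total_degree_le_monom: "i + j \<le> n \<Longrightarrow> total_degree_le n (monom (monom c i) j)"
  by (auto simp: total_degree_le_def)

lemma total_degree_le_const: "degree p \<le> n \<Longrightarrow> total_degree_le n [:p:]"
  by (auto simp: total_degree_le_def coeff_pCons split: nat.splits dest: le_degree)

lemma coeff_coeff_mult:
  "coeff (coeff (G * H) j) i = (\<Sum>b\<le>j. \<Sum>a\<le>i. coeff (coeff G b) a * coeff (coeff H (j - b)) (i - a))"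
  by (simp add: coeff_mult coeff_sum)

lemma total_degree_le_mult:
  fixes G H :: "'a::comm_semiring_1 poly poly"
  assumes "total_degree_le n G" "total_degree_le m H"
  shows "total_degree_le (n + m) (G * H)"
  unfolding total_degree_le_def
proof (intro allI impI, rule ccontr)
  fix i j assume nz: "coeff (coeff (G * H) j) i \<noteq> 0" and gt: "\<not> i + j \<le> n + m"
  have "coeff (coeff G b) a * coeff (coeff H (j - b)) (i - a) = 0" if "b \<le> j" "a \<le> i" for a b
  proof (rule ccontr)
    assume "\<not> ?thesis"
    then have "coeff (coeff G b) a \<noteq> 0" "coeff (coeff H (j - b)) (i - a) \<noteq> 0" by auto
    then have "a + b \<le> n" "(i - a) + (j - b) \<le> m"
      using assms by (auto simp: total_degree_le_def)
    then show False using gt that by linarith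
  qed
  then have "coeff (coeff (G * H) j) i = 0"
    by (simp add: coeff_coeff_mult)
  with nz show False ..
qed

lemma ex_total_degree_le: "\<exists>n. total_degree_le n G"
proof
  define n where "n = degree G + Max ((\<lambda>j. degree (coeff G j)) ` {..degree G})"
  have "i + j \<le> n" if nz: "coeff (coeff G j) i \<noteq> 0" for i j
  proof -
    have "j \<le> degree G" using nz by (metis coeff_0 le_degree)
    moreover have "i \<le> degree (coeff G j)" using nz by (rule le_degree)
    moreover have "degree (coeff G j) \<le> Max ((\<lambda>j. degree (coeff G j)) ` {..degree G})"
      using \<open>j \<le> degree G\<close> by (intro Max_ge) auto
    ultimately show ?thesis unfolding n_def by linarith
  qed
  then show "total_degree_le n G" by (simp add: total_degree_le_def)
qed

text \<open>The monomial \<open>y ^ (n + m)\<close> can only arise as \<open>y ^ n\<close> times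
  \<open>y ^ m\<close>, since any other splitting exceeds the degree bound of one factor. This makes
  values at infinity multiplicative.\<close>

lemma corner_mult:
  fixes G H :: "'a::comm_semiring_1 poly poly"
  assumes "total_degree_le n G" "total_degree_le m H"
  shows "coeff (coeff (G * H) (n + m)) 0 = coeff (coeff G n) 0 * coeff (coeff H m) 0"
proof -
  have "coeff (coeff (G * H) (n + m)) 0 =
      (\<Sum>b\<le>n + m. if b = n then coeff (coeff G n) 0 * coeff (coeff H m) 0 else 0)"
    unfolding coeff_coeff_mult
  proof (intro sum.cong refl)
    fix b assume "b \<in> {..n + m}"
    moreover have "coeff (coeff G b) 0 = 0" if "b > n"
      using assms(1) that unfolding total_degree_le_def by (metis add_0 not_le)
    moreover have "coeff (coeff H (n + m - b)) 0 = 0" if "b < n"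
    proof (rule ccontr)
      assume "\<not> ?thesis"
      then have "n + m - b \<le> m" using assms(2) unfolding total_degree_le_def by (metis add_0)
      then show False using that by linarith
    qed
    ultimately show "(\<Sum>a\<le>0. coeff (coeff G b) a * coeff (coeff H (n + m - b)) (0 - a)) =
        (if b = n then coeff (coeff G n) 0 * coeff (coeff H m) 0 else 0)"
      by (cases b n rule: linorder_cases) auto
  qed
  then show ?thesis by simp
qed

section \<open>The coordinate ring\<close>

lemma coord_add: "coord (G + H) = coord G + coord H"
  by (rule plus_herm_ring.abs_eq[symmetric])

lemma coord_mult: "coord (G * H) = coord G * coord H"
  by (rule times_herm_ring.abs_eq[symmetric])

lemma coord_diff: "coord (G - H) = coord G - coord H"
  by (rule minus_herm_ring.abs_eq[symmetric])

lemma coord_uminus: "coord (- G) = - coord G"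
  by (rule uminus_herm_ring.abs_eq[symmetric])

lemma coord_0 [simp]: "coord 0 = 0"
  by (simp add: zero_herm_ring_def)

lemma coord_1 [simp]: "coord 1 = 1"
  by (simp add: one_herm_ring_def)

lemma coord_power: "coord (G ^ n) = coord G ^ n"
  by (induction n) (simp_all add: coord_mult)

lemma coord_eq_iff: "coord G = coord H \<longleftrightarrow> herm_poly dvd G - H"
  by (rule herm_ring.abs_eq_iff)

lemma coord_eq_0_iff: "coord G = 0 \<longleftrightarrow> herm_poly dvd G"
  using coord_eq_iff[of G 0] by simp

lemma coord_surj: "\<exists>G. g = coord G"
  by (metis Quotient3_herm_ring Quotient3_def)

definition emb :: "'a::square_field poly \<Rightarrow> 'a herm_ring" where
  "emb p = coord [:p:]"

definition YY :: "'a::square_field herm_ring" where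
  "YY = coord [:0, 1:]"

lemma emb_add: "emb (p + r) = emb p + emb r"
  by (simp add: emb_def flip: coord_add)

lemma emb_mult: "emb (p * r) = emb p * emb r"
  by (simp add: emb_def mult.commute flip: coord_mult)

lemma emb_0 [simp]: "emb 0 = 0"
  by (simp add: emb_def)

lemma emb_1 [simp]: "emb 1 = 1"
  by (simp add: emb_def flip: one_pCons)

lemma emb_uminus: "emb (- p) = - emb p"
  by (simp add: emb_def flip: coord_uminus)

lemma emb_diff: "emb (p - r) = emb p - emb r"
  by (simp add: emb_def flip: coord_diff)

lemma emb_power: "emb (p ^ n) = emb p ^ n"
  by (induction n) (simp_all add: emb_mult)

lemma coord_pCons: "coord (pCons p G) = emb p + YY * coord G"
proof -
  have "pCons p G = [:p:] + [:0, 1:] * G" by simp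
  then show ?thesis by (metis coord_add coord_mult emb_def YY_def)
qed

abbreviation XX :: "'a::square_field herm_ring" where
  "XX \<equiv> emb [:0, 1:]"

lemma coord_monom: "coord (monom p n) = emb p * YY ^ n"
proof -
  have "monom p n = [:p:] * [:0, 1:] ^ n" by (simp add: monom_altdef)
  then show ?thesis by (metis coord_mult coord_power emb_def YY_def)
qed

lemma emb_monom: "emb (monom c n) = emb [:c:] * XX ^ n"
  by (simp add: monom_altdef emb_mult[symmetric] emb_power[symmetric])

text \<open>Reduced representatives are unique: over the polynomials in x the coordinate ring is
  free with basis \<open>1, ..., y ^ (q - 1)\<close>.\<close>

lemma herm_dvd_degree_less_imp_0:
  fixes G :: "'a::square_field poly poly"
  assumes "herm_poly dvd G" "degree G < qq TYPE('a)"
  shows "G = 0"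
  using assms dvd_imp_degree_le[of herm_poly G] degree_herm_poly[where 'a = 'a] by force

lemma emb_eq_0_iff [simp]: "emb p = 0 \<longleftrightarrow> p = 0"
proof
  assume "emb p = 0"
  then have "herm_poly dvd [:p:]" by (simp add: emb_def coord_eq_0_iff)
  then show "p = 0"
    using herm_dvd_degree_less_imp_0[of "[:p:]"] qq_ge_2[where 'a = 'a] by simp
qed simp

lemma herm_poly_nz [simp]: "herm_poly \<noteq> (0 :: 'a::square_field poly poly)"
  using lead_coeff_herm_poly[where 'a = 'a] by auto

text \<open>As \<open>herm_poly\<close> has leading coefficient -1, the factor introduced by
  pseudo-division is a sign, and multiplying by it once more removes it.\<close>

lemma ex_reduced:
  fixes g :: "'a::square_field herm_ring"
  obtains G where "g = coord G" "degree G < qq TYPE('a)"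
proof -
  obtain G0 where G0: "g = coord G0" using coord_surj by blast
  obtain Q R where QR: "pseudo_divmod G0 (herm_poly :: 'a poly poly) = (Q, R)" by fastforce
  define k where "k = Suc (degree G0) - degree (herm_poly :: 'a poly poly)"
  have 1: "smult ((-1) ^ k) G0 = herm_poly * Q + R" and 2: "R = 0 \<or> degree R < degree (herm_poly :: 'a poly poly)"
    using pseudo_divmod[OF herm_poly_nz QR] by (simp_all add: lead_coeff_herm_poly k_def)
  have "((-1) ^ k * (-1) ^ k :: 'a poly) = 1"
    by (simp add: power_mult_distrib[symmetric])
  then have "G0 = smult ((-1) ^ k) (smult ((-1) ^ k) G0)"
    by (simp only: smult_smult smult_1_left)
  also have "\<dots> = herm_poly * smult ((-1) ^ k) Q + smult ((-1) ^ k) R"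
    by (simp only: 1 smult_add_right mult_smult_right)
  finally have "g = coord (smult ((-1) ^ k) R)"
    unfolding G0 coord_eq_iff by (metis add_diff_cancel_right' dvd_triv_left)
  moreover have "degree (smult ((-1) ^ k) R) < qq TYPE('a)"
    using 2 degree_smult_le[of "(-1) ^ k" R] qq_ge_2[where 'a = 'a] degree_herm_poly[where 'a = 'a]
    by (cases "R = 0") auto
  ultimately show thesis by (rule that)
qed

text \<open>
  A combination \<open>A * G + B * herm_poly\<close> of minimal degree in \<open>y\<close> is free of \<open>y\<close>: otherwise
  pseudo-division of \<open>herm_poly\<close> by it would produce a smaller one.
\<close>
lemma ex_emb_multiple:
  fixes g :: "'a::square_field herm_ring"
  assumes "g \<noteq> 0"
  obtains p g' where "p \<noteq> 0" "emb p = g * g'"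
proof -
  define I where "I = {B :: 'a poly poly. B \<noteq> 0 \<and> degree B < qq TYPE('a) \<and> g dvd coord B}"
  obtain G where G: "g = coord G" "degree G < qq TYPE('a)" by (rule ex_reduced)
  then have "G \<in> I" using assms by (auto simp: I_def)
  then obtain B where B: "B \<in> I" and min: "\<And>B'. B' \<in> I \<Longrightarrow> degree B \<le> degree B'"
    using ex_has_least_nat[of "\<lambda>B. B \<in> I" G degree] by blast
  have "degree B = 0"
  proof (rule ccontr)
    assume d: "degree B \<noteq> 0"
    have B0: "B \<noteq> 0" and dB: "degree B < qq TYPE('a)" using B by (auto simp: I_def)
    obtain A R where AR: "pseudo_divmod (herm_poly :: 'a poly poly) B = (A, R)" by fastforce
    define k where "k = Suc (degree (herm_poly :: 'a poly poly)) - degree B"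
    have 1: "smult (lead_coeff B ^ k) herm_poly = B * A + R" and 2: "R = 0 \<or> degree R < degree B"
      using pseudo_divmod[OF B0 AR] by (simp_all add: k_def)
    have "R = smult (lead_coeff B ^ k) herm_poly - B * A" using 1 by simp
    then have "coord R = - (coord B * coord A)"
      by (simp add: coord_diff coord_mult coord_eq_0_iff dvd_smult)
    then have "g dvd coord R" using B by (auto simp: I_def)
    have "R = 0"
    proof (rule ccontr)
      assume "R \<noteq> 0"
      with 2 dB \<open>g dvd coord R\<close> have "R \<in> I" by (auto simp: I_def)
      then show False using min[of R] 2 \<open>R \<noteq> 0\<close> by simp
    qed
    \<comment> \<open>With remainder zero, primality makes \<open>herm_poly\<close> divide the
      quotient \<open>A\<close>; comparing degrees in y then leaves degree 0 for
      \<open>B\<close>.\<close>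
    then have BA: "B * A = smult (lead_coeff B ^ k) herm_poly" using 1 by simp
    then have "herm_poly dvd B * A" by (simp add: dvd_smult)
    then have "herm_poly dvd B \<or> herm_poly dvd A"
      using prime_elem_dvd_mult_iff[OF prime_elem_herm_poly] by blast
    then have "herm_poly dvd A"
      using herm_dvd_degree_less_imp_0[OF _ dB] B0 by blast
    moreover have "A \<noteq> 0" using BA B0 by auto
    ultimately have "degree (herm_poly :: 'a poly poly) \<le> degree A"
      by (rule dvd_imp_degree_le)
    moreover have "degree B + degree A = degree (herm_poly :: 'a poly poly)"
      using arg_cong[OF BA, of degree] \<open>A \<noteq> 0\<close> B0 by (simp add: degree_mult_eq)
    ultimately show False using d by simp
  qed
  then obtain p where p: "B = [:p:]" by (rule degree_eq_zeroE)
  show thesis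
  proof (rule that[of p])
    show "p \<noteq> 0" using B p by (auto simp: I_def)
    show "emb p = g * (SOME g'. emb p = g * g')"
      using B p by (auto simp: I_def emb_def dvd_def intro: someI)
  qed
qed

section \<open>Discrete valuations\<close>

text \<open>The axioms of a discrete valuation ring in terms of \<open>has_value\<close>, so that
  affine points and the point at infinity share one theory. \<open>value_0_imp_t_dvd\<close> says
  that \<open>t\<close> generates the maximal ideal; \<open>finite_order\<close> stands in for the
  Noetherian property, as it forbids division by \<open>t\<close> without end.\<close>

locale valued_point =
  fixes S :: "'a::square_field geom_point" and t :: "'a herm_field"
  assumes value_unique: "has_value f S z \<Longrightarrow> has_value f S w \<Longrightarrow> z = w"
    and value_1: "has_value 1 S 1"
    and value_add: "has_value f S z \<Longrightarrow> has_value g S w \<Longrightarrow> has_value (f + g) S (z + w)"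
    and value_mult: "has_value f S z \<Longrightarrow> has_value g S w \<Longrightarrow> has_value (f * g) S (z * w)"
    and value_uminus: "has_value f S z \<Longrightarrow> has_value (- f) S (- z)"
    and value_inverse: "has_value f S z \<Longrightarrow> z \<noteq> 0 \<Longrightarrow> has_value (inverse f) S (inverse z)"
    and value_t: "has_value t S 0"
    and t_nz: "t \<noteq> 0"
    and value_0_imp_t_dvd: "has_value f S 0 \<Longrightarrow> \<exists>g w. f = t * g \<and> has_value g S w"
    and ex_regular_quotient:
      "f \<noteq> 0 \<Longrightarrow> \<exists>g h z w. f = g / h \<and> has_value g S z \<and> has_value h S w"
    and finite_order:
      "has_value f S z \<Longrightarrow> f \<noteq> 0 \<Longrightarrow> \<exists>N. \<forall>g w. has_value g S w \<longrightarrow> f \<noteq> g * t ^ N"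
begin

definition unit :: "'a herm_field \<Rightarrow> bool" where
  "unit u \<longleftrightarrow> (\<exists>z. z \<noteq> 0 \<and> has_value u S z)"

lemma value_0: "has_value 0 S 0"
  using value_add[OF value_1 value_uminus[OF value_1]] by simp

lemma unit_nz: "unit u \<Longrightarrow> u \<noteq> 0"
  unfolding unit_def using value_unique value_0 by blast

lemma unit_1 [simp]: "unit 1"
  unfolding unit_def using value_1 by (intro exI[of _ 1]) simp

lemma unit_mult: "unit u \<Longrightarrow> unit v \<Longrightarrow> unit (u * v)"
  unfolding unit_def by (metis value_mult no_zero_divisors)

lemma unit_inverse: "unit u \<Longrightarrow> unit (inverse u)"
  unfolding unit_def by (metis value_inverse nonzero_imp_inverse_nonzero)

lemma unit_power: "unit u \<Longrightarrow> unit (u ^ n)"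
  by (induction n) (simp_all add: unit_mult)

lemma unit_powi: "unit u \<Longrightarrow> unit (u powi n)"
  by (simp add: power_int_def unit_power unit_inverse flip: power_inverse)

lemma unit_iff: "unit u \<longleftrightarrow> u \<in> local_ring S \<and> inverse u \<in> local_ring S \<and> u \<noteq> 0"
proof
  assume u: "unit u"
  then show "u \<in> local_ring S \<and> inverse u \<in> local_ring S \<and> u \<noteq> 0"
    using unit_inverse[OF u] unit_nz[OF u] by (auto simp: unit_def local_ring_def)
next
  assume "u \<in> local_ring S \<and> inverse u \<in> local_ring S \<and> u \<noteq> 0"
  then obtain z w where zw: "has_value u S z" "has_value (inverse u) S w" "u \<noteq> 0"
    by (auto simp: local_ring_def)
  have "has_value 1 S (z * w)" using value_mult[OF zw(1,2)] zw(3) by simp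
  then have "z * w = 1" using value_unique value_1 by blast
  then show "unit u" using zw(1) unfolding unit_def by (metis mult_zero_left zero_neq_one)
qed

lemma value_power: "has_value f S z \<Longrightarrow> has_value (f ^ n) S (z ^ n)"
  by (induction n) (simp_all add: value_1 value_mult)

lemma value_t_power: "has_value (t ^ n) S (0 ^ n)"
  by (rule value_power[OF value_t])

text \<open>As long as the value is 0 a factor \<open>t\<close> can be split off; the induction is
  on the bound supplied by \<open>finite_order\<close>.\<close>

lemma regular_rep:
  assumes "has_value f S z" "f \<noteq> 0"
  shows "\<exists>n u. f = u * t ^ n \<and> unit u"
proof -
  have "\<forall>f z. has_value f S z \<longrightarrow> f \<noteq> 0 \<longrightarrow> (\<forall>g w. has_value g S w \<longrightarrow> f \<noteq> g * t ^ N) \<longrightarrow>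
      (\<exists>n u. f = u * t ^ n \<and> unit u)" for N
  proof (induction N)
    case 0
    then show ?case by auto
  next
    case (Suc N)
    show ?case
    proof (intro allI impI)
      fix f z assume f: "has_value f S z" "f \<noteq> 0" and N: "\<forall>g w. has_value g S w \<longrightarrow> f \<noteq> g * t ^ Suc N"
      show "\<exists>n u. f = u * t ^ n \<and> unit u"
      proof (cases "z = 0")
        case False
        then show ?thesis using f by (intro exI[of _ 0] exI[of _ f]) (auto simp: unit_def)
      next
        case True
        then obtain g w where g: "f = t * g" "has_value g S w" using value_0_imp_t_dvd f by blast
        have "g \<noteq> 0" using g f by auto
        moreover have "\<forall>g' w. has_value g' S w \<longrightarrow> g \<noteq> g' * t ^ N"
          using N g(1) by (auto simp: mult_ac)
        ultimately obtain n u where "g = u * t ^ n" "unit u" using Suc.IH g(2) by blast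
        then show ?thesis using g(1) by (intro exI[of _ "Suc n"] exI[of _ u]) (auto simp: mult_ac)
      qed
    qed
  qed
  then show ?thesis using finite_order[OF assms] assms by blast
qed

lemma rep:
  assumes "f \<noteq> 0"
  shows "\<exists>n u. f = u * t powi n \<and> unit u"
proof -
  obtain g h z w where gh: "f = g / h" "has_value g S z" "has_value h S w"
    using ex_regular_quotient[OF assms] by blast
  have "g \<noteq> 0" "h \<noteq> 0" using gh assms by auto
  then obtain n u m v where nu: "g = u * t ^ n" "unit u" "h = v * t ^ m" "unit v"
    using regular_rep gh(2,3) by meson
  have "f = (u * inverse v) * t powi (int n - int m)"
    using nu gh(1) t_nz unit_nz[OF nu(4)]
    by (simp add: power_int_diff divide_inverse mult_ac)
  then show ?thesis using unit_mult[OF nu(2) unit_inverse[OF nu(4)]] by blast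
qed

lemma unit_t_powi_iff: "unit (t powi n) \<longleftrightarrow> n = 0"
proof
  assume u: "unit (t powi n)"
  have *: "m = 0" if "unit (t ^ m)" for m
  proof (rule ccontr)
    assume "m \<noteq> 0"
    then have "has_value (t ^ m) S 0" using value_t_power[of m] by (simp add: power_0_left)
    then show False using that value_unique unfolding unit_def by blast
  qed
  show "n = 0"
  proof (cases "n \<ge> 0")
    case True
    then show ?thesis using u *[of "nat n"] by (simp add: power_int_def)
  next
    case False
    then have "unit (t ^ nat (- n))"
      using unit_inverse[OF u] by (simp add: power_int_def flip: power_inverse)
    then show ?thesis using * False by fastforce
  qed
qed simp

lemma uniformizer_t: "uniformizer S t"
proof -
  have "t * g \<in> max_ideal S" if "g \<in> local_ring S" for g
    using that value_mult[OF value_t] by (auto simp: local_ring_def max_ideal_def)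
  then show ?thesis
    unfolding uniformizer_def using value_0_imp_t_dvd
    by (auto simp: local_ring_def max_ideal_def)
qed

text \<open>Uniformizers generate the same ideal and so divide each other. This makes the choice of
  uniformizer inside \<open>ord_at\<close> harmless.\<close>

lemma uniformizer_cases:
  assumes "uniformizer S t'"
  obtains e where "unit e" "t' = e * t"
proof -
  have M: "{t * g |g. g \<in> local_ring S} = {t' * g |g. g \<in> local_ring S}"
    using assms uniformizer_t by (simp add: uniformizer_def)
  have 1: "1 \<in> local_ring S" using value_1 by (auto simp: local_ring_def)
  have "t' * 1 \<in> {t * g |g. g \<in> local_ring S}" unfolding M using 1 by blast
  then obtain g where g: "t' = t * g" "g \<in> local_ring S" by auto
  have "t * 1 \<in> {t' * g |g. g \<in> local_ring S}" unfolding M[symmetric] using 1 by blast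
  then obtain g' where g': "t = t' * g'" "g' \<in> local_ring S" by auto
  have "t * (g * g') = t * 1" using g(1) g'(1) by (metis mult.assoc mult.right_neutral)
  then have "g * g' = 1" using t_nz by (simp only: mult_cancel_left) simp
  then have "g' = inverse g" "g \<noteq> 0" by (auto simp: inverse_unique)
  then have "unit g" using g g' by (simp add: unit_iff)
  then show thesis using that g(1) by (simp add: mult.commute)
qed

text \<open>The definite description ranges over all uniformizers. Changing the uniformizer only
  changes the unit factor, and \<open>t powi n\<close> is a unit only for \<open>n = 0\<close>, so
  one representation determines the order.\<close>

lemma ord_eqI:
  assumes "unit u" "f = u * t powi n"
  shows "ord_at S f = n"
  unfolding ord_at_def
proof (rule the_equality)
  show "\<exists>t u. uniformizer S t \<and> u \<in> local_ring S \<and> inverse u \<in> local_ring S \<and> u \<noteq> 0 \<and> f = u * t powi n"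
    using assms uniformizer_t by (auto simp: unit_iff)
next
  fix m assume "\<exists>t u. uniformizer S t \<and> u \<in> local_ring S \<and> inverse u \<in> local_ring S \<and> u \<noteq> 0 \<and> f = u * t powi m"
  then obtain t' v where t': "uniformizer S t'" and v: "unit v" "f = v * t' powi m"
    by (auto simp: unit_iff)
  obtain e where e: "unit e" "t' = e * t" by (rule uniformizer_cases[OF t'])
  have nz: "u \<noteq> 0" "v \<noteq> 0" "e \<noteq> 0" using unit_nz assms(1) v(1) e(1) by auto
  have "u * t powi n = v * (e powi m * t powi m)"
    using v(2) assms(2) e(2) by (simp add: power_int_mult_distrib)
  then have "t powi (m - n) = u * inverse (v * e powi m)"
    using nz t_nz by (simp add: power_int_diff field_simps)
  then have "unit (t powi (m - n))"
    using assms(1) v(1) e(1) by (simp only: unit_mult unit_inverse unit_powi)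
  then show "m = n" by (simp add: unit_t_powi_iff)
qed

lemma ord_rep:
  assumes "f \<noteq> 0"
  obtains u n where "unit u" "f = u * t powi n" "ord_at S f = n"
  using rep[OF assms] ord_eqI by blast

lemma ord_unit: "unit u \<Longrightarrow> ord_at S u = 0"
  by (rule ord_eqI[of u]) auto

lemma ord_mult:
  assumes "f \<noteq> 0" "g \<noteq> 0"
  shows "ord_at S (f * g) = ord_at S f + ord_at S g"
proof -
  obtain u n where u: "unit u" "f = u * t powi n" "ord_at S f = n" by (rule ord_rep[OF assms(1)])
  obtain v m where v: "unit v" "g = v * t powi m" "ord_at S g = m" by (rule ord_rep[OF assms(2)])
  have "ord_at S (f * g) = n + m"
    using u v t_nz by (intro ord_eqI[OF unit_mult[OF u(1) v(1)]]) (simp add: power_int_add mult_ac)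
  then show ?thesis using u(3) v(3) by simp
qed

lemma ord_inverse:
  assumes "f \<noteq> 0"
  shows "ord_at S (inverse f) = - ord_at S f"
  using ord_mult[of f "inverse f"] ord_unit[OF unit_1] assms by simp

lemma ord_power: "f \<noteq> 0 \<Longrightarrow> ord_at S (f ^ n) = int n * ord_at S f"
  by (induction n) (simp_all add: ord_unit ord_mult algebra_simps)

lemma regular_iff:
  assumes "f \<noteq> 0"
  shows "(\<exists>z. has_value f S z) \<longleftrightarrow> ord_at S f \<ge> 0"
proof
  assume "\<exists>z. has_value f S z"
  then obtain n u where "f = u * t ^ n" "unit u" using regular_rep assms by blast
  then have "ord_at S f = int n" by (intro ord_eqI[of u]) auto
  then show "ord_at S f \<ge> 0" by simp
next
  assume o: "ord_at S f \<ge> 0"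
  obtain u n where u: "unit u" "f = u * t powi n" "ord_at S f = n" by (rule ord_rep[OF assms])
  then have "f = u * t ^ nat n" using o by (simp add: power_int_def)
  moreover obtain z where "has_value u S z" using u by (auto simp: unit_def)
  ultimately show "\<exists>z. has_value f S z" using value_mult value_t_power by blast
qed

definition vge :: "int \<Rightarrow> 'a herm_field \<Rightarrow> bool" where
  "vge n f \<longleftrightarrow> f = 0 \<or> ord_at S f \<ge> n"

lemma vge_0 [simp]: "vge n 0"
  by (simp add: vge_def)

lemma vge_regular_iff: "vge 0 f \<longleftrightarrow> (\<exists>z. has_value f S z)"
  using regular_iff[of f] value_0 by (cases "f = 0") (auto simp: vge_def)

text \<open>A description free of \<open>ord_at\<close>, from which closure under addition is
  immediate.\<close>

lemma vge_iff: "vge n f \<longleftrightarrow> (\<exists>g z. f = g * t powi n \<and> has_value g S z)"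
proof
  assume "vge n f"
  show "\<exists>g z. f = g * t powi n \<and> has_value g S z"
  proof (cases "f = 0")
    case True
    then show ?thesis using value_0 by (intro exI[of _ 0]) auto
  next
    case False
    then obtain u m where u: "unit u" "f = u * t powi m" "ord_at S f = m" by (rule ord_rep)
    have "m \<ge> n" using u(3) \<open>vge n f\<close> False by (simp add: vge_def)
    have "t powi m = t powi (m - n) * t powi n"
      using t_nz by (simp flip: power_int_add)
    also have "t powi (m - n) = t ^ nat (m - n)" using \<open>m \<ge> n\<close> by (simp add: power_int_def)
    finally have "f = (u * t ^ nat (m - n)) * t powi n" using u(2) by (simp add: mult_ac)
    then show ?thesis using u(1) value_mult value_t_power unfolding unit_def by blast
  qed
next
  assume "\<exists>g z. f = g * t powi n \<and> has_value g S z"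
  then obtain g z where g: "f = g * t powi n" "has_value g S z" by blast
  show "vge n f"
  proof (cases "f = 0")
    case False
    then have "g \<noteq> 0" using g by auto
    have "ord_at S (t powi n) = n" by (rule ord_eqI[of 1]) auto
    then have "ord_at S f = ord_at S g + n"
      using ord_mult[of g "t powi n"] g(1) \<open>g \<noteq> 0\<close> t_nz by simp
    then show ?thesis using regular_iff[OF \<open>g \<noteq> 0\<close>] g(2) by (auto simp: vge_def)
  qed simp
qed

lemma vge_mono: "vge n f \<Longrightarrow> m \<le> n \<Longrightarrow> vge m f"
  by (auto simp: vge_def)

lemma vge_add: "vge n f \<Longrightarrow> vge n g \<Longrightarrow> vge n (f + g)"
  unfolding vge_iff by (metis distrib_right value_add)

lemma vge_uminus: "vge n f \<Longrightarrow> vge n (- f)"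
  unfolding vge_iff by (metis mult_minus_left value_uminus)

lemma vge_diff: "vge n f \<Longrightarrow> vge n g \<Longrightarrow> vge n (f - g)"
  using vge_add[of n f "- g"] vge_uminus by simp

lemma vge_mult: "vge n f \<Longrightarrow> vge m g \<Longrightarrow> vge (n + m) (f * g)"
  by (cases "f = 0 \<or> g = 0") (auto simp: vge_def ord_mult)

text \<open>Used to replace a form by its restriction to a tangent when the two differ by something
  of order \<open>q + 1\<close> or more.\<close>

lemma vge_cong: "vge n (f - g) \<Longrightarrow> vge n f \<longleftrightarrow> vge n g"
  using vge_add[of n "f - g" g] vge_diff[of n f "f - g"] by auto

lemma vge_mult_iff: "g \<noteq> 0 \<Longrightarrow> vge n (f * g) \<longleftrightarrow> vge (n - ord_at S g) f"
  by (cases "f = 0") (auto simp: vge_def ord_mult)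

end

section \<open>Affine points\<close>

locale hermitian =
  fixes q :: nat and ty :: "'a::square_field itself"
  assumes primepow_q: "primepow q" and card_q: "CARD('a) = q\<^sup>2"
begin

lemma qq_eq: "qq TYPE('a) = q"
  by (rule qq_eqI[OF card_q])

lemma q_ge_2: "q \<ge> 2"
  using qq_ge_2[where 'a = 'a] by (simp add: qq_eq)

section \<open>Frobenius maps and the period of a geometric point\<close>

lemma q_eq_CHAR_power: "\<exists>k. q = CHAR('a) ^ k"
proof -
  obtain p k where p: "Factorial_Ring.prime p" "q = p ^ k" using primepow_q by (auto simp: primepow_def)
  have "CHAR('a) dvd p ^ (k * 2)"
    using CHAR_dvd_CARD[where 'a = 'a] by (simp add: card_q p(2) power_mult)
  then have "CHAR('a) dvd p" by (rule prime_dvd_power[OF CHAR_prime])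
  then show ?thesis using p by (metis primes_dvd_imp_eq CHAR_prime)
qed

text \<open>Stated for any ring of the right characteristic, because it is applied in the ground
  field, its closure, polynomial rings and the coordinate ring.\<close>

lemma frob_add:
  fixes x y :: "'b::comm_semiring_1"
  assumes "CHAR('b) = CHAR('a)"
  shows "(x + y) ^ (q ^ n) = x ^ (q ^ n) + y ^ (q ^ n)"
proof -
  obtain k where "q = CHAR('a) ^ k" using q_eq_CHAR_power by blast
  then have "q ^ n = CHAR('b) ^ (k * n)" by (simp add: assms power_mult)
  then show ?thesis using CHAR_prime[where 'a = 'a] by (intro freshmans_dream') (auto simp: assms)
qed

lemma frob_diff:
  fixes x y :: "'b::comm_ring_1"
  assumes "CHAR('b) = CHAR('a)"
  shows "(x - y) ^ (q ^ n) = x ^ (q ^ n) - y ^ (q ^ n)"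
  using frob_add[OF assms, of "x - y" y n] by (simp add: algebra_simps)

lemma CHAR_herm_ring: "CHAR('a herm_ring) = CHAR('a)"
proof (rule CHAR_eqI)
  have of_nat: "(of_nat n :: 'a herm_ring) = emb [:of_nat n:]" for n
  proof (induction n)
    case (Suc n)
    then have "(of_nat (Suc n) :: 'a herm_ring) = emb 1 + emb [:of_nat n:]" by simp
    also have "\<dots> = emb [:of_nat (Suc n):]" by (simp only: emb_add[symmetric]) (simp add: one_pCons)
    finally show ?case .
  qed simp
  show "of_nat CHAR('a) = (0 :: 'a herm_ring)" by (simp add: of_nat)
  show "CHAR('a) dvd n" if "of_nat n = (0 :: 'a herm_ring)" for n
    using that unfolding of_nat by (simp add: of_nat_eq_0_iff_char_dvd)
qed

lemmas frob = frob_add[OF refl] frob_diff[OF refl]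
  frob_add[OF CHAR_herm_ring] frob_diff[OF CHAR_herm_ring]
  frob_add[OF CHAR_alg_closure] frob_diff[OF CHAR_alg_closure]
  frob_add[OF semiring_char_poly] frob_diff[OF semiring_char_poly]

lemmas frob_q = frob[where n = 1, unfolded power_one_right]

lemma const_power: "(c :: 'a) ^ ((q\<^sup>2) ^ n) = c"
  by (rule finite_field_power_card_power_eq_same) (simp add: card_q)

lemma power_q_q: "((c :: 'a) ^ q) ^ q = c"
  using const_power[of c 1] by (simp add: power2_eq_square power_mult)

lemma ac_poly_frob: "ac_poly (p :: 'a poly) x ^ ((q\<^sup>2) ^ n) = ac_poly p (x ^ ((q\<^sup>2) ^ n))"
proof (induction p)
  case (pCons c p)
  have "to_ac c ^ ((q\<^sup>2) ^ n) = to_ac c" by (simp add: const_power flip: to_ac_power)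
  then show ?case
    using pCons.IH frob_add[OF CHAR_alg_closure, of "to_ac c" _ "2 * n"]
    by (simp add: map_poly_pCons power_mult_distrib flip: power_mult)
qed (use q_ge_2 in \<open>simp add: power_0_left\<close>)

text \<open>The iterated \<open>q^2\<close>-th powers of \<open>a\<close> are all roots of one
  polynomial over the ground field, so two of them agree; Frobenius is injective, so the smaller
  exponent can be cancelled.\<close>

lemma ex_frob_period1: "\<exists>n>0. (a :: 'a alg_closure) ^ ((q\<^sup>2) ^ n) = a"
proof -
  obtain p :: "'a poly" where p: "p \<noteq> 0" "ac_poly p a = 0" by (rule alg_closure_algebraic)
  define f where "f n = a ^ ((q\<^sup>2) ^ n)" for n
  have "range f \<subseteq> {x. ac_poly p x = 0}"
    using p(2) q_ge_2 by (auto simp: f_def power_0_left simp flip: ac_poly_frob)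
  moreover have "finite {x. ac_poly p x = 0}"
    using p(1) by (intro poly_roots_finite) (simp add: map_poly_eq_0_iff)
  ultimately have "finite (range f)" by (rule finite_subset)
  then have "\<not> inj f" using finite_imageD by blast
  then obtain n m where "f n = f m" "n < m"
    unfolding inj_def by (metis linorder_neqE_nat)
  then have "(a ^ ((q\<^sup>2) ^ (m - n))) ^ ((q\<^sup>2) ^ n) = a ^ ((q\<^sup>2) ^ n)"
    unfolding f_def by (metis le_add_diff_inverse less_imp_le mult.commute power_add power_mult)
  moreover have "(a ^ ((q\<^sup>2) ^ (m - n)) - a) ^ (q ^ (2 * n)) =
      (a ^ ((q\<^sup>2) ^ (m - n))) ^ (q ^ (2 * n)) - a ^ (q ^ (2 * n))"
    by (rule frob_diff[OF CHAR_alg_closure])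
  ultimately have "(a ^ ((q\<^sup>2) ^ (m - n)) - a) ^ (q ^ (2 * n)) = 0"
    by (simp only: power_mult[of q 2 n]) simp
  then have "a ^ ((q\<^sup>2) ^ (m - n)) = a" by simp
  then show ?thesis using \<open>n < m\<close> by (intro exI[of _ "m - n"]) auto
qed

lemma frob_period_mult: "(a :: 'a alg_closure) ^ (N ^ n) = a \<Longrightarrow> a ^ (N ^ (n * k)) = a"
  by (induction k) (simp_all add: power_add power_mult)

lemma ex_frob_period:
  obtains n where "n > 0" "(a :: 'a alg_closure) ^ ((q\<^sup>2) ^ n) = a" "(b :: 'a alg_closure) ^ ((q\<^sup>2) ^ n) = b"
proof -
  obtain n m where "n > 0" "a ^ ((q\<^sup>2) ^ n) = a" "m > 0" "b ^ ((q\<^sup>2) ^ m) = b"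
    using ex_frob_period1 by metis
  then show thesis
    using that[of "n * m"] frob_period_mult[of a "q\<^sup>2" n m] frob_period_mult[of b "q\<^sup>2" m n]
    by (simp add: mult.commute)
qed

text \<open>A generator of the ideal of polynomials vanishing at \<open>a\<close>, not normalised to
  be monic.\<close>

definition min_poly_of :: "'a alg_closure \<Rightarrow> 'a poly \<Rightarrow> bool" where
  "min_poly_of a p \<longleftrightarrow> p \<noteq> 0 \<and> (\<forall>r. ac_poly r a = 0 \<longleftrightarrow> p dvd r)"

lemma ex_min_poly: "\<exists>p. min_poly_of a p"
proof -
  obtain r0 :: "'a poly" where r0: "r0 \<noteq> 0" "ac_poly r0 a = 0" by (rule alg_closure_algebraic)
  then obtain p where p: "p \<noteq> 0" "ac_poly p a = 0"
    and min: "\<And>r. r \<noteq> 0 \<Longrightarrow> ac_poly r a = 0 \<Longrightarrow> degree p \<le> degree r"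
    using ex_has_least_nat[of "\<lambda>p. p \<noteq> 0 \<and> ac_poly p a = 0" r0 degree] by blast
  have "p dvd r" if "ac_poly r a = 0" for r
  proof -
    have "ac_poly r a = ac_poly (r div p) a * ac_poly p a + ac_poly (r mod p) a"
      by (simp flip: ac_poly_add ac_poly_mult)
    then have "ac_poly (r mod p) a = 0" using that p by simp
    then have "r mod p = 0" using min[of "r mod p"] degree_mod_less[OF p(1), of r] by fastforce
    then show ?thesis by auto
  qed
  then show ?thesis using p by (auto simp: min_poly_of_def ac_poly_mult elim!: dvdE)
qed

lemma min_poly_to_ac: "min_poly_of (to_ac a) [:- a, 1:]"
  unfolding min_poly_of_def by (auto simp: ac_poly_to_ac poly_eq_0_iff_dvd)

lemma herm_poly_eq: "(herm_poly :: 'a poly poly) = [:monom 1 (q + 1):] - monom 1 q - monom 1 1"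
  by (simp add: herm_poly_def qq_eq)

lemma curve_relation: "YY ^ q + YY = (XX :: 'a herm_ring) ^ (q + 1)"
proof -
  have "coord herm_poly = (0 :: 'a herm_ring)" by (simp add: coord_eq_0_iff)
  then have "emb (monom 1 (q + 1)) - YY ^ q - (YY :: 'a herm_ring) = 0"
    unfolding herm_poly_eq coord_diff coord_monom by (simp add: emb_def[symmetric])
  then show ?thesis by (simp add: emb_monom one_pCons[symmetric] algebra_simps)
qed

definition on_curve :: "'a alg_closure \<Rightarrow> 'a alg_closure \<Rightarrow> bool" where
  "on_curve a b \<longleftrightarrow> a ^ (q + 1) = b ^ q + b"

text \<open>The value is taken on a chosen representative. It is independent of the choice for
  points on the curve, which is why the laws below assume \<open>on_curve\<close>.\<close>

definition evr :: "'a alg_closure \<Rightarrow> 'a alg_closure \<Rightarrow> 'a herm_ring \<Rightarrow> 'a alg_closure" where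
  "evr a b g = ev a b (SOME G. g = coord G)"

lemma ev_herm_poly: "on_curve a b \<Longrightarrow> ev a b herm_poly = 0"
  unfolding herm_poly_eq ev_diff ev_monom ev_const
  by (simp add: on_curve_def ac_poly_monom)

lemma evr_coord: 
  assumes "on_curve a b"
  shows "evr a b (coord G) = ev a b G"
proof -
  define G' where "G' = (SOME G'. coord G = coord G')"
  have "coord G = coord G'" unfolding G'_def by (rule someI) simp
  then obtain A where "G - G' = herm_poly * A" by (auto simp: coord_eq_iff)
  then have "ev a b (G - G') = 0" by (simp add: ev_mult ev_herm_poly[OF assms])
  then show ?thesis unfolding evr_def G'_def[symmetric] by (simp add: ev_diff)
qed

context
  fixes a b :: "'a alg_closure"
  assumes on_curve: "on_curve a b"
begin

lemma evr_add: "evr a b (g + h) = evr a b g + evr a b h"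
  using coord_surj[of g] coord_surj[of h]
  by (auto simp: evr_coord on_curve ev_add simp flip: coord_add)

lemma evr_diff: "evr a b (g - h) = evr a b g - evr a b h"
  using coord_surj[of g] coord_surj[of h]
  by (auto simp: evr_coord on_curve ev_diff simp flip: coord_diff)

lemma evr_uminus: "evr a b (- g) = - evr a b g"
  using coord_surj[of g] by (auto simp: evr_coord on_curve ev_uminus simp flip: coord_uminus)

lemma evr_mult: "evr a b (g * h) = evr a b g * evr a b h"
  using coord_surj[of g] coord_surj[of h]
  by (auto simp: evr_coord on_curve ev_mult simp flip: coord_mult)

lemma evr_1 [simp]: "evr a b 1 = 1"
  using evr_coord[OF on_curve, of 1] by simp

lemma evr_0 [simp]: "evr a b 0 = 0"
  using evr_coord[OF on_curve, of 0] by simp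

lemma evr_power: "evr a b (g ^ n) = evr a b g ^ n"
  by (induction n) (simp_all add: evr_mult)

lemma evr_emb: "evr a b (emb p) = ac_poly p a"
  by (simp add: emb_def evr_coord on_curve ev_const)

lemma evr_YY: "evr a b YY = b"
  by (simp add: YY_def evr_coord on_curve ev_pCons map_poly_pCons)

end

text \<open>Applying \<open>y^q = x^(q+1) - y\<close> twice restores the sign of y, so a
  \<open>q^2\<close>-th power changes y only by a polynomial in x.\<close>

lemma YY_frob: "\<exists>W. (YY :: 'a herm_ring) ^ ((q\<^sup>2) ^ n) = YY + emb W"
proof (induction n)
  case 0
  show ?case by (intro exI[of _ 0]) simp
next
  case (Suc n)
  then obtain W where W: "(YY :: 'a herm_ring) ^ ((q\<^sup>2) ^ n) = YY + emb W" by blast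
  define M :: "'a poly" where "M = [:0, 1:] ^ (q + 1)"
  have YYq: "(YY :: 'a herm_ring) ^ q = emb M - YY" using curve_relation unfolding M_def emb_power by (simp only: eq_diff_eq)
  have "YY ^ ((q\<^sup>2) ^ Suc n) = (YY + emb W) ^ (q ^ 2)"
    by (simp only: power_Suc2 power_mult W)
  also have "\<dots> = YY ^ (q ^ 2) + emb W ^ (q ^ 2)" by (rule frob_add[OF CHAR_herm_ring])
  also have "YY ^ (q ^ 2) = (emb M - YY) ^ q" by (simp add: power2_eq_square power_mult YYq)
  also have "\<dots> = emb M ^ q - YY ^ q" by (rule frob_q(4))
  also have "\<dots> + emb W ^ (q ^ 2) = YY + emb (M ^ q - M + W ^ (q ^ 2))"
    by (simp add: YYq emb_add emb_diff emb_power)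
  finally show ?case ..
qed

text \<open>
  Raising to a power of \<open>q\<^sup>2\<close> that fixes the coordinates of the point is a ring endomorphism
  congruent to the identity modulo the minimal polynomial of the \<open>x\<close>-coordinate, so
  \<open>g * (g ^ (N - 1) - 1)\<close> is divisible by it.
\<close>
lemma min_poly_local_dvd:
  assumes on_curve: "on_curve a b" and p: "min_poly_of a p" and g: "evr a b g = 0"
  obtains h g' where "evr a b h \<noteq> 0" "g * h = emb p * g'"
proof -
  obtain n where n: "n > 0" "a ^ ((q\<^sup>2) ^ n) = a" "b ^ ((q\<^sup>2) ^ n) = b" by (rule ex_frob_period)
  define N where "N = (q\<^sup>2) ^ n"
  have N_q: "N = q ^ (2 * n)" by (simp add: N_def power_mult)
  have "1 < q ^ (2 * n)" using q_ge_2 n(1) by (intro one_less_power) auto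
  then have "N > 1" by (simp add: N_q)
  have emb: "emb p dvd emb c ^ N - emb c" for c
  proof -
    have "ac_poly (c ^ N) a = ac_poly c a ^ N"
      by (induction N) (simp_all add: ac_poly_mult)
    moreover have "ac_poly c a ^ N = ac_poly c a"
      using n(2) ac_poly_frob[of c a n] by (simp add: N_def)
    ultimately have "ac_poly (c ^ N - c) a = 0"
      using ac_poly_add[of "c ^ N - c" c a] by simp
    then have "p dvd c ^ N - c" using p by (simp add: min_poly_of_def)
    then obtain k where "c ^ N - c = p * k" ..
    then have "emb c ^ N - emb c = emb p * emb k"
      by (simp flip: emb_power emb_diff emb_mult)
    then show ?thesis by simp
  qed
  obtain W where W: "(YY :: 'a herm_ring) ^ N = YY + emb W" unfolding N_def using YY_frob by blast
  have "b ^ N = b + ac_poly W a"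
    using arg_cong[OF W, of "evr a b"]
    by (simp add: evr_power[OF on_curve] evr_add[OF on_curve] evr_YY[OF on_curve] evr_emb[OF on_curve])
  \<comment> \<open>The exponent \<open>N\<close> fixes \<open>b\<close> as well, so the correction
    polynomial vanishes at \<open>a\<close>.\<close>
  then have "ac_poly W a = 0" using n(3) by (simp add: N_def)
  then have "p dvd W" using p by (simp add: min_poly_of_def)
  then have YY: "emb p dvd YY ^ N - YY" by (auto simp: W emb_mult elim!: dvdE)
  have "emb p dvd coord G ^ N - coord G" for G
  proof (induction G)
    case 0
    show ?case using \<open>N > 1\<close> by (simp add: power_0_left)
  next
    case (pCons c G)
    have "coord (pCons c G) ^ N - coord (pCons c G) =
        (emb c ^ N - emb c) + (YY ^ N - YY) * coord G ^ N + YY * (coord G ^ N - coord G)"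
      unfolding coord_pCons N_q frob_add[OF CHAR_herm_ring] by (simp add: power_mult_distrib algebra_simps)
    then show ?case using emb YY pCons.IH by (simp add: dvd_add)
  qed
  then have "emb p dvd g ^ N - g" using coord_surj[of g] by blast
  then obtain g' where g': "g ^ N - g = emb p * g'" ..
  show thesis
  proof (rule that)
    show "evr a b (g ^ (N - 1) - 1) \<noteq> 0"
      using \<open>N > 1\<close> g by (simp add: evr_diff evr_power on_curve power_0_left)
    have "g ^ N = g * g ^ (N - 1)" using \<open>N > 1\<close> by (metis One_nat_def Suc_pred less_trans power_Suc zero_less_one)
    then show "g * (g ^ (N - 1) - 1) = emb p * g'" using g' by (simp add: algebra_simps)
  qed
qed

text \<open>Away from infinity homogeneity is no restriction: any two polynomials have a common
  degree bound, and the factors \<open>z ^ n\<close> of numerator and denominator cancel.\<close>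

lemma has_value_affine:
  assumes "on_curve a b"
  shows "has_value f (proj_point a b 1) z \<longleftrightarrow>
    (\<exists>g h. f = Fract g h \<and> evr a b h \<noteq> 0 \<and> z = evr a b g / evr a b h)"
proof
  assume "has_value f (proj_point a b 1) z"
  then obtain n G H v where v: "v \<in> proj_point a b 1" "total_degree_le n G" "total_degree_le n H"
    "f = Fract (coord G) (coord H)" "form_eval n H v \<noteq> 0" "z = form_eval n G v / form_eval n H v"
    unfolding has_value_def by blast
  obtain l where l: "v = (l * a, l * b, l)" "l \<noteq> 0" using v(1) by (auto simp: proj_point_def)
  show "\<exists>g h. f = Fract g h \<and> evr a b h \<noteq> 0 \<and> z = evr a b g / evr a b h"
    using v(4-6) l(2) unfolding l(1) form_eval_affine[OF v(2)] form_eval_affine[OF v(3)]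
    by (intro exI[of _ "coord G"] exI[of _ "coord H"]) (simp add: evr_coord[OF assms])
next
  assume "\<exists>g h. f = Fract g h \<and> evr a b h \<noteq> 0 \<and> z = evr a b g / evr a b h"
  then obtain g h where gh: "f = Fract g h" "evr a b h \<noteq> 0" "z = evr a b g / evr a b h" by blast
  obtain G H where GH: "g = coord G" "h = coord H" using coord_surj by meson
  obtain n m where "total_degree_le n G" "total_degree_le m H" using ex_total_degree_le by meson
  then have nm: "total_degree_le (n + m) G" "total_degree_le (n + m) H"
    by (auto intro: total_degree_le_mono)
  have "(a, b, 1) \<in> proj_point a b 1" by (auto simp: proj_point_def intro!: exI[of _ 1])
  then show "has_value f (proj_point a b 1) z"
    unfolding has_value_def using nm gh GH
      form_eval_affine[OF nm(1), of 1 a b] form_eval_affine[OF nm(2), of 1 a b]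
    by (intro exI[of _ "n + m"] exI[of _ G] exI[of _ H] bexI[of _ "(a, b, 1)"])
      (simp_all add: evr_coord[OF assms])
qed

lemma poly_decompose:
  fixes p r :: "'a poly"
  assumes "r \<noteq> 0" "degree p > 0"
  obtains e r' where "r = p ^ e * r'" "\<not> p dvd r'"
proof -
  have "\<exists>e r'. r = p ^ e * r' \<and> \<not> p dvd r'"
    using assms(1)
  proof (induction "degree r" arbitrary: r rule: less_induct)
    case less
    show ?case
    proof (cases "p dvd r")
      case False
      then show ?thesis by (intro exI[of _ 0] exI[of _ r]) simp
    next
      case True
      then obtain s where s: "r = p * s" ..
      then have "s \<noteq> 0" "degree s < degree r" using less.prems assms(2) by (auto simp: degree_mult_eq)
      then obtain e r' where "s = p ^ e * r'" "\<not> p dvd r'" using less.hyps by blast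
      then show ?thesis using s by (intro exI[of _ "Suc e"] exI[of _ r']) (simp add: mult_ac)
    qed
  qed
  then show thesis using that by blast
qed

lemma min_poly_degree:
  assumes "min_poly_of a p"
  shows "degree p > 0"
proof (rule ccontr)
  assume "\<not> ?thesis"
  then obtain c where c: "p = [:c:]" by (auto elim: degree_eq_zeroE)
  have "ac_poly p a = 0" "p \<noteq> 0" using assms by (auto simp: min_poly_of_def)
  then show False by (simp add: c map_poly_pCons)
qed

end

section \<open>The coordinate ring inside the function field, and its affine local rings\<close>

definition fr :: "'a::square_field herm_ring \<Rightarrow> 'a herm_field" where
  "fr g = Fract g 1"

lemma fr_add: "fr (g + h) = fr g + fr h"
  by (simp add: fr_def)

lemma fr_uminus: "fr (- g) = - fr g"
  by (simp add: fr_def)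

lemma fr_mult: "fr (g * h) = fr g * fr h"
  by (simp add: fr_def)

lemma fr_0 [simp]: "fr 0 = 0"
  by (simp add: fr_def Zero_fract_def)

lemma fr_1 [simp]: "fr 1 = 1"
  by (simp add: fr_def One_fract_def)

lemma fr_power: "fr (g ^ n) = fr g ^ n"
  by (induction n) (simp_all add: fr_mult)

lemma fr_eq_iff [simp]: "fr g = fr h \<longleftrightarrow> g = h"
  by (simp add: fr_def eq_fract)

lemma fr_eq_0_iff [simp]: "fr g = 0 \<longleftrightarrow> g = 0"
  using fr_eq_iff[of g 0] by simp

lemma Fract_eq_fr: "Fract g h = fr g / fr h"
  by (simp add: fr_def)

lemma fr_divide_eq_iff: "h \<noteq> 0 \<Longrightarrow> h' \<noteq> 0 \<Longrightarrow> fr g / fr h = fr g' / fr h' \<longleftrightarrow> g * h' = g' * h"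
  by (simp add: frac_eq_eq flip: fr_mult)

lemma ex_fr_divide: "\<exists>g h. h \<noteq> 0 \<and> f = fr g / fr h"
  by (cases f rule: Fract_cases) (auto simp: Fract_eq_fr)

context hermitian
begin

lemma value_affineI:
  assumes "on_curve a b" "evr a b h \<noteq> 0"
  shows "has_value (fr g / fr h) (proj_point a b 1) (evr a b g / evr a b h)"
  using assms unfolding has_value_affine[OF assms(1)] Fract_eq_fr by blast

lemma value_affine_fr:
  assumes "on_curve a b"
  shows "has_value (fr g) (proj_point a b 1) (evr a b g)"
  using value_affineI[OF assms, of 1 g] by (simp add: evr_1[OF assms])

lemma value_affineE:
  assumes "on_curve a b" "has_value f (proj_point a b 1) z"
  obtains g h where "h \<noteq> 0" "f = fr g / fr h" "evr a b h \<noteq> 0" "z = evr a b g / evr a b h"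
  using assms unfolding has_value_affine[OF assms(1)] Fract_eq_fr
  by (metis evr_0)

text \<open>Tangents at affine points are never vertical, so x is a local coordinate; over the
  ground field the minimal polynomial of \<open>a\<close> takes the role of \<open>x - a\<close>.
  That it generates the maximal ideal is \<open>min_poly_local_dvd\<close>.\<close>

lemma valued_point_affine:
  assumes oc: "on_curve a b" and p: "min_poly_of a p"
  shows "valued_point (proj_point a b 1) (fr (emb p))"
proof
  note evs = evr_add[OF oc] evr_mult[OF oc] evr_uminus[OF oc] evr_power[OF oc] evr_emb[OF oc]
  have p0: "p \<noteq> 0" and pa: "ac_poly p a = 0" using p by (auto simp: min_poly_of_def)
  fix f g :: "'a herm_field" and z w :: "'a alg_closure"
  show "z = w" if "has_value f (proj_point a b 1) z" "has_value f (proj_point a b 1) w"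
  proof -
    from that(1) obtain g h where gh: "h \<noteq> 0" "f = fr g / fr h" "evr a b h \<noteq> 0" "z = evr a b g / evr a b h"
      by (rule value_affineE[OF oc])
    from that(2) obtain g' h' where gh': "h' \<noteq> 0" "f = fr g' / fr h'" "evr a b h' \<noteq> 0" "w = evr a b g' / evr a b h'"
      by (rule value_affineE[OF oc])
    have "g * h' = g' * h" using gh gh' fr_divide_eq_iff by metis
    then have "evr a b g * evr a b h' = evr a b g' * evr a b h" by (metis evr_mult[OF oc])
    then show ?thesis using gh gh' by (simp add: frac_eq_eq)
  qed
  show "has_value 1 (proj_point a b 1) 1"
    using value_affine_fr[OF oc, of 1] by (simp add: evr_1[OF oc])
  show "has_value (f + g) (proj_point a b 1) (z + w)"
    and "has_value (f * g) (proj_point a b 1) (z * w)"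
    if "has_value f (proj_point a b 1) z" "has_value g (proj_point a b 1) w"
  proof -
    from that(1) obtain u v where uv: "v \<noteq> 0" "f = fr u / fr v" "evr a b v \<noteq> 0" "z = evr a b u / evr a b v"
      by (rule value_affineE[OF oc])
    from that(2) obtain u' v' where uv': "v' \<noteq> 0" "g = fr u' / fr v'" "evr a b v' \<noteq> 0" "w = evr a b u' / evr a b v'"
      by (rule value_affineE[OF oc])
    have 1: "f + g = fr (u * v' + u' * v) / fr (v * v')" and 2: "f * g = fr (u * u') / fr (v * v')"
      using uv uv' by (simp_all add: add_frac_eq fr_add fr_mult)
    show "has_value (f + g) (proj_point a b 1) (z + w)"
      using value_affineI[OF oc, of "v * v'" "u * v' + u' * v"] uv uv' unfolding 1
      by (simp add: evs add_frac_eq)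
    show "has_value (f * g) (proj_point a b 1) (z * w)"
      using value_affineI[OF oc, of "v * v'" "u * u'"] uv uv' unfolding 2
      by (simp add: evs)
  qed
  show "has_value (- f) (proj_point a b 1) (- z)" if "has_value f (proj_point a b 1) z"
  proof -
    from that(1) obtain u v where uv: "v \<noteq> 0" "f = fr u / fr v" "evr a b v \<noteq> 0" "z = evr a b u / evr a b v"
      by (rule value_affineE[OF oc])
    then show ?thesis using value_affineI[OF oc uv(3), of "- u"] by (simp add: fr_uminus evs)
  qed
  show "has_value (inverse f) (proj_point a b 1) (inverse z)"
    if "has_value f (proj_point a b 1) z" "z \<noteq> 0"
  proof -
    from that(1) obtain u v where uv: "v \<noteq> 0" "f = fr u / fr v" "evr a b v \<noteq> 0" "z = evr a b u / evr a b v"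
      by (rule value_affineE[OF oc])
    then show ?thesis using value_affineI[OF oc, of u v] that(2) by simp
  qed
  show "has_value (fr (emb p)) (proj_point a b 1) 0"
    using value_affine_fr[OF oc, of "emb p"] by (simp add: evs pa)
  show "fr (emb p) \<noteq> 0" using p0 by simp
  show "\<exists>g w. f = fr (emb p) * g \<and> has_value g (proj_point a b 1) w"
    if "has_value f (proj_point a b 1) 0"
  proof -
    from that obtain u v where uv: "v \<noteq> 0" "f = fr u / fr v" "evr a b v \<noteq> 0" "0 = evr a b u / evr a b v"
      by (rule value_affineE[OF oc])
    then have "evr a b u = 0" by simp
    then obtain h u' where h: "evr a b h \<noteq> 0" "u * h = emb p * u'"
      by (rule min_poly_local_dvd[OF oc p])
    have "h \<noteq> 0" using h(1) oc by auto
    then have "fr u = fr (emb p) * fr u' / fr h"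
      using h(2) by (simp add: eq_divide_eq flip: fr_mult)
    then have "f = fr (emb p) * (fr u' / fr (h * v))"
      using uv by (simp add: fr_mult)
    moreover have "has_value (fr u' / fr (h * v)) (proj_point a b 1) (evr a b u' / evr a b (h * v))"
      using h(1) uv(3) by (intro value_affineI[OF oc]) (simp add: evs)
    ultimately show ?thesis by blast
  qed
  show "\<exists>g h z w. f = g / h \<and> has_value g (proj_point a b 1) z \<and> has_value h (proj_point a b 1) w"
    using ex_fr_divide[of f] value_affine_fr[OF oc] by blast
  show "\<exists>N. \<forall>g w. has_value g (proj_point a b 1) w \<longrightarrow> f \<noteq> g * fr (emb p) ^ N"
    if "has_value f (proj_point a b 1) z" "f \<noteq> 0"
  proof -
    from that(1) obtain u v where uv: "v \<noteq> 0" "f = fr u / fr v" "evr a b v \<noteq> 0" "z = evr a b u / evr a b v"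
      by (rule value_affineE[OF oc])
    have "u \<noteq> 0" using uv that(2) by auto
    then obtain r u' where r: "r \<noteq> 0" "emb r = u * u'" by (rule ex_emb_multiple)
    \<comment> \<open>The numerator \<open>u\<close> divides a nonzero polynomial in x, so the
      multiplicity of \<open>p\<close> in that polynomial bounds the order.\<close>
    obtain e r' where e: "r = p ^ e * r'" "\<not> p dvd r'"
      using r(1) min_poly_degree[OF p] by (rule poly_decompose)
    have "f \<noteq> g * fr (emb p) ^ Suc e" if g: "has_value g (proj_point a b 1) w" for g w
    proof
      assume f: "f = g * fr (emb p) ^ Suc e"
      obtain k l where kl: "l \<noteq> 0" "g = fr k / fr l" "evr a b l \<noteq> 0"
        using g by (rule value_affineE[OF oc])
      have "fr u / fr v = fr (k * emb p ^ Suc e) / fr l"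
        using f uv(2) kl(2) by (simp add: fr_mult fr_power)
      then have "u * l = k * emb p ^ Suc e * v" using fr_divide_eq_iff uv(1) kl(1) by blast
      then have "emb r * l = k * emb p ^ Suc e * v * u'" using r(2) by (simp add: mult_ac)
      then have "emb p ^ e * (emb r' * l) = emb p ^ e * (emb p * (k * v * u'))"
        by (simp add: e(1) emb_mult emb_power mult_ac)
      then have "emb r' * l = emb p * (k * v * u')" using p0 by simp
      then have "evr a b (emb r' * l) = evr a b (emb p * (k * v * u'))" by simp
      then have "ac_poly r' a = 0" using kl(3) by (simp add: evs pa)
      then show False using e(2) p by (simp add: min_poly_of_def)
    qed
    then show ?thesis by blast
  qed
qed

section \<open>The point at infinity\<close>

abbreviation Pinf :: "'a geom_point" where
  "Pinf \<equiv> P_inf"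

lemma total_degree_le_1 [simp]: "total_degree_le n (1 :: 'a poly poly)"
  by (simp add: one_pCons total_degree_le_const)

abbreviation corner :: "nat \<Rightarrow> 'a poly poly \<Rightarrow> 'a" where
  "corner n G \<equiv> coeff (coeff G n) 0"

text \<open>
  The top form of a multiple of \<open>herm_poly\<close> is divisible by \<open>x\<^sup>q\<^sup>+\<^sup>1\<close>.
\<close>
lemma total_degree_herm_multiple:
  assumes A: "A \<noteq> (0 :: 'a poly poly)" and td: "total_degree_le n (herm_poly * A)"
  obtains m where "n = m + (q + 1)" "total_degree_le m A"
proof -
  define c where "c i j = coeff (coeff A j) i" for i j
  have coeff: "coeff (coeff (herm_poly * A) j) i =
      (if q + 1 \<le> i then c (i - (q + 1)) j else 0) - (if q \<le> j then c i (j - q) else 0)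
      - (if 1 \<le> j then c i (j - 1) else 0)" for i j
  proof -
    have "herm_poly * A = smult (monom 1 (q + 1)) A - monom 1 q * A - monom 1 1 * A"
      unfolding herm_poly_eq by (simp add: algebra_simps)
    then show ?thesis by (simp add: coeff_monom_mult c_def)
  qed
  obtain N where N: "total_degree_le N A" using ex_total_degree_le by blast
  define M where "M = (LEAST m. total_degree_le m A)"
  have M: "total_degree_le M A" unfolding M_def using N by (rule LeastI)
  obtain i j where ij: "c i j \<noteq> 0" "i + j = M"
  proof (cases "M = 0")
    case True
    obtain j where "coeff A j \<noteq> 0" using A by (auto simp: poly_eq_iff)
    then obtain i where "c i j \<noteq> 0" by (auto simp: poly_eq_iff c_def)
    then show ?thesis using that[of i j] M True by (auto simp: total_degree_le_def c_def)
  next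
    case False
    have "\<not> total_degree_le (M - 1) A"
      using False not_less_Least[of "M - 1" "\<lambda>m. total_degree_le m A"] by (simp add: M_def)
    then obtain i j where "c i j \<noteq> 0" "\<not> i + j \<le> M - 1" by (auto simp: total_degree_le_def c_def)
    then show ?thesis using that[of i j] M by (force simp: total_degree_le_def c_def)
  qed
  \<comment> \<open>The other two terms of \<open>herm_poly\<close> would need coefficients of
    \<open>A\<close> in total degree \<open>M + 1\<close> and \<open>M + q\<close>, so at this
    monomial only the term \<open>x^(q+1)\<close> contributes.\<close>
  have "c (i + (q + 1)) (j - q) = 0" if "q \<le> j"
    using M ij(2) that q_ge_2 unfolding total_degree_le_def c_def by force
  moreover have "c (i + (q + 1)) (j - 1) = 0" if "1 \<le> j"
    using M ij(2) that q_ge_2 unfolding total_degree_le_def c_def by force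
  ultimately have "coeff (coeff (herm_poly * A) j) (i + (q + 1)) = c i j"
    unfolding coeff by simp
  then have "i + (q + 1) + j \<le> n" using td ij(1) unfolding total_degree_le_def by metis
  then have "n = (n - (q + 1)) + (q + 1)" "total_degree_le (n - (q + 1)) A"
    using ij(2) total_degree_le_mono[OF M, of "n - (q + 1)"] by auto
  then show thesis by (rule that)
qed

text \<open>Makes the corner coefficient well defined on the coordinate ring. As a form of degree
  \<open>q + 1\<close>, \<open>herm_poly\<close> has no term \<open>Y^(q+1)\<close>: the curve
  passes through the point at infinity.\<close>

lemma corner_eq_0:
  assumes "coord G = 0" "total_degree_le n G"
  shows "corner n G = 0"
proof -
  obtain A where A: "G = herm_poly * A" using assms(1) by (auto simp: coord_eq_0_iff)
  show ?thesis
  proof (cases "A = 0")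
    case False
    obtain m where m: "n = m + (q + 1)" "total_degree_le m A"
      by (rule total_degree_herm_multiple[OF False assms(2)[unfolded A]])
    have "total_degree_le (q + 1) (herm_poly :: 'a poly poly)"
      unfolding herm_poly_eq
      by (intro total_degree_le_diff total_degree_le_const)
        (use q_ge_2 in \<open>auto simp: degree_monom_eq one_pCons total_degree_le_def coeff_pCons split: nat.splits\<close>)
    then have "corner (q + 1 + m) G = corner (q + 1) herm_poly * corner m A"
      unfolding A using m(2) by (rule corner_mult)
    moreover have "corner (q + 1) (herm_poly :: 'a poly poly) = 0"
      using q_ge_2 by (simp add: herm_poly_eq)
    ultimately show ?thesis by (simp add: m(1) add.commute)
  qed (simp add: A)
qed

lemma corner_nz_imp_coord_nz: "corner n G \<noteq> 0 \<Longrightarrow> total_degree_le n G \<Longrightarrow> coord G \<noteq> 0"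
  using corner_eq_0 by blast

lemma value_infI:
  assumes "total_degree_le n G" "total_degree_le n H" "corner n H \<noteq> 0"
  shows "has_value (fr (coord G) / fr (coord H)) Pinf (to_ac (corner n G / corner n H))"
proof -
  have "(0, 1, 0) \<in> Pinf"
    by (auto simp: P_inf_def proj_point_def intro!: exI[of _ 1])
  then show ?thesis
    unfolding has_value_def using assms
    by (intro exI[of _ n] exI[of _ G] exI[of _ H] bexI[of _ "(0, 1, 0)"])
      (simp_all only: form_eval_infinity Fract_eq_fr, simp_all)
qed

lemma value_infE:
  assumes "has_value f Pinf z"
  obtains n G H where "total_degree_le n G" "total_degree_le n H" "corner n H \<noteq> 0" "coord H \<noteq> 0"
    "f = fr (coord G) / fr (coord H)" "z = to_ac (corner n G / corner n H)"
proof -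
  obtain n G H v where v: "v \<in> Pinf" "total_degree_le n G" "total_degree_le n H"
    "f = Fract (coord G) (coord H)" "form_eval n H v \<noteq> 0" "z = form_eval n G v / form_eval n H v"
    using assms unfolding has_value_def by blast
  obtain l where l: "v = (0, l, 0)" "l \<noteq> 0" using v(1) by (auto simp: P_inf_def proj_point_def)
  have "corner n H \<noteq> 0" using v(5) l by (simp only: form_eval_infinity) auto
  moreover have "z = to_ac (corner n G / corner n H)"
    using v(6) l by (simp only: form_eval_infinity) simp
  ultimately show thesis
    using that[of n G H] v(2-4) corner_nz_imp_coord_nz by (simp add: Fract_eq_fr)
qed

abbreviation Yp :: "'a poly poly" where "Yp \<equiv> [:0, 1:]"

lemma total_degree_le_Yp_power: "total_degree_le n (Yp ^ n)"
  unfolding monom_eq_power[symmetric]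
  using total_degree_le_monom[of 0 n n "1 :: 'a"] by (simp only: monom_eq_1)

lemma corner_Yp_power: "corner n (Yp ^ n) = 1"
  by (simp add: monom_eq_power[symmetric])

lemma coord_Yp_power: "coord (Yp ^ n) = (YY :: 'a herm_ring) ^ n"
  by (simp add: coord_power YY_def)

lemma value_inf_form:
  assumes "total_degree_le n G"
  shows "has_value (fr (coord G) / fr YY ^ n) Pinf (to_ac (corner n G))"
  using value_infI[OF assms total_degree_le_Yp_power]
  by (simp add: corner_Yp_power coord_Yp_power fr_power)

lemma value_inf_unique:
  assumes "has_value f Pinf z" "has_value f Pinf w"
  shows "z = w"
proof -
  obtain n G H where G: "total_degree_le n G" "total_degree_le n H" "corner n H \<noteq> 0" "coord H \<noteq> 0"
    "f = fr (coord G) / fr (coord H)" "z = to_ac (corner n G / corner n H)"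
    using assms(1) by (rule value_infE)
  obtain m G' H' where G': "total_degree_le m G'" "total_degree_le m H'" "corner m H' \<noteq> 0" "coord H' \<noteq> 0"
    "f = fr (coord G') / fr (coord H')" "w = to_ac (corner m G' / corner m H')"
    using assms(2) by (rule value_infE)
  have "coord (G * H' - G' * H) = 0"
    using trans[OF sym[OF G(5)] G'(5)] unfolding fr_divide_eq_iff[OF G(4) G'(4)]
    by (simp add: coord_diff coord_mult)
  moreover have 1: "total_degree_le (n + m) (G * H')"
    by (intro total_degree_le_mult G G')
  moreover have "total_degree_le (m + n) (G' * H)"
    by (intro total_degree_le_mult G G')
  then have 2: "total_degree_le (n + m) (G' * H)" by (simp add: add.commute)
  ultimately have "corner (n + m) (G * H' - G' * H) = 0"
    by (intro corner_eq_0 total_degree_le_diff)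
  then have "corner n G * corner m H' = corner m G' * corner n H"
    using corner_mult[OF G(1) G'(2)] corner_mult[OF G'(1) G(2)] by (simp add: add.commute)
  then have "corner n G / corner n H = corner m G' / corner m H'"
    using G(3) G'(3) by (simp add: frac_eq_eq)
  then show ?thesis by (simp only: G(6) G'(6))
qed

lemma value_inf_1: "has_value 1 Pinf 1"
  using value_inf_form[of 0 1] by simp

lemma value_inf_add: "has_value (f + g) Pinf (z + w)"
  and value_inf_mult: "has_value (f * g) Pinf (z * w)"
  if "has_value f Pinf z" "has_value g Pinf w"
proof -
  from that(1) obtain n G H where G: "total_degree_le n G" "total_degree_le n H" "corner n H \<noteq> 0" "coord H \<noteq> 0"
    "f = fr (coord G) / fr (coord H)" "z = to_ac (corner n G / corner n H)"
    by (rule value_infE)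
  from that(2) obtain m G' H' where G': "total_degree_le m G'" "total_degree_le m H'" "corner m H' \<noteq> 0" "coord H' \<noteq> 0"
    "g = fr (coord G') / fr (coord H')" "w = to_ac (corner m G' / corner m H')"
    by (rule value_infE)
  have td: "total_degree_le (n + m) (G * H')" "total_degree_le (m + n) (G' * H)"
    "total_degree_le (n + m) (G * G')" "total_degree_le (n + m) (H * H')"
    by (intro total_degree_le_mult G G')+
  note cs = corner_mult[OF G(1) G'(2)] corner_mult[OF G'(1) G(2)] corner_mult[OF G(1) G'(1)]
    corner_mult[OF G(2) G'(2)]
  have td2: "total_degree_le (n + m) (G * H' + G' * H)"
    using td by (intro total_degree_le_add) (simp_all add: add.commute)
  have 1: "f + g = fr (coord (G * H' + G' * H)) / fr (coord (H * H'))"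
    and 2: "f * g = fr (coord (G * G')) / fr (coord (H * H'))"
    using G(4,5) G'(4,5) by (simp_all add: add_frac_eq fr_add fr_mult coord_add coord_mult)
  have nz: "corner (n + m) (H * H') \<noteq> 0" using G(3) G'(3) by (simp add: cs)
  show "has_value (f + g) Pinf (z + w)"
    using value_infI[OF td2 td(4) nz] cs G(3,6) G'(3,6) unfolding 1
    by (simp add: add_frac_eq add.commute[of m])
  show "has_value (f * g) Pinf (z * w)"
    using value_infI[OF td(3) td(4) nz] cs G(3,6) G'(3,6) unfolding 2 by simp
qed

lemma value_inf_power: "has_value f Pinf z \<Longrightarrow> has_value (f ^ n) Pinf (z ^ n)"
  by (induction n) (simp_all add: value_inf_1 value_inf_mult)

text \<open>In the chart \<open>Y = 1\<close> the curve reads \<open>x^(q+1) = z + z^q\<close>, with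
  tangent \<open>z = 0\<close> at the origin, so \<open>x / y\<close> is a local coordinate at
  infinity.\<close>

abbreviation s_inf :: "'a herm_field" where
  "s_inf \<equiv> fr XX / fr YY"

lemma YY_nz: "YY \<noteq> (0 :: 'a herm_ring)"
  using corner_nz_imp_coord_nz[of Yp 1] total_degree_le_Yp_power[of 1] by (simp add: YY_def)

text \<open>The same function on the curve as \<open>x^(q+1)\<close>, but of total degree only
  \<open>q\<close> and with nonzero corner, hence usable as a denominator at infinity.\<close>

abbreviation Bp :: "'a poly poly" where
  "Bp \<equiv> Yp ^ q + Yp"

lemma total_degree_le_Bp: "total_degree_le q Bp"
  using total_degree_le_Yp_power[of q] total_degree_le_mono[OF total_degree_le_Yp_power[of 1], of q] q_ge_2
  by (intro total_degree_le_add) auto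

lemma corner_Bp: "corner q Bp = 1"
  using q_ge_2 corner_Yp_power[of q] by (auto simp: coeff_pCons split: nat.splits)

lemma coord_Bp: "coord Bp = (XX :: 'a herm_ring) ^ (q + 1)"
  using curve_relation by (simp add: coord_add coord_Yp_power) (simp add: YY_def)

lemma value_s_inf: "has_value s_inf Pinf 0"
  using value_inf_form[of 1 "[:[:0, 1:]:]"]
  by (simp add: total_degree_le_const emb_def[symmetric])

text \<open>The unit relating \<open>1 / y\<close> to the power \<open>q + 1\<close> of the uniformizer \<open>x / y\<close> at infinity.\<close>
definition e_inf :: "'a herm_field" where
  "e_inf = fr YY ^ q / fr XX ^ (q + 1)"

lemma value_e_inf: "has_value e_inf Pinf 1"
  using value_infI[OF total_degree_le_Yp_power total_degree_le_Bp]
  by (simp only: corner_Bp corner_Yp_power coord_Yp_power coord_Bp e_inf_def fr_power) simp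

lemma inverse_YY_eq: "inverse (fr YY) = s_inf ^ (q + 1) * e_inf"
  using YY_nz by (simp add: e_inf_def field_simps)

text \<open>Written as \<open>x^q / (y^q + y)\<close>, a quotient of forms of degree
  \<open>q\<close> whose corners are 0 and 1.\<close>

lemma value_inverse_XX: "has_value (inverse (fr XX)) Pinf 0"
proof -
  have "has_value (fr (coord [:monom 1 q:]) / fr (coord Bp)) Pinf (to_ac (corner q [:monom 1 q:] / corner q Bp))"
    by (rule value_infI[OF _ total_degree_le_Bp])
      (auto simp: corner_Bp total_degree_le_const degree_monom_le simp del: coeff_add)
  moreover have "corner q [:monom 1 q:] = (0 :: 'a)" using q_ge_2 by (simp add: coeff_pCons split: nat.splits)
  moreover have "fr (coord [:monom 1 q:]) / fr (coord Bp) = inverse (fr (XX :: 'a herm_ring))"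
    unfolding coord_Bp emb_def[symmetric] emb_monom
    by (simp add: one_pCons[symmetric] fr_mult fr_power field_simps)
  ultimately show ?thesis by simp
qed

text \<open>Gives every nonzero polynomial in x a definite pole at infinity; this is what bounds
  orders there.\<close>

lemma value_inf_emb:
  assumes "p \<noteq> 0"
  shows "has_value (fr (emb p) / fr XX ^ degree p) Pinf (to_ac (lead_coeff p))"
  using assms
proof (induction p)
  case (pCons c p)
  have c: "has_value (fr (emb [:c:])) Pinf (to_ac c)"
    using value_inf_form[of 0 "[:[:c:]:]"] by (simp add: total_degree_le_const emb_def)
  have e: "emb (pCons c p) = emb [:c:] + XX * emb p"
    by (simp flip: emb_add emb_mult)
  show ?case
  proof (cases "p = 0")
    case True
    then show ?thesis using c by simp
  next
    case False
    have "has_value (fr (emb [:c:]) * inverse (fr XX) ^ Suc (degree p) + fr (emb p) / fr XX ^ degree p)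
        Pinf (to_ac c * 0 ^ Suc (degree p) + to_ac (lead_coeff p))"
      by (intro value_inf_add value_inf_mult value_inf_power c value_inverse_XX pCons.IH False)
    moreover have "fr (emb [:c:]) * inverse (fr XX) ^ Suc (degree p) + fr (emb p) / fr XX ^ degree p
        = fr (emb (pCons c p)) / fr XX ^ degree (pCons c p)"
      using False by (simp add: e fr_add fr_mult field_simps)
    ultimately show ?thesis using False by simp
  qed
qed simp

text \<open>Split the numerator as x times a form plus a part free of x. The vanishing corner lowers
  the degree of the x-free part, that is, this part is divisible by Z, and on the curve Z is
  divisible by the uniformizer near infinity.\<close>

lemma s_inf_dvd:
  assumes "has_value f Pinf 0"
  shows "\<exists>g w. f = s_inf * g \<and> has_value g Pinf w"
proof -
  obtain n G H where G: "total_degree_le n G" "total_degree_le n H" "corner n H \<noteq> 0" "coord H \<noteq> 0"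
    "f = fr (coord G) / fr (coord H)" "0 = to_ac (corner n G / corner n H)"
    using assms by (rule value_infE)
  have G0: "corner n G = 0" using G(3,6) by simp
  show ?thesis
  proof (cases n)
    case 0
    have "coeff (coeff G j) i = 0" for i j
      using G(1) G0 0 unfolding total_degree_le_def
      by (metis add_eq_0_iff_both_eq_0 le_zero_eq)
    then have "G = 0" by (simp add: poly_eq_iff)
    then have "f = 0" using G(5) by simp
    then show ?thesis using value_inf_form[of 0 0] by (intro exI[of _ 0]) auto
  next
    case (Suc m)
    define G1 where "G1 = map_poly (poly_shift 1) G"
    define G2 where "G2 = map_poly (\<lambda>c. [:coeff c 0:]) G"
    have G1: "coeff (coeff G1 j) i = coeff (coeff G j) (Suc i)" for i j
      by (simp add: G1_def coeff_map_poly coeff_poly_shift)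
    have G2: "coeff (coeff G2 j) i = (if i = 0 then coeff (coeff G j) 0 else 0)" for i j
      by (auto simp: G2_def coeff_map_poly coeff_pCons split: nat.splits)
    have G12: "G = smult [:0, 1:] G1 + G2"
      by (intro poly_eqI) (auto simp: G1 G2 coeff_pCons split: nat.splits)
    have td1: "total_degree_le m G1"
      using G(1) unfolding total_degree_le_def G1 Suc by fastforce
    have td2: "total_degree_le m G2"
      using G(1) G0 unfolding total_degree_le_def G2 Suc
      by (metis add_0 le_SucE)
    \<comment> \<open>On the curve \<open>x * A = y * x^(q+1) * G\<close>: multiplication by
      \<open>Bp\<close> makes also the x-free part divisible by x. The degree of \<open>A\<close> is
      exactly that allowed by the new denominator \<open>Bp * H\<close>.\<close>
    define A where "A = Yp * (G1 * Bp + [:monom 1 q:] * G2)"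
    have "total_degree_le (m + q) (G1 * Bp)"
      by (rule total_degree_le_mult[OF td1 total_degree_le_Bp])
    moreover have "total_degree_le (q + m) ([:monom 1 q:] * G2)"
      by (intro total_degree_le_mult td2 total_degree_le_const degree_monom_le)
    ultimately have "total_degree_le (m + q) (G1 * Bp + [:monom 1 q:] * G2)"
      by (intro total_degree_le_add) (simp_all only: add.commute)
    from total_degree_le_mult[OF total_degree_le_Yp_power[of 1] this]
    have tdA: "total_degree_le (1 + (m + q)) A" by (simp only: A_def power_one_right)
    have tdB: "total_degree_le (q + n) (Bp * H)"
      by (intro total_degree_le_mult total_degree_le_Bp G)
    have c: "corner (q + n) (Bp * H) = corner n H"
      using corner_mult[OF total_degree_le_Bp G(2)] corner_Bp by simp
    have tdA': "total_degree_le (q + n) A"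
      using tdA by (simp add: Suc add_ac)
    have "coord (Bp * H) \<noteq> 0"
      using c G(3) tdB by (intro corner_nz_imp_coord_nz) auto
    then have nz: "YY * coord (Bp * H) \<noteq> 0" using YY_nz by simp
    have "has_value (fr (coord A) / fr (coord (Bp * H))) Pinf
        (to_ac (corner (q + n) A / corner (q + n) (Bp * H)))"
      using G(3) by (intro value_infI tdA' tdB) (simp only: c not_False_eq_True)
    moreover have "f = s_inf * (fr (coord A) / fr (coord (Bp * H)))"
    proof -
      have "coord G = XX * coord G1 + coord G2"
        using arg_cong[OF G12, of coord] coord_mult[of "[:[:0, 1:]:]" G1]
        by (simp add: coord_add emb_def)
      note cG = this
      have "coord [:monom 1 q:] = (XX :: 'a herm_ring) ^ q"
        by (simp add: emb_def[symmetric] emb_monom one_pCons[symmetric])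
      moreover have "coord Yp = (YY :: 'a herm_ring)" by (simp add: YY_def)
      ultimately have "coord A = YY * (coord G1 * XX ^ (q + 1) + XX ^ q * coord G2)"
        unfolding A_def coord_mult[of Yp] coord_add[of "G1 * Bp"] coord_mult[of G1 Bp]
          coord_mult[of "[:monom 1 q:]"] coord_Bp by (simp only:)
      moreover have "coord (Bp * H) = XX ^ (q + 1) * coord H"
        by (simp only: coord_mult coord_Bp)
      ultimately have "coord G * (YY * coord (Bp * H)) = (XX * coord A) * coord H"
        unfolding cG by (simp only:) (simp add: algebra_simps)
      then show ?thesis
        using G(4,5) nz fr_divide_eq_iff[of "coord H" "YY * coord (Bp * H)" "coord G" "XX * coord A"]
        by (simp add: fr_mult)
    qed
    ultimately show ?thesis by blast
  qed
qed

lemma valued_point_infinity: "valued_point Pinf s_inf"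
proof
  fix f g :: "'a herm_field" and z w :: "'a alg_closure"
  show "z = w" if "has_value f Pinf z" "has_value f Pinf w"
    using that by (rule value_inf_unique)
  show "has_value 1 Pinf 1" by (rule value_inf_1)
  show "has_value (f + g) Pinf (z + w)" and "has_value (f * g) Pinf (z * w)"
    if "has_value f Pinf z" "has_value g Pinf w"
    by (rule value_inf_add[OF that], rule value_inf_mult[OF that])
  show "has_value (- f) Pinf (- z)" if "has_value f Pinf z"
  proof -
    have "has_value (fr (coord (-1))) Pinf (to_ac (-1) :: 'a alg_closure)"
      using value_inf_form[of 0 "-1"]
      by (simp add: total_degree_le_uminus)
    then have "has_value (- 1 :: 'a herm_field) Pinf (- 1)" by (simp add: coord_uminus fr_uminus)
    from value_inf_mult[OF this that] show ?thesis by simp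
  qed
  show "has_value (inverse f) Pinf (inverse z)" if "has_value f Pinf z" "z \<noteq> 0"
  proof -
    from that(1) obtain n G H where G: "total_degree_le n G" "total_degree_le n H" "corner n H \<noteq> 0" "coord H \<noteq> 0"
      "f = fr (coord G) / fr (coord H)" "z = to_ac (corner n G / corner n H)"
      by (rule value_infE)
    have "corner n G \<noteq> 0" using G(6) that(2) by auto
    from value_infI[OF G(2,1) this] show ?thesis using G(5,6) by simp
  qed
  show "has_value s_inf Pinf 0" by (rule value_s_inf)
  show "s_inf \<noteq> 0" using YY_nz by simp
  show "\<exists>g w. f = s_inf * g \<and> has_value g Pinf w" if "has_value f Pinf 0"
    using that by (rule s_inf_dvd)
  show "\<exists>g h z w. f = g / h \<and> has_value g Pinf z \<and> has_value h Pinf w"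
  proof -
    obtain g h where gh: "f = fr g / fr h" using ex_fr_divide by blast
    obtain G H where GH: "g = coord G" "h = coord H" using coord_surj by meson
    obtain n m where "total_degree_le n G" "total_degree_le m H" using ex_total_degree_le by meson
    then have "total_degree_le (n + m) G" "total_degree_le (n + m) H"
      by (auto intro: total_degree_le_mono)
    from this[THEN value_inf_form] show ?thesis
      using gh GH YY_nz
      by (intro exI[of _ "fr g / fr YY ^ (n + m)"] exI[of _ "fr h / fr YY ^ (n + m)"]) auto
  qed
  show "\<exists>N. \<forall>g w. has_value g Pinf w \<longrightarrow> f \<noteq> g * s_inf ^ N"
    if "has_value f Pinf z" "f \<noteq> 0"
  proof -
    from that(1) obtain n G H where G: "total_degree_le n G" "total_degree_le n H" "corner n H \<noteq> 0" "coord H \<noteq> 0"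
      "f = fr (coord G) / fr (coord H)" "z = to_ac (corner n G / corner n H)"
      by (rule value_infE)
    have "coord G \<noteq> 0" using G(5) that(2) by auto
    then obtain p g' where p: "p \<noteq> 0" "emb p = coord G * g'" by (rule ex_emb_multiple)
    obtain G' where G': "g' = coord G'" using coord_surj by blast
    obtain n' where n': "total_degree_le n' G'" using ex_total_degree_le by blast
    define k where "k = degree p"
    \<comment> \<open>\<open>1 / y\<close> has order \<open>q + 1\<close> and \<open>p / x^k\<close>
      is a unit, so \<open>M\<close> is the order of \<open>1 / y^(n + n')\<close>. Since
      \<open>1 / x\<close> is regular, a factor \<open>s_inf ^ Suc M\<close> of \<open>f\<close>
      would force the unit to vanish.\<close>
    define M where "M = (q + 1) * (n + n')"
    have "f \<noteq> g * s_inf ^ Suc M" if g: "has_value g Pinf w" for g w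
    proof
      assume f: "f = g * s_inf ^ Suc M"
      let ?x = "fr XX :: 'a herm_field" and ?y = "fr YY :: 'a herm_field"
      have nz: "?x \<noteq> 0" "?y \<noteq> 0" "s_inf \<noteq> 0" using YY_nz by auto
      have "fr (emb p) / ?x ^ k * (e_inf ^ (n + n') * s_inf ^ M) = fr (emb p) / ?x ^ k * inverse ?y ^ (n + n')"
        unfolding inverse_YY_eq M_def power_mult power_mult_distrib by (simp only: mult_ac)
      also have "\<dots> = f * (fr (coord H) / ?y ^ n) * (fr (coord G') / ?y ^ n') * inverse ?x ^ k"
        using G(4,5) nz by (simp add: p(2) G' fr_mult power_add field_simps)
      also have "\<dots> = g * s_inf * (fr (coord H) / ?y ^ n) * (fr (coord G') / ?y ^ n') * inverse ?x ^ k * s_inf ^ M"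
        unfolding f by (simp add: mult_ac)
      finally have "fr (emb p) / ?x ^ k * e_inf ^ (n + n') =
          g * s_inf * (fr (coord H) / ?y ^ n) * (fr (coord G') / ?y ^ n') * inverse ?x ^ k"
        using nz by (simp add: mult.assoc[symmetric] del: times_divide_eq_left times_divide_eq_right)
      moreover have "has_value (fr (emb p) / ?x ^ k * e_inf ^ (n + n')) Pinf (to_ac (lead_coeff p) * 1 ^ (n + n'))"
        unfolding k_def by (intro value_inf_mult value_inf_power value_inf_emb value_e_inf p)
      moreover have "has_value (g * s_inf * (fr (coord H) / ?y ^ n) * (fr (coord G') / ?y ^ n') * inverse ?x ^ k)
          Pinf (w * 0 * to_ac (corner n H) * to_ac (corner n' G') * 0 ^ k)"
        by (intro value_inf_mult value_inf_power value_inf_form value_s_inf value_inverse_XX g G n')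
      ultimately have "to_ac (lead_coeff p) * 1 ^ (n + n') = w * 0 * to_ac (corner n H) * to_ac (corner n' G') * 0 ^ k"
        using value_inf_unique by metis
      then show False using p(1) by simp
    qed
    then show ?thesis by blast
  qed
qed

end

section \<open>Functions regular on the affine curve\<close>

context hermitian
begin

abbreviation aff :: "'a alg_closure \<Rightarrow> 'a alg_closure \<Rightarrow> 'a geom_point" where
  "aff a b \<equiv> proj_point a b 1"

lemma proj_point_mem: "(x, y, z) \<in> proj_point x y (z :: 'k::field)"
  by (auto simp: proj_point_def intro!: exI[of _ 1])

lemma aff_eq_iff: "aff a b = aff a' b' \<longleftrightarrow> a = a' \<and> b = b'"
proof
  assume "aff a b = aff a' b'"
  then have "(a, b, 1) \<in> aff a' b'" using proj_point_mem by metis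
  then show "a = a' \<and> b = b'" by (auto simp: proj_point_def)
qed auto

lemma aff_neq_Pinf [simp]: "aff a b \<noteq> Pinf" "Pinf \<noteq> aff a b"
proof -
  show "aff a b \<noteq> Pinf"
  proof
    assume "aff a b = Pinf"
    then have "(a, b, 1) \<in> Pinf" using proj_point_mem by metis
    then show False by (auto simp: proj_point_def P_inf_def)
  qed
  then show "Pinf \<noteq> aff a b" by metis
qed

lemma proj_point_scale:
  assumes "c \<noteq> (0 :: 'k::field)"
  shows "proj_point (c * x) (c * y) (c * z) = proj_point x y z"
proof -
  have "\<exists>k. (l * x, l * y, l * z) = (k * (c * x), k * (c * y), k * (c * z)) \<and> k \<noteq> 0" if "l \<noteq> 0" for l
    using assms that by (intro exI[of _ "l / c"]) simp
  moreover have "\<exists>k. (l * (c * x), l * (c * y), l * (c * z)) = (k * x, k * y, k * z) \<and> k \<noteq> 0" if "l \<noteq> 0" for l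
    using assms that by (intro exI[of _ "l * c"]) simp
  ultimately show ?thesis unfolding proj_point_def by blast
qed

lemma herm_curve_eq: "herm_curve = insert Pinf {aff a b | a b. on_curve a b}"
proof (intro equalityI subsetI)
  fix S :: "'a geom_point" assume "S \<in> herm_curve"
  then obtain x y z where S: "S = proj_point x y z" "(x, y, z) \<noteq> (0, 0, 0)"
    "x ^ (q + 1) - y ^ q * z - y * z ^ q = 0"
    unfolding herm_curve_def qq_eq by blast
  show "S \<in> insert Pinf {aff a b | a b. on_curve a b}"
  proof (cases "z = 0")
    case True
    then have "x = 0" using S(3) q_ge_2 by (simp add: power_0_left)
    then have "S = Pinf"
      using S(1,2) True proj_point_scale[of y 0 1 0] by (simp add: P_inf_def)
    then show ?thesis by simp
  next
    case False
    have "S = aff (x / z) (y / z)"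
      using S(1) False proj_point_scale[of z "x / z" "y / z" 1] by simp
    moreover have "on_curve (x / z) (y / z)"
    proof -
      have x: "x ^ (q + 1) = y ^ q * z + y * z ^ q"
        using S(3) by (simp only: diff_diff_eq right_minus_eq)
      have "(x / z) ^ (q + 1) = (y ^ q * z + y * z ^ q) / (z ^ q * z)"
        by (simp only: power_divide x) (simp add: mult.commute)
      also have "\<dots> = (y / z) ^ q + y / z"
        using False by (simp add: add_divide_distrib power_divide)
      finally show ?thesis by (simp add: on_curve_def)
    qed
    ultimately show ?thesis by blast
  qed
next
  fix S :: "'a geom_point" assume "S \<in> insert Pinf {aff a b | a b. on_curve a b}"
  then consider "S = proj_point 0 1 0" | a b where "S = proj_point a b 1" "on_curve a b"
    by (auto simp: P_inf_def)
  then show "S \<in> herm_curve"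
  proof cases
    case 1
    then show ?thesis unfolding herm_curve_def qq_eq using q_ge_2
      by (intro CollectI exI[of _ 0] exI[of _ 1]) (auto simp: power_0_left)
  next
    case 2
    then show ?thesis unfolding herm_curve_def qq_eq on_curve_def
      by (intro CollectI exI[of _ a] exI[of _ b] exI[of _ 1]) auto
  qed
qed

text \<open>The trace \<open>c^q + c\<close> on \<open>q^2\<close> elements takes its values among
  the at most \<open>q\<close> solutions of \<open>c^q = c\<close>, and its nonempty fibres are
  translates of the kernel.\<close>

lemma card_trace_kernel: "q \<le> card {c :: 'a. c ^ q + c = 0}"
proof -
  define K where "K = {c :: 'a. c ^ q + c = 0}"
  define tr where "tr c = c ^ q + c" for c :: 'a
  define R where "R = {c :: 'a. c ^ q = c}"
  have "card R \<le> degree (monom 1 q - monom 1 1 :: 'a poly)"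
  proof -
    have "coeff (monom 1 q - monom 1 1 :: 'a poly) q = 1" using q_ge_2 by simp
    then have "(monom 1 q - monom 1 1 :: 'a poly) \<noteq> 0" by (metis coeff_0 zero_neq_one)
    from card_poly_roots_bound[OF this] show ?thesis by (simp add: R_def poly_monom)
  qed
  also have "\<dots> \<le> q" using q_ge_2 by (intro degree_diff_le degree_monom_le order.trans[OF degree_monom_le]) auto
  finally have R: "card R \<le> q" .
  have "tr c \<in> R" for c
    by (simp add: R_def tr_def frob_q power_q_q add.commute)
  then have "UNIV = (\<Union>r\<in>R. {c. tr c = r})" by auto
  then have "CARD('a) \<le> (\<Sum>r\<in>R. card {c. tr c = r})"
    using card_UN_le[of R "\<lambda>r. {c. tr c = r}"] by simp
  also have "\<dots> \<le> (\<Sum>r\<in>R. card K)"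
  proof (rule sum_mono)
    fix r
    show "card {c. tr c = r} \<le> card K"
    proof (cases "\<exists>c0. tr c0 = r")
      case True
      then obtain c0 where c0: "tr c0 = r" ..
      have "(c - c0) ^ q + (c - c0) = tr c - tr c0" for c
        by (simp add: tr_def frob_q)
      then have "(\<lambda>c. c - c0) ` {c. tr c = r} \<subseteq> K"
        using c0 by (auto simp: K_def)
      then show ?thesis by (intro card_inj_on_le[where f = "\<lambda>c. c - c0"]) (auto intro: inj_onI)
    qed simp
  qed
  also have "\<dots> \<le> q * card K" using R by simp
  finally have "q * q \<le> q * card K" by (simp add: card_q power2_eq_square)
  then show ?thesis using q_ge_2 by (simp add: K_def)
qed

text \<open>One point exists because the closure is algebraically closed; the trace kernel,
  contained in the ground field, then acts on the fibre by translation of y.\<close>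

lemma card_fibre: "q \<le> card {b. on_curve a b}"
proof -
  let ?p = "monom 1 q + monom 1 1 - [:a ^ (q + 1):] :: 'a alg_closure poly"
  have c: "coeff ?p q = 1" using q_ge_2 by (simp add: coeff_pCons split: nat.splits)
  then have p0: "?p \<noteq> 0" by (metis coeff_0 zero_neq_one)
  have "q \<le> degree ?p" using c by (intro le_degree) simp
  then obtain b0 where "poly ?p b0 = 0" using alg_closed_imp_poly_has_root[of ?p] q_ge_2 by auto
  then have b0: "b0 ^ q + b0 = a ^ (q + 1)" by (simp add: poly_monom)
  have fin: "finite {b. on_curve a b}"
  proof -
    have "{b. on_curve a b} \<subseteq> {b. poly ?p b = 0}" by (auto simp: on_curve_def poly_monom)
    then show ?thesis using poly_roots_finite[OF p0] by (rule finite_subset)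
  qed
  have "(\<lambda>c. b0 + to_ac c) ` {c. c ^ q + c = 0} \<subseteq> {b. on_curve a b}"
  proof clarify
    fix c :: 'a assume "c ^ q + c = 0"
    then have "to_ac c ^ q + to_ac c = 0" by (metis to_ac_0 to_ac_add to_ac_power)
    moreover have "(b0 + to_ac c) ^ q + (b0 + to_ac c) = (b0 ^ q + b0) + (to_ac c ^ q + to_ac c)"
      by (simp add: frob_q)
    ultimately show "on_curve a (b0 + to_ac c)"
      by (simp only: on_curve_def b0) simp
  qed
  then have "card {c :: 'a. c ^ q + c = 0} \<le> card {b. on_curve a b}"
    by (intro card_inj_on_le[where f = "\<lambda>c. b0 + to_ac c"] fin) (auto intro: inj_onI)
  then show ?thesis using card_trace_kernel by simp
qed

text \<open>
  A denominator of least degree among the polynomials in \<open>x\<close> is constant: at a root \<open>a\<close> of it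
  the numerator, of degree less than \<open>q\<close> in \<open>y\<close>, vanishes at all \<open>q\<close> points over \<open>a\<close>.
\<close>
lemma regular_imp_fr:
  assumes reg: "\<And>a b. on_curve a b \<Longrightarrow> \<exists>z. has_value f (aff a b) z"
  obtains g where "f = fr g"
proof -
  define I where "I = {r :: 'a poly. r \<noteq> 0 \<and> (\<exists>A. fr (emb r) * f = fr A)}"
  obtain g h where gh: "h \<noteq> 0" "f = fr g / fr h" using ex_fr_divide by blast
  obtain r0 h' where r0: "r0 \<noteq> 0" "emb r0 = h * h'" using gh(1) by (rule ex_emb_multiple)
  have "fr (emb r0) * f = fr (g * h')" using gh r0 by (simp add: fr_mult)
  then have "r0 \<in> I" using r0 by (auto simp: I_def)
  then obtain r where r: "r \<in> I" and min: "\<And>r'. r' \<in> I \<Longrightarrow> degree r \<le> degree r'"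
    using ex_has_least_nat[of "\<lambda>r. r \<in> I" r0 degree] by blast
  then obtain A where A: "fr (emb r) * f = fr A" and r_nz: "r \<noteq> 0" by (auto simp: I_def)
  have "degree r = 0"
  proof (rule ccontr)
    assume "degree r \<noteq> 0"
    then have "degree (map_poly to_ac r) > 0" by (simp add: degree_map_poly)
    then obtain a where a: "ac_poly r a = 0" using alg_closed_imp_poly_has_root by blast
    obtain p where p: "min_poly_of a p" using ex_min_poly by blast
    then obtain r' where r': "r = p * r'" using a by (auto simp: min_poly_of_def elim: dvdE)
    obtain G where G: "A = coord G" "degree G < q" using ex_reduced[of A] by (metis qq_eq)
    have ev0: "ev a b G = 0" if oc: "on_curve a b" for b
    proof -
      obtain z where "has_value f (aff a b) z" using reg oc by blast
      then obtain u v where uv: "v \<noteq> 0" "f = fr u / fr v" "evr a b v \<noteq> 0"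
        using oc by (elim value_affineE)
      have "fr (emb r * u) = fr (A * v)" using A uv by (simp add: fr_mult field_simps)
      then have "emb r * u = A * v" by simp
      then have "evr a b (emb r * u) = evr a b (A * v)" by simp
      then have "evr a b A = 0" using a uv(3) by (simp add: evr_mult[OF oc] evr_emb[OF oc])
      then show ?thesis by (simp add: G evr_coord[OF oc])
    qed
    have "map_poly (\<lambda>c. ac_poly c a) G = 0"
    proof (rule ccontr)
      assume nz: "map_poly (\<lambda>c. ac_poly c a) G \<noteq> 0"
      have "q \<le> card {b. on_curve a b}" by (rule card_fibre)
      also have "\<dots> \<le> card {b. poly (map_poly (\<lambda>c. ac_poly c a) G) b = 0}"
        using ev0 by (intro card_mono poly_roots_finite nz) (auto simp: ev_def)
      also have "\<dots> \<le> degree (map_poly (\<lambda>c. ac_poly c a) G)" by (rule card_poly_roots_bound[OF nz])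
      also have "\<dots> \<le> degree G" by (rule map_poly_degree_leq)
      finally show False using G(2) by simp
    qed
    then have "coeff (map_poly (\<lambda>c. ac_poly c a) G) j = 0" for j by simp
    \<comment> \<open>All coefficients of the numerator vanish at \<open>a\<close>, so the minimal
      polynomial cancels against the denominator and lowers its degree.\<close>
    then have "p dvd coeff G j" for j
      using p by (simp add: coeff_map_poly min_poly_of_def)
    then have "[:p:] dvd G" by (simp add: const_poly_dvd_iff)
    then obtain G' where "G = [:p:] * G'" ..
    then have A': "A = emb p * coord G'" by (simp only: G(1) coord_mult emb_def)
    have "p \<noteq> 0" "r' \<noteq> 0" using r' r_nz by auto
    have "fr (emb p) * (fr (emb r') * f) = fr (emb p) * fr (coord G')"
      using A A' r' by (simp add: emb_mult fr_mult mult_ac)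
    then have "fr (emb r') * f = fr (coord G')" using \<open>p \<noteq> 0\<close> by simp
    then have "r' \<in> I" using \<open>r' \<noteq> 0\<close> by (auto simp: I_def)
    then have "degree r \<le> degree r'" by (rule min)
    then show False using r' \<open>p \<noteq> 0\<close> \<open>r' \<noteq> 0\<close> min_poly_degree[OF p] by (simp add: degree_mult_eq)
  qed
  then obtain c where c: "r = [:c:]" by (rule degree_eq_zeroE)
  then have "c \<noteq> 0" using r_nz by simp
  have "emb [:inverse c:] * emb r = 1"
    unfolding c emb_mult[symmetric] using \<open>c \<noteq> 0\<close> by (simp flip: one_pCons)
  then have "fr (emb [:inverse c:]) * fr (emb r) = 1" by (simp only: fr_mult[symmetric] fr_1)
  then have "f = fr (emb [:inverse c:]) * (fr (emb r) * f)" by (simp only: mult.assoc[symmetric] mult_1_left)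
  then have "f = fr (emb [:inverse c:] * A)" by (simp only: A fr_mult)
  then show thesis by (rule that)
qed

section \<open>Orders of forms\<close>

abbreviation vg :: "'a geom_point \<Rightarrow> int \<Rightarrow> 'a herm_field \<Rightarrow> bool" where
  "vg \<equiv> valued_point.vge"

sublocale inf: valued_point Pinf s_inf
  by (rule valued_point_infinity)

text \<open>The binary form of degree \<open>m\<close> in x and y whose dehomogenisation at
  \<open>y = 1\<close> is \<open>p\<close>.\<close>

definition hpoly :: "nat \<Rightarrow> 'a poly \<Rightarrow> 'a poly poly" where
  "hpoly m p = (\<Sum>i\<le>m. monom (monom (coeff p i) i) (m - i))"

lemma coeff_hpoly: "coeff (coeff (hpoly m p) j) i = (if i + j = m then coeff p i else 0)"
proof -
  have "coeff (coeff (hpoly m p) j) i = (\<Sum>k\<le>m. if k = i then (if i + j = m then coeff p i else 0) else 0)"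
    unfolding hpoly_def coeff_sum by (intro sum.cong refl) auto
  then show ?thesis by auto
qed

lemma total_degree_le_hpoly: "total_degree_le m (hpoly m p)"
  by (simp add: total_degree_le_def coeff_hpoly)

text \<open>The part of degree \<open>m\<close> with y set to 1, that is, the restriction of the
  form to the line \<open>Z = 0\<close>, the tangent at infinity.\<close>

definition top_form :: "nat \<Rightarrow> 'a poly poly \<Rightarrow> 'a poly" where
  "top_form m F = (\<Sum>i\<le>m. monom (coeff (coeff F (m - i)) i) i)"

lemma coeff_top: "coeff (top_form m F) i = (if i \<le> m then coeff (coeff F (m - i)) i else 0)"
proof -
  have "coeff (top_form m F) i = (\<Sum>k\<le>m. if k = i then coeff (coeff F (m - i)) i else 0)"
    unfolding top_form_def coeff_sum by (intro sum.cong refl) auto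
  then show ?thesis by auto
qed

lemma degree_top: "degree (top_form m F) \<le> m"
  by (rule degree_le) (simp add: coeff_top)

lemma hpoly_mult:
  assumes "degree w + e \<le> m"
  shows "hpoly m (monom 1 e * w) = [:monom 1 e:] * hpoly (m - e) w"
proof (intro poly_eqI)
  fix j i
  have "coeff w (i - e) = 0" if "i + j = m" "\<not> i - e + j = m - e" "e \<le> i"
    using that by simp
  moreover have "coeff w (i - e) = 0" if "i + j \<noteq> m" "i - e + j = m - e" "e \<le> i"
    using that assms by simp
  ultimately show "coeff (coeff (hpoly m (monom 1 e * w)) j) i = coeff (coeff ([:monom 1 e:] * hpoly (m - e) w) j) i"
    by (auto simp: coeff_hpoly coeff_monom_mult)
qed

lemma fr_coord_monom_const: "fr (coord [:monom 1 e:]) = (fr XX :: 'a herm_field) ^ e"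
  by (simp add: emb_def[symmetric] emb_monom one_pCons[symmetric] fr_power)

text \<open>Divided by \<open>y ^ m\<close>, the binary form becomes \<open>p\<close> evaluated at
  the uniformizer \<open>x / y\<close>, so its order is the multiplicity of the root 0 of
  \<open>p\<close>.\<close>

lemma vge_hpoly:
  assumes "degree p \<le> m"
  shows "inf.vge (int i) (fr (coord (hpoly m p)) / fr YY ^ m) \<longleftrightarrow> monom 1 i dvd p"
proof (cases "p = 0")
  case True
  then show ?thesis by (simp add: hpoly_def)
next
  case False
  obtain e w where e: "p = monom 1 e * w" "\<not> [:0, 1:] dvd w"
    using poly_decompose[of p "[:0, 1:]"] False by (auto simp: monom_eq_power)
  have w: "w \<noteq> 0" "coeff w 0 \<noteq> 0"
    using False e poly_eq_0_iff_dvd[of w 0] by (auto simp: poly_0_coeff_0)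
  have dw: "degree w + e \<le> m" using assms w by (simp add: e(1) degree_mult_eq degree_monom_eq)
  have U: "inf.unit (fr (coord (hpoly (m - e) w)) / fr YY ^ (m - e))"
    unfolding inf.unit_def
    using value_inf_form[OF total_degree_le_hpoly, of "m - e" w] dw w
    by (intro exI[of _ "to_ac (corner (m - e) (hpoly (m - e) w))"]) (simp add: coeff_hpoly)
  have "fr (coord (hpoly m p)) / fr YY ^ m =
      fr (coord (hpoly (m - e) w)) / fr YY ^ (m - e) * s_inf powi (int e)"
  proof -
    have "(fr YY :: 'a herm_field) ^ m = fr YY ^ (m - e) * fr YY ^ e" using dw by (simp flip: power_add)
    then show ?thesis
      by (simp add: e(1) hpoly_mult[OF dw] coord_mult fr_mult fr_coord_monom_const power_divide
          del: mult_pCons_left)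
  qed
  with U have "ord_at Pinf (fr (coord (hpoly m p)) / fr YY ^ m) = int e"
    by (rule inf.ord_eqI)
  moreover have "coord (hpoly (m - e) w) \<noteq> 0" using inf.unit_nz[OF U] by auto
  then have "coord (hpoly m p) \<noteq> 0"
    by (simp add: e(1) hpoly_mult[OF dw] coord_mult emb_def[symmetric] monom_eq_0_iff
        del: mult_pCons_left)
  moreover have "monom 1 i dvd p \<longleftrightarrow> i \<le> e"
  proof
    assume "monom 1 i dvd p"
    then obtain v where "p = monom 1 i * v" ..
    then have "coeff p e = (if i \<le> e then coeff v (e - i) else 0)" by (simp add: coeff_monom_mult)
    moreover have "coeff p e \<noteq> 0" using w(2) by (simp add: e(1) coeff_monom_mult)
    ultimately show "i \<le> e" by presburger
  next
    assume "i \<le> e"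
    then have "monom (1::'a) i dvd monom 1 e" by (simp add: monom_eq_power le_imp_power_dvd)
    then show "monom 1 i dvd p" by (simp add: e(1))
  qed
  ultimately show ?thesis using YY_nz by (simp add: inf.vge_def)
qed

lemma vge_inverse_YY: "inf.vge (int q + 1) (inverse (fr YY))"
  unfolding inf.vge_iff inverse_YY_eq
  by (intro exI[of _ e_inf] exI[of _ 1] conjI value_e_inf) (simp add: power_int_def nat_add_distrib mult.commute)

lemma ord_inf_YY: "ord_at Pinf (fr YY) = - (int q + 1)"
proof -
  have "inf.unit e_inf" using value_e_inf unfolding inf.unit_def by (intro exI[of _ 1]) simp
  moreover have "inverse (fr YY) = e_inf * s_inf powi (int q + 1)"
    unfolding inverse_YY_eq by (simp add: power_int_def nat_add_distrib mult.commute)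
  ultimately have "ord_at Pinf (inverse (fr YY)) = int q + 1" by (rule inf.ord_eqI)
  then show ?thesis using inf.ord_inverse[of "fr YY"] YY_nz by simp
qed

text \<open>The clause for \<open>m = 0\<close> is there because \<open>m - 1\<close> is truncated:
  without it a constant would be allowed as lower part.\<close>

lemma top_decompose:
  assumes "total_degree_le m F"
  obtains F' where "F = hpoly m (top_form m F) + F'" "m = 0 \<longrightarrow> F' = 0" "total_degree_le (m - 1) F'"
proof -
  define F' where "F' = F - hpoly m (top_form m F)"
  have c: "coeff (coeff F' j) i = (if i + j = m then 0 else coeff (coeff F j) i)" for i j
    by (auto simp: F'_def coeff_hpoly coeff_top)
  have td: "i + j < m" if "coeff (coeff F' j) i \<noteq> 0" for i j
    using that assms by (auto simp: c total_degree_le_def nat_less_le split: if_splits)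
  show thesis
  proof (rule that)
    show "F = hpoly m (top_form m F) + F'" by (simp add: F'_def)
    show "m = 0 \<longrightarrow> F' = 0" using td by (auto simp: poly_eq_iff)
    show "total_degree_le (m - 1) F'" unfolding total_degree_le_def using td by fastforce
  qed
qed

text \<open>Terms below the top degree carry the factor Z, the tangent at infinity; relative to
  \<open>y ^ m\<close> this is a factor \<open>1 / y\<close>, of order \<open>q + 1\<close>.\<close>

lemma vge_lower_form:
  assumes "m = 0 \<longrightarrow> F' = 0" "total_degree_le (m - 1) F'"
  shows "inf.vge (int q + 1) (fr (coord F') / fr YY ^ m)"
proof (cases "m = 0")
  case False
  have "inf.vge 0 (fr (coord F') / fr YY ^ (m - 1))"
    unfolding inf.vge_regular_iff using value_inf_form[OF assms(2)] by blast
  from inf.vge_mult[OF vge_inverse_YY this]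
  have "inf.vge (int q + 1) (inverse (fr YY) * (fr (coord F') / fr YY ^ (m - 1)))" by simp
  moreover have "(fr YY :: 'a herm_field) ^ m = fr YY * fr YY ^ (m - 1)"
    using False by (cases m) auto
  ultimately show ?thesis by (simp add: field_simps)
qed (use assms in simp)

text \<open>Up to order \<open>q + 1\<close> only the top form is seen. The shift by
  \<open>m * (q + 1)\<close> is the pole order of \<open>y ^ m\<close>.\<close>

lemma vge_form_infinity:
  assumes "total_degree_le m F" "i \<le> q + 1"
  shows "inf.vge (int i - int m * (int q + 1)) (fr (coord F)) \<longleftrightarrow> monom 1 i dvd top_form m F"
proof -
  obtain F' where F': "F = hpoly m (top_form m F) + F'" "m = 0 \<longrightarrow> F' = 0" "total_degree_le (m - 1) F'"
    using assms(1) by (rule top_decompose)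
  have "fr (coord F) / fr YY ^ m - fr (coord (hpoly m (top_form m F))) / fr YY ^ m = fr (coord F') / fr YY ^ m"
    using arg_cong[OF F'(1), of "\<lambda>F. fr (coord F) / fr YY ^ m"]
    by (simp add: coord_add fr_add add_divide_distrib)
  then have "inf.vge (int i) (fr (coord F) / fr YY ^ m - fr (coord (hpoly m (top_form m F))) / fr YY ^ m)"
    using inf.vge_mono[OF vge_lower_form[OF F'(2,3)], of "int i"] assms(2) by simp
  then have "inf.vge (int i) (fr (coord F) / fr YY ^ m) \<longleftrightarrow> monom 1 i dvd top_form m F"
    unfolding vge_hpoly[OF degree_top, symmetric] by (rule inf.vge_cong)
  moreover have "inf.vge (int i) (fr (coord F) * inverse (fr YY ^ m)) \<longleftrightarrow>
      inf.vge (int i - ord_at Pinf (inverse (fr YY ^ m))) (fr (coord F))"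
    using YY_nz by (intro inf.vge_mult_iff) simp
  moreover have "ord_at Pinf (inverse (fr YY ^ m)) = int m * (int q + 1)"
    using YY_nz by (simp add: inf.ord_inverse inf.ord_power ord_inf_YY algebra_simps)
  ultimately show ?thesis by (simp add: divide_inverse)
qed

text \<open>
  A representative of least total degree has a top form that is not divisible by \<open>x\<^sup>q\<^sup>+\<^sup>1\<close>,
  hence a pole of the expected order at infinity.
\<close>
lemma ex_form_of_degree:
  assumes "inf.vge (- (int m * (int q + 1))) (fr g)"
  obtains F where "total_degree_le m F" "g = coord F"
proof -
  define Pd where "Pd n \<longleftrightarrow> (\<exists>F. total_degree_le n F \<and> g = coord F)" for n
  have "\<exists>n. Pd n" using coord_surj[of g] ex_total_degree_le unfolding Pd_def by metis
  define M where "M = (LEAST n. Pd n)"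
  have "Pd M" unfolding M_def using \<open>\<exists>n. Pd n\<close> by (rule LeastI_ex)
  then obtain F where F: "total_degree_le M F" "g = coord F" by (auto simp: Pd_def)
  have "M \<le> m"
  proof (rule ccontr)
    assume "\<not> M \<le> m"
    then have Mm: "m + 1 \<le> M" by simp
    have nP: "\<not> Pd (M - 1)" using Mm not_less_Least[of "M - 1" Pd] by (simp add: M_def)
    obtain F' where F': "F = hpoly M (top_form M F) + F'" "M = 0 \<longrightarrow> F' = 0" "total_degree_le (M - 1) F'"
      using F(1) by (rule top_decompose)
    have "int (m + 1) * (int q + 1) \<le> int M * (int q + 1)"
      using Mm by (intro mult_right_mono) auto
    \<comment> \<open>Since \<open>M > m\<close>, the allowed pole is smaller than that of
      \<open>y ^ M\<close> by at least \<open>q + 1\<close>, which forces the top form to be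
      divisible by \<open>x^(q+1)\<close>.\<close>
    then have "inf.vge (int (q + 1) - int M * (int q + 1)) (fr (coord F))"
      using assms unfolding F(2) by (elim inf.vge_mono) (simp add: algebra_simps)
    then have "monom 1 (q + 1) dvd top_form M F"
      using vge_form_infinity[OF F(1), of "q + 1"] by simp
    then obtain w where w: "top_form M F = monom 1 (q + 1) * w" ..
    have "\<exists>F''. total_degree_le (M - 1) F'' \<and> coord (hpoly M (top_form M F)) = coord F''"
    proof (cases "w = 0")
      case True
      then show ?thesis using w by (intro exI[of _ 0]) (simp add: hpoly_def)
    next
      case False
      have dw: "degree w + (q + 1) \<le> M"
        using degree_top[of M F] False by (simp add: w degree_mult_eq degree_monom_eq monom_eq_0_iff)
      \<comment> \<open>Trading \<open>x^(q+1)\<close> for \<open>y^q + y\<close> keeps the function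
        and lowers the total degree by one, against the minimality of \<open>M\<close>.\<close>
      have "coord (hpoly M (top_form M F)) = coord (Bp * hpoly (M - (q + 1)) w)"
        unfolding w hpoly_mult[OF dw] coord_mult coord_Bp
        by (simp add: emb_def[symmetric] emb_monom one_pCons[symmetric])
      moreover have "total_degree_le (q + (M - (q + 1))) (Bp * hpoly (M - (q + 1)) w)"
        by (intro total_degree_le_mult total_degree_le_Bp total_degree_le_hpoly)
      moreover have "q + (M - (q + 1)) = M - 1" using dw by simp
      ultimately show ?thesis by metis
    qed
    then obtain F'' where F'': "total_degree_le (M - 1) F''" "coord (hpoly M (top_form M F)) = coord F''" by blast
    have "g = coord (F'' + F')"
      using F(2) F'(1) F''(2) by (metis coord_add)
    then have "Pd (M - 1)" using F''(1) F'(3) total_degree_le_add unfolding Pd_def by blast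
    with nP show False ..
  qed
  then show thesis using that total_degree_le_mono F by blast
qed

end

section \<open>Tangent lines\<close>

context hermitian
begin

text \<open>The gradient of \<open>X^(q+1) - Y^q Z - Y Z^q\<close> is
  \<open>(X^q, -Z^q, -Y^q)\<close>, so the tangent at a rational point is
  \<open>y = \<alpha>^q x - \<beta>^q\<close>.\<close>

definition tline :: "'a \<Rightarrow> 'a \<Rightarrow> 'a poly" where
  "tline \<alpha> \<beta> = [:- (\<beta> ^ q), \<alpha> ^ q:]"

definition tangent :: "'a \<Rightarrow> 'a \<Rightarrow> 'a herm_ring" where
  "tangent \<alpha> \<beta> = YY - emb (tline \<alpha> \<beta>)"

lemma tangent_0: "tangent 0 0 = YY"
  using q_ge_2 by (simp add: tangent_def tline_def)

lemma P_aff_eq: "P_aff \<alpha> \<beta> = aff (to_ac \<alpha>) (to_ac \<beta>)"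
  by (simp add: P_aff_def)

context
  fixes \<alpha> \<beta> :: 'a
  assumes curve: "\<alpha> ^ (q + 1) = \<beta> ^ q + \<beta>"
begin

lemma on_curve_rational: "on_curve (to_ac \<alpha>) (to_ac \<beta>)"
  unfolding on_curve_def by (metis curve to_ac_add to_ac_power)

lemma valued_point_rational: "valued_point (P_aff \<alpha> \<beta>) (fr (emb [:- \<alpha>, 1:]))"
  unfolding P_aff_eq by (rule valued_point_affine[OF on_curve_rational min_poly_to_ac])

text \<open>The curve equation again, in coordinates centred at the point: the tangent replaces y
  and \<open>x - \<alpha>\<close> replaces x. Rationality enters through
  \<open>(\<alpha>^q)^q = \<alpha>\<close>. The relation shows that the tangent meets the curve at
  no other affine point, and here with multiplicity \<open>q + 1\<close>.\<close>

lemma tangent_relation: "tangent \<alpha> \<beta> + tangent \<alpha> \<beta> ^ q = emb [:- \<alpha>, 1:] ^ (q + 1)"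
proof -
  define c where "c x = emb [:x:]" for x :: 'a
  have c_power: "c x ^ n = c (x ^ n)" for x n
    unfolding c_def emb_power[symmetric] poly_const_pow ..
  have c_mult: "c x * c y = c (x * y)" and c_add: "c x + c y = c (x + y)" for x y
    unfolding c_def by (simp_all add: mult.commute flip: emb_mult emb_add)
  have "tline \<alpha> \<beta> = [:\<alpha> ^ q:] * [:0, 1:] - [:\<beta> ^ q:]" by (simp add: tline_def)
  then have t: "tangent \<alpha> \<beta> = YY - (c (\<alpha> ^ q) * XX - c (\<beta> ^ q))"
    unfolding tangent_def c_def by (simp only: emb_mult emb_diff)
  have tq: "tangent \<alpha> \<beta> ^ q = YY ^ q - (c \<alpha> * XX ^ q - c \<beta>)"
    unfolding t frob_q(4) by (simp only: frob_q(4) power_mult_distrib c_power power_q_q)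
  have "[:- \<alpha>, 1:] = [:0, 1:] - [:\<alpha>:]" by simp
  then have x: "emb [:- \<alpha>, 1:] = XX - c \<alpha>" unfolding c_def by (simp only: emb_diff)
  have "emb [:- \<alpha>, 1:] ^ (q + 1) = (XX ^ q - c (\<alpha> ^ q)) * (XX - c \<alpha>)"
    unfolding x power_add frob_q(4) c_power by simp
  also have "\<dots> = XX ^ (q + 1) - c \<alpha> * XX ^ q - c (\<alpha> ^ q) * XX + c (\<alpha> ^ q) * c \<alpha>"
    by (simp add: algebra_simps)
  also have "c (\<alpha> ^ q) * c \<alpha> = c (\<beta> ^ q) + c \<beta>"
    unfolding c_mult c_add using curve by (simp add: mult.commute)
  finally have x: "emb [:- \<alpha>, 1:] ^ (q + 1) =
      YY ^ q + YY - c \<alpha> * XX ^ q - c (\<alpha> ^ q) * XX + (c (\<beta> ^ q) + c \<beta>)"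
    unfolding curve_relation .
  show ?thesis unfolding tq x by (subst t) (simp add: algebra_simps)
qed

lemma evr_tangent: "on_curve a b \<Longrightarrow> evr a b (tangent \<alpha> \<beta>) = b - ac_poly (tline \<alpha> \<beta>) a"
  by (simp add: tangent_def evr_diff evr_YY evr_emb)

lemma poly_tline: "poly (tline \<alpha> \<beta>) \<alpha> = \<beta>"
  using curve by (simp add: tline_def algebra_simps)

lemma evr_tangent_eq_0:
  assumes oc: "on_curve a b" and 0: "evr a b (tangent \<alpha> \<beta>) = 0"
  shows "a = to_ac \<alpha> \<and> b = to_ac \<beta>"
proof -
  have "evr a b (emb [:- \<alpha>, 1:]) ^ (q + 1) = 0"
    using arg_cong[OF tangent_relation, of "evr a b"] 0 q_ge_2
    by (simp only: evr_add[OF oc] evr_power[OF oc]) (simp add: power_0_left)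
  then have "evr a b (emb [:- \<alpha>, 1:]) = 0" by auto
  then have a: "a = to_ac \<alpha>" by (simp add: evr_emb[OF oc] map_poly_pCons)
  have "b = ac_poly (tline \<alpha> \<beta>) a" using 0 by (simp add: evr_tangent[OF oc])
  then have "b = to_ac \<beta>" by (simp add: a ac_poly_to_ac poly_tline)
  with a show ?thesis by simp
qed

interpretation pt: valued_point "P_aff \<alpha> \<beta>" "fr (emb [:- \<alpha>, 1:])"
  by (rule valued_point_rational)

lemma evr_nz_imp_unit:
  assumes "evr (to_ac \<alpha>) (to_ac \<beta>) g \<noteq> 0"
  shows "pt.unit (fr g)"
  unfolding pt.unit_def unfolding P_aff_eq using value_affine_fr[OF on_curve_rational, of g] assms by blast

lemma tangent_nz: "tangent \<alpha> \<beta> \<noteq> 0"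
proof
  assume "tangent \<alpha> \<beta> = 0"
  then have "emb ([:- \<alpha>, 1:] ^ (q + 1)) = 0"
    using tangent_relation q_ge_2 by (simp add: power_0_left emb_power)
  then show False by (simp only: emb_eq_0_iff power_eq_0_iff) simp
qed

lemma ord_tangent: "ord_at (P_aff \<alpha> \<beta>) (fr (tangent \<alpha> \<beta>)) = int q + 1"
proof -
  \<comment> \<open>By \<open>tangent_relation\<close> the tangent times \<open>u\<close> equals
    \<open>(x - \<alpha>)^(q+1)\<close>, and \<open>u\<close> has value 1 at the point.\<close>
  define u where "u = 1 + tangent \<alpha> \<beta> ^ (q - 1)"
  have "evr (to_ac \<alpha>) (to_ac \<beta>) (tangent \<alpha> \<beta>) = 0"
    by (simp add: evr_tangent[OF on_curve_rational] ac_poly_to_ac poly_tline)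
  then have "evr (to_ac \<alpha>) (to_ac \<beta>) u = 1"
    using q_ge_2 unfolding u_def
    by (simp add: evr_add[OF on_curve_rational] evr_power[OF on_curve_rational]
        evr_1[OF on_curve_rational] power_0_left)
  then have u: "pt.unit (fr u)" by (intro evr_nz_imp_unit) simp
  have "tangent \<alpha> \<beta> * u = emb [:- \<alpha>, 1:] ^ (q + 1)"
    unfolding tangent_relation[symmetric] u_def
    using q_ge_2 power_Suc[of "tangent \<alpha> \<beta>" "q - 1"] by (simp add: algebra_simps)
  then have "fr (tangent \<alpha> \<beta>) = inverse (fr u) * fr (emb [:- \<alpha>, 1:]) ^ (q + 1)"
    using pt.unit_nz[OF u] by (simp add: field_simps flip: fr_mult fr_power)
  then have "fr (tangent \<alpha> \<beta>) = inverse (fr u) * fr (emb [:- \<alpha>, 1:]) powi (int q + 1)"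
    by (simp add: power_int_def nat_add_distrib)
  then show ?thesis using pt.unit_inverse[OF u] by (intro pt.ord_eqI)
qed

lemma vge_emb: "pt.vge (int k) (fr (emb p)) \<longleftrightarrow> [:- \<alpha>, 1:] ^ k dvd p"
proof (cases "p = 0")
  case False
  obtain e w where e: "p = [:- \<alpha>, 1:] ^ e * w" "\<not> [:- \<alpha>, 1:] dvd w"
    using poly_decompose[of p "[:- \<alpha>, 1:]"] False by auto
  then have w: "poly w \<alpha> \<noteq> 0" by (simp add: poly_eq_0_iff_dvd)
  have "evr (to_ac \<alpha>) (to_ac \<beta>) (emb w) \<noteq> 0"
    using w by (simp add: evr_emb[OF on_curve_rational] ac_poly_to_ac)
  then have u: "pt.unit (fr (emb w))" by (rule evr_nz_imp_unit)
  have "ord_at (P_aff \<alpha> \<beta>) (fr (emb p)) = int e"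
    by (rule pt.ord_eqI[OF u]) (simp add: e(1) emb_mult emb_power fr_mult fr_power)
  moreover have "[:- \<alpha>, 1:] ^ k dvd p \<longleftrightarrow> k \<le> e"
  proof
    assume "[:- \<alpha>, 1:] ^ k dvd p"
    show "k \<le> e"
    proof (rule ccontr)
      assume "\<not> k \<le> e"
      then have "[:- \<alpha>, 1:] ^ e * [:- \<alpha>, 1:] dvd p"
        using \<open>[:- \<alpha>, 1:] ^ k dvd p\<close> le_imp_power_dvd[of "Suc e" k "[:- \<alpha>, 1:]"]
        by (auto simp: mult.commute intro: dvd_trans)
      then have "[:- \<alpha>, 1:] dvd w" unfolding e(1) by (subst (asm) dvd_mult_cancel_left) auto
      with e(2) show False ..
    qed
  qed (simp add: e(1) le_imp_power_dvd)
  ultimately show ?thesis using False by (simp add: pt.vge_def)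
qed simp

text \<open>Division by \<open>y - tline\<close> leaves the restriction to the tangent line as
  remainder, while the quotient term has order at least \<open>q + 1\<close>.\<close>

lemma vge_form_tangent:
  assumes "k \<le> q + 1"
  shows "pt.vge (int k) (fr (coord F)) \<longleftrightarrow> [:- \<alpha>, 1:] ^ k dvd poly F (tline \<alpha> \<beta>)"
proof -
  define A where "A = synthetic_div F (tline \<alpha> \<beta>)"
  have "F = [:- tline \<alpha> \<beta>, 1:] * A + [:poly F (tline \<alpha> \<beta>):]"
    unfolding A_def by (rule synthetic_div_correct'[symmetric])
  then have "coord F = coord [:- tline \<alpha> \<beta>, 1:] * coord A + emb (poly F (tline \<alpha> \<beta>))"
    by (metis coord_add coord_mult emb_def)
  moreover have "coord [:- tline \<alpha> \<beta>, 1:] = tangent \<alpha> \<beta>"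
    by (simp add: coord_pCons tangent_def emb_uminus emb_1)
  ultimately have F: "fr (coord F) - fr (emb (poly F (tline \<alpha> \<beta>))) = fr (tangent \<alpha> \<beta>) * fr (coord A)"
    by (simp add: fr_add fr_mult)
  have "pt.vge (int q + 1) (fr (tangent \<alpha> \<beta>))" by (simp add: pt.vge_def ord_tangent)
  moreover have "pt.vge 0 (fr (coord A))"
    unfolding pt.vge_regular_iff unfolding P_aff_eq using value_affine_fr[OF on_curve_rational] by blast
  ultimately have "pt.vge (int q + 1 + 0) (fr (coord F) - fr (emb (poly F (tline \<alpha> \<beta>))))"
    unfolding F by (rule pt.vge_mult)
  then have "pt.vge (int k) (fr (coord F) - fr (emb (poly F (tline \<alpha> \<beta>))))"
    using assms by (elim pt.vge_mono) simp
  from pt.vge_cong[OF this] show ?thesis unfolding vge_emb .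
qed

text \<open>A form of degree 1 with corner 1: the line avoids the point at infinity, so its pole
  there is that of y.\<close>

lemma ord_inf_tangent: "ord_at Pinf (fr (tangent \<alpha> \<beta>)) = - (int q + 1)"
proof -
  define G :: "'a poly poly" where "G = Yp - [:tline \<alpha> \<beta>:]"
  have td: "total_degree_le 1 G"
    unfolding G_def using total_degree_le_Yp_power[of 1]
    by (intro total_degree_le_diff total_degree_le_const) (auto simp: tline_def)
  have "has_value (fr (tangent \<alpha> \<beta>) / fr YY) Pinf 1"
  proof -
    have "coord G = tangent \<alpha> \<beta>" by (simp only: G_def coord_diff tangent_def YY_def emb_def)
    moreover have "corner 1 G = 1" by (simp add: G_def)
    ultimately show ?thesis using value_inf_form[OF td] by simp
  qed
  then have "inf.unit (fr (tangent \<alpha> \<beta>) / fr YY)" unfolding inf.unit_def by (intro exI[of _ 1]) simp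
  then have "ord_at Pinf (fr (tangent \<alpha> \<beta>) / fr YY) = 0" by (rule inf.ord_unit)
  moreover have "ord_at Pinf (fr (tangent \<alpha> \<beta>) / fr YY) =
      ord_at Pinf (fr (tangent \<alpha> \<beta>)) + ord_at Pinf (inverse (fr YY))"
    unfolding divide_inverse by (rule inf.ord_mult) (use tangent_nz YY_nz in auto)
  ultimately show ?thesis using inf.ord_inverse[of "fr YY"] YY_nz by (simp add: ord_inf_YY)
qed

end

lemma valued_point_general:
  assumes "on_curve a b"
  obtains t where "valued_point (aff a b) t"
  using ex_min_poly[of a] valued_point_affine[OF assms] by blast

lemma ord_aff_eq_0:
  assumes "on_curve a b" "evr a b g \<noteq> 0"
  shows "ord_at (aff a b) (fr g) = 0"
proof -
  obtain t where "valued_point (aff a b) t" using assms(1) by (rule valued_point_general)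
  then interpret pt: valued_point "aff a b" t .
  show ?thesis
    using value_affine_fr[OF assms(1), of g] assms(2) by (intro pt.ord_unit) (auto simp: pt.unit_def)
qed

end

section \<open>Riemann-Roch spaces of divisors on a triangle\<close>

text \<open>On the curve \<open>\<beta> = 0\<close> forces \<open>\<alpha> = 0\<close>, so the last
  assumption says that the third point differs from the origin.\<close>

locale standard_triangle = hermitian q ty for q and ty :: "'a::square_field itself" +
  fixes \<alpha> \<beta> :: 'a
  assumes curve: "\<alpha> ^ (q + 1) = \<beta> ^ q + \<beta>"
    and \<beta>_nz: "\<beta> \<noteq> 0"
begin

abbreviation P0 :: "'a geom_point" where "P0 \<equiv> P_aff 0 0"
abbreviation P1 :: "'a geom_point" where "P1 \<equiv> P_aff \<alpha> \<beta>"

lemma curve0: "(0 :: 'a) ^ (q + 1) = 0 ^ q + 0"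
  using q_ge_2 by simp

lemma P_distinct [simp]: "P0 \<noteq> P1" "P1 \<noteq> P0" "Pinf \<noteq> P0" "P0 \<noteq> Pinf" "Pinf \<noteq> P1" "P1 \<noteq> Pinf"
  using \<beta>_nz aff_neq_Pinf by (auto simp: P_aff_eq aff_eq_iff simp flip: to_ac_0)

abbreviation Df :: "int \<Rightarrow> int \<Rightarrow> int \<Rightarrow> 'a divisor" where
  "Df a b c \<equiv> Poly_Mapping.single Pinf a + Poly_Mapping.single P0 b + Poly_Mapping.single P1 c"

text \<open>The divisor of this function is \<open>q + 1\<close> times
  \<open>b P0 + c P1 - (b + c) Pinf\<close>, so multiplication by it moves multiples of
  \<open>q + 1\<close> from the affine points to infinity.\<close>

abbreviation den :: "nat \<Rightarrow> nat \<Rightarrow> 'a herm_field" where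
  "den b c \<equiv> fr YY ^ b * fr (tangent \<alpha> \<beta>) ^ c"

lemma den_nz: "den b c \<noteq> 0"
  using YY_nz tangent_nz[OF curve] by simp

lemma ord_den:
  assumes vp: "valued_point S t"
  shows "ord_at S (den b c) = int b * ord_at S (fr YY) + int c * ord_at S (fr (tangent \<alpha> \<beta>))"
proof -
  interpret S: valued_point S t by (rule vp)
  show ?thesis using YY_nz tangent_nz[OF curve] by (simp add: S.ord_mult S.ord_power)
qed

lemma rr_space_iff_vge:
  "f \<in> rr_space A \<longleftrightarrow> (\<forall>S\<in>herm_curve. vg S (- Poly_Mapping.lookup A S) f)"
proof -
  have "vg S n f \<longleftrightarrow> f = 0 \<or> n \<le> ord_at S f" if S: "S \<in> herm_curve" for S n
  proof -
    consider "S = Pinf" | a b where "S = aff a b" "on_curve a b"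
      using S unfolding herm_curve_eq by blast
    then have "\<exists>t. valued_point S t"
    proof cases
      case 1
      then show ?thesis using valued_point_infinity by blast
    next
      case 2
      then show ?thesis by (auto elim: valued_point_general)
    qed
    then obtain t where "valued_point S t" ..
    then show ?thesis by (rule valued_point.vge_def)
  qed
  moreover have "Pinf \<in> herm_curve" by (simp add: herm_curve_eq)
  ultimately show ?thesis unfolding rr_space_def by auto
qed

lemma vge_divide_den:
  assumes "valued_point S t"
  shows "vg S n (g / den b c) \<longleftrightarrow>
    vg S (n + int b * ord_at S (fr YY) + int c * ord_at S (fr (tangent \<alpha> \<beta>))) g"
proof -
  interpret S: valued_point S t by (rule assms)
  show ?thesis
    using S.vge_mult_iff[of "den b c" "n + ord_at S (den b c)" "g / den b c"] den_nz[of b c]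
    unfolding ord_den[OF assms] by (simp add: add.assoc)
qed

text \<open>After clearing \<open>den\<close> only the deficits \<open>j\<close> and
  \<open>k\<close> remain as vanishing orders at the affine points, and all poles are collected at
  infinity.\<close>

lemma rr_space_divide_den:
  "g / den b1 c1 \<in> rr_space (Df ((int q + 1) * int a1 - int i) ((int q + 1) * int b1 - int j)
      ((int q + 1) * int c1 - int k)) \<longleftrightarrow>
    vg Pinf (int i - int (a1 + b1 + c1) * (int q + 1)) g \<and> vg P0 (int j) g \<and> vg P1 (int k) g \<and>
    (\<forall>a b. on_curve a b \<longrightarrow> aff a b \<noteq> P0 \<longrightarrow> aff a b \<noteq> P1 \<longrightarrow> vg (aff a b) 0 g)"
proof -
  define D where "D = Df ((int q + 1) * int a1 - int i) ((int q + 1) * int b1 - int j)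
      ((int q + 1) * int c1 - int k)"
  have oc0: "on_curve (to_ac 0) (to_ac 0)" and oc1: "on_curve (to_ac \<alpha>) (to_ac \<beta>)"
    by (rule on_curve_rational[OF curve0], rule on_curve_rational[OF curve])
  have hc: "herm_curve = insert Pinf (insert P0 (insert P1 {aff a b |a b. on_curve a b \<and> aff a b \<noteq> P0 \<and> aff a b \<noteq> P1}))"
    using oc0 oc1 unfolding herm_curve_eq P_aff_eq by blast
  have lookup: "Poly_Mapping.lookup D Pinf = (int q + 1) * int a1 - int i"
    "Poly_Mapping.lookup D P0 = (int q + 1) * int b1 - int j"
    "Poly_Mapping.lookup D P1 = (int q + 1) * int c1 - int k"
    by (simp_all add: D_def lookup_add lookup_single)
  have lookup0: "Poly_Mapping.lookup D S = 0" if "S \<noteq> Pinf" "S \<noteq> P0" "S \<noteq> P1" for S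
    using that by (simp add: D_def lookup_add lookup_single)
  have "vg Pinf (- Poly_Mapping.lookup D Pinf) (g / den b1 c1) \<longleftrightarrow>
      vg Pinf (int i - int (a1 + b1 + c1) * (int q + 1)) g"
    unfolding vge_divide_den[OF valued_point_infinity] ord_inf_YY ord_inf_tangent[OF curve] lookup
    by (simp add: algebra_simps)
  moreover have "vg P0 (- Poly_Mapping.lookup D P0) (g / den b1 c1) \<longleftrightarrow> vg P0 (int j) g"
  proof -
    have "ord_at P0 (fr (tangent \<alpha> \<beta>)) = 0"
      unfolding P_aff_eq using evr_tangent_eq_0[OF curve oc0] \<beta>_nz
      by (intro ord_aff_eq_0[OF oc0]) auto
    then show ?thesis
      unfolding vge_divide_den[OF valued_point_rational[OF curve0]] lookup
      using ord_tangent[OF curve0] by (simp add: tangent_0 algebra_simps)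
  qed
  moreover have "vg P1 (- Poly_Mapping.lookup D P1) (g / den b1 c1) \<longleftrightarrow> vg P1 (int k) g"
  proof -
    have "ord_at P1 (fr YY) = 0"
      unfolding P_aff_eq using \<beta>_nz by (intro ord_aff_eq_0[OF oc1]) (simp add: evr_YY[OF oc1])
    then show ?thesis
      unfolding vge_divide_den[OF valued_point_rational[OF curve]] lookup
      using ord_tangent[OF curve] by (simp add: algebra_simps)
  qed
  moreover have "vg (aff a b) (- Poly_Mapping.lookup D (aff a b)) (g / den b1 c1) \<longleftrightarrow> vg (aff a b) 0 g"
    if oc: "on_curve a b" and ne: "aff a b \<noteq> P0" "aff a b \<noteq> P1" for a b
  proof -
    obtain t where t: "valued_point (aff a b) t" using oc by (rule valued_point_general)
    have "evr a b (tangent \<alpha> \<beta>) \<noteq> 0"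
      using evr_tangent_eq_0[OF curve oc] ne by (auto simp: P_aff_eq)
    moreover have "evr a b (tangent 0 0) \<noteq> 0"
      using evr_tangent_eq_0[OF curve0 oc] ne by (auto simp: P_aff_eq)
    ultimately show ?thesis
      unfolding vge_divide_den[OF t] using ne lookup0[of "aff a b"] ord_aff_eq_0[OF oc]
      by (simp add: tangent_0)
  qed
  ultimately show ?thesis
    unfolding rr_space_iff_vge hc D_def[symmetric] by blast
qed

definition orders :: "nat \<Rightarrow> 'a poly poly \<Rightarrow> nat \<Rightarrow> nat \<Rightarrow> nat \<Rightarrow> bool" where
  "orders m F i j k \<longleftrightarrow> [:0, 1:] ^ i dvd top_form m F \<and> [:0, 1:] ^ j dvd poly F 0 \<and>
     [:- \<alpha>, 1:] ^ k dvd poly F (tline \<alpha> \<beta>)"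

lemma rr_space_form_iff:
  assumes td: "total_degree_le (a1 + b1 + c1) F" and ijk: "i \<le> q + 1" "j \<le> q + 1" "k \<le> q + 1"
  shows "fr (coord F) / den b1 c1 \<in> rr_space (Df ((int q + 1) * int a1 - int i)
      ((int q + 1) * int b1 - int j) ((int q + 1) * int c1 - int k)) \<longleftrightarrow>
    orders (a1 + b1 + c1) F i j k"
proof -
  have "vg (aff a b) 0 (fr (coord F))" if oc: "on_curve a b" for a b
  proof -
    obtain t where "valued_point (aff a b) t" using oc by (rule valued_point_general)
    then interpret pt: valued_point "aff a b" t .
    show ?thesis unfolding pt.vge_regular_iff using value_affine_fr[OF oc] by blast
  qed
  moreover have "tline 0 0 = 0" using q_ge_2 by (simp add: tline_def)
  ultimately show ?thesis
    unfolding rr_space_divide_den orders_def vge_form_infinity[OF td ijk(1)] monom_eq_power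
      vge_form_tangent[OF curve ijk(3)] vge_form_tangent[OF curve0 ijk(2)] by simp
qed

text \<open>Clearing \<open>den\<close> gives a function regular on the affine curve, hence a
  polynomial; its pole at infinity bounds the degree by \<open>a1 + b1 + c1\<close>, and orders up
  to \<open>q + 1\<close> are then read off from the tangents.\<close>

lemma rr_space_iff:
  assumes ijk: "i \<le> q + 1" "j \<le> q + 1" "k \<le> q + 1"
  shows "f \<in> rr_space (Df ((int q + 1) * int a1 - int i)
      ((int q + 1) * int b1 - int j) ((int q + 1) * int c1 - int k)) \<longleftrightarrow>
    (\<exists>F. total_degree_le (a1 + b1 + c1) F \<and> f = fr (coord F) / den b1 c1 \<and>
      orders (a1 + b1 + c1) F i j k)" (is "?L \<longleftrightarrow> ?R")
proof
  assume L: ?L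
  define g where "g = f * den b1 c1"
  have f: "f = g / den b1 c1" using den_nz by (simp add: g_def)
  note g = L[unfolded f rr_space_divide_den]
  have "\<exists>z. has_value g (aff a b) z" if oc: "on_curve a b" for a b
  proof -
    obtain t where t: "valued_point (aff a b) t" using oc by (rule valued_point_general)
    then interpret pt: valued_point "aff a b" t .
    have "pt.vge 0 g"
    proof (cases "aff a b = P0 \<or> aff a b = P1")
      case True
      then show ?thesis using g pt.vge_mono[of "int j" g 0] pt.vge_mono[of "int k" g 0] by auto
    next
      case False
      then show ?thesis using g oc by blast
    qed
    then show ?thesis by (simp add: pt.vge_regular_iff)
  qed
  then obtain r where r: "g = fr r" by (rule regular_imp_fr)
  have "inf.vge (- (int (a1 + b1 + c1) * (int q + 1))) (fr r)"
    using g unfolding r by (auto elim: inf.vge_mono)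
  then obtain F where F: "total_degree_le (a1 + b1 + c1) F" "r = coord F"
    by (rule ex_form_of_degree)
  then show ?R using L rr_space_form_iff[OF F(1) ijk] f r by blast
next
  assume ?R
  then show ?L using rr_space_form_iff[OF _ ijk] by blast
qed

text \<open>The third restriction is translated so that each of the marked points becomes the point \<open>0\<close>.\<close>
definition sides :: "nat \<Rightarrow> 'a poly \<Rightarrow> 'a poly \<Rightarrow> 'a poly \<Rightarrow> bool" where
  "sides m f0 f1 f2 \<longleftrightarrow> (\<exists>F. total_degree_le m F \<and> f0 = top_form m F \<and> f1 = poly F 0 \<and>
     f2 = pcompose (poly F (tline \<alpha> \<beta>)) [:\<alpha>, 1:])"

lemma pcompose_power: "pcompose (p ^ n) r = pcompose p r ^ n"
  by (induction n) (simp_all add: pcompose_mult pcompose_1)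

lemma pcompose_shift_dvd: "[:- \<alpha>, 1:] ^ k dvd p \<longleftrightarrow> [:0, 1:] ^ k dvd pcompose p [:\<alpha>, 1:]"
proof
  assume "[:- \<alpha>, 1:] ^ k dvd p"
  then obtain r where "p = [:- \<alpha>, 1:] ^ k * r" ..
  then have "pcompose p [:\<alpha>, 1:] = [:0, 1:] ^ k * pcompose r [:\<alpha>, 1:]"
    by (simp add: pcompose_mult pcompose_power pcompose_pCons)
  then show "[:0, 1:] ^ k dvd pcompose p [:\<alpha>, 1:]" by simp
next
  assume "[:0, 1:] ^ k dvd pcompose p [:\<alpha>, 1:]"
  then obtain r where r: "pcompose p [:\<alpha>, 1:] = [:0, 1:] ^ k * r" ..
  have "p = pcompose (pcompose p [:\<alpha>, 1:]) [:- \<alpha>, 1:]"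
    by (simp add: pcompose_assoc[symmetric] pcompose_pCons)
  also have "\<dots> = [:- \<alpha>, 1:] ^ k * pcompose r [:- \<alpha>, 1:]"
    by (simp add: r pcompose_mult pcompose_power pcompose_pCons)
  finally show "[:- \<alpha>, 1:] ^ k dvd p" by (metis dvd_triv_left)
qed

context
  fixes a1 b1 c1 i j k m :: nat and D :: "'a divisor"
  assumes ijk: "i \<le> q + 1" "j \<le> q + 1" "k \<le> q + 1"
  defines "m \<equiv> a1 + b1 + c1"
    and "D \<equiv> Df ((int q + 1) * int a1 - int i) ((int q + 1) * int b1 - int j) ((int q + 1) * int c1 - int k)"
begin

text \<open>One space contains the other, so a basepoint means that the weaker vanishing conditions
  imply the stronger ones. The primed orders must also stay within \<open>q + 1\<close>, which is
  the source of the bounds by \<open>q\<close> in the three criteria below.\<close>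

lemma has_basepoint_aux:
  assumes D': "D - Poly_Mapping.single S 1 = Df ((int q + 1) * int a1 - int i')
      ((int q + 1) * int b1 - int j') ((int q + 1) * int c1 - int k')"
    and ijk': "i' \<le> q + 1" "j' \<le> q + 1" "k' \<le> q + 1" "i \<le> i'" "j \<le> j'" "k \<le> k'"
  shows "has_basepoint D S \<longleftrightarrow> (\<forall>F. total_degree_le m F \<longrightarrow> orders m F i j k \<longrightarrow> orders m F i' j' k')"
proof -
  have mono: "orders m F i j k" if "orders m F i' j' k'" for F
    using that ijk'(4-6) unfolding orders_def by (meson dvd_trans le_imp_power_dvd)
  have sub: "rr_space (D - Poly_Mapping.single S 1) \<subseteq> rr_space D"
  proof
    fix f assume "f \<in> rr_space (D - Poly_Mapping.single S 1)"
    then obtain F where "total_degree_le m F" "f = fr (coord F) / den b1 c1" "orders m F i' j' k'"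
      unfolding D' m_def using rr_space_iff[OF ijk'(1-3)] by blast
    then show "f \<in> rr_space D"
      using mono unfolding D_def m_def rr_space_iff[OF ijk] by blast
  qed
  show ?thesis
  proof
    assume bp: "has_basepoint D S"
    show "\<forall>F. total_degree_le m F \<longrightarrow> orders m F i j k \<longrightarrow> orders m F i' j' k'"
      using bp rr_space_form_iff[OF _ ijk, of a1 b1 c1] rr_space_form_iff[OF _ ijk'(1-3), of a1 b1 c1]
      unfolding has_basepoint_def D' unfolding D_def m_def by blast
  next
    assume "\<forall>F. total_degree_le m F \<longrightarrow> orders m F i j k \<longrightarrow> orders m F i' j' k'"
    then have "rr_space D \<subseteq> rr_space (D - Poly_Mapping.single S 1)"
      unfolding D' unfolding D_def m_def using rr_space_iff[OF ijk] rr_space_iff[OF ijk'(1-3)] by blast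
    with sub show "has_basepoint D S" unfolding has_basepoint_def by blast
  qed
qed

lemma sides_iff:
  "(\<forall>F. total_degree_le m F \<longrightarrow> orders m F i j k \<longrightarrow> orders m F i' j' k') \<longleftrightarrow>
   (\<forall>f0 f1 f2. sides m f0 f1 f2 \<longrightarrow> [:0, 1:] ^ i dvd f0 \<longrightarrow> [:0, 1:] ^ j dvd f1 \<longrightarrow> [:0, 1:] ^ k dvd f2 \<longrightarrow>
      [:0, 1:] ^ i' dvd f0 \<and> [:0, 1:] ^ j' dvd f1 \<and> [:0, 1:] ^ k' dvd f2)"
  unfolding orders_def sides_def pcompose_shift_dvd by blast

lemma has_basepoint_Pinf_iff:
  assumes "i \<le> q"
  shows "has_basepoint D Pinf \<longleftrightarrow> (\<forall>f0 f1 f2. sides m f0 f1 f2 \<longrightarrow> [:0, 1:] ^ i dvd f0 \<longrightarrow>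
    [:0, 1:] ^ j dvd f1 \<longrightarrow> [:0, 1:] ^ k dvd f2 \<longrightarrow> [:0, 1:] ^ Suc i dvd f0)"
proof -
  have "D - Poly_Mapping.single Pinf 1 = Df ((int q + 1) * int a1 - int (Suc i))
      ((int q + 1) * int b1 - int j) ((int q + 1) * int c1 - int k)"
    using single_diff[of Pinf "(int q + 1) * int a1 - int i" 1] by (simp add: D_def algebra_simps)
  then show ?thesis
    using assms ijk by (subst has_basepoint_aux[of _ "Suc i" j k]) (auto simp: sides_iff)
qed

lemma has_basepoint_P0_iff:
  assumes "j \<le> q"
  shows "has_basepoint D P0 \<longleftrightarrow> (\<forall>f0 f1 f2. sides m f0 f1 f2 \<longrightarrow> [:0, 1:] ^ i dvd f0 \<longrightarrow>
    [:0, 1:] ^ j dvd f1 \<longrightarrow> [:0, 1:] ^ k dvd f2 \<longrightarrow> [:0, 1:] ^ Suc j dvd f1)"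
proof -
  have "D - Poly_Mapping.single P0 1 = Df ((int q + 1) * int a1 - int i)
      ((int q + 1) * int b1 - int (Suc j)) ((int q + 1) * int c1 - int k)"
    using single_diff[of P0 "(int q + 1) * int b1 - int j" 1] by (simp add: D_def algebra_simps)
  then show ?thesis
    using assms ijk by (subst has_basepoint_aux[of _ i "Suc j" k]) (auto simp: sides_iff)
qed

lemma has_basepoint_P1_iff:
  assumes "k \<le> q"
  shows "has_basepoint D P1 \<longleftrightarrow> (\<forall>f0 f1 f2. sides m f0 f1 f2 \<longrightarrow> [:0, 1:] ^ i dvd f0 \<longrightarrow>
    [:0, 1:] ^ j dvd f1 \<longrightarrow> [:0, 1:] ^ k dvd f2 \<longrightarrow> [:0, 1:] ^ Suc k dvd f2)"
proof -
  have "D - Poly_Mapping.single P1 1 = Df ((int q + 1) * int a1 - int i)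
      ((int q + 1) * int b1 - int j) ((int q + 1) * int c1 - int (Suc k))"
    using single_diff[of P1 "(int q + 1) * int c1 - int k" 1] by (simp add: D_def algebra_simps)
  then show ?thesis
    using assms ijk by (subst has_basepoint_aux[of _ i j "Suc k"]) (auto simp: sides_iff)
qed

end

end

section \<open>Restriction to the three tangent lines\<close>

lemma X_power_dvd_iff:
  fixes f :: "'a::field poly"
  shows "[:0, 1:] ^ i dvd f \<longleftrightarrow> (\<exists>w. f = monom 1 i * w)"
  by (auto simp: monom_eq_power dvd_def)

lemma X_power_dvd_monom_mult: "[:0, 1:] ^ i dvd monom (1 :: 'a::field) i * w"
  by (simp add: monom_eq_power)

lemma degree_monom_mult_le_iff:
  fixes w :: "'a::field poly"
  assumes "i \<le> m"
  shows "degree (monom 1 i * w) \<le> m \<longleftrightarrow> degree w \<le> m - i"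
  using assms by (cases "w = 0") (auto simp: degree_mult_eq degree_monom_eq monom_eq_0_iff)

lemma X_dvd_iff_coeff_0: "[:0, 1:] dvd w \<longleftrightarrow> coeff w 0 = (0 :: 'a::field)"
  using poly_eq_0_iff_dvd[of w 0] by (simp add: poly_0_coeff_0)

lemma X_Suc_dvd_iff:
  fixes w :: "'a::field poly"
  shows "[:0, 1:] ^ Suc i dvd monom 1 i * w \<longleftrightarrow> coeff w 0 = 0"
proof -
  have "[:0, 1:] ^ Suc i dvd monom 1 i * w \<longleftrightarrow> monom 1 i * [:0, 1:] dvd monom 1 i * w"
    by (simp add: monom_eq_power mult.commute)
  also have "\<dots> \<longleftrightarrow> [:0, 1:] dvd w" by (rule dvd_mult_cancel_left[THEN trans]) (simp add: monom_eq_0_iff)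
  finally show ?thesis by (simp add: X_dvd_iff_coeff_0)
qed

lemma X_power_dvd_imp_0:
  fixes f :: "'a::field poly"
  assumes "[:0, 1:] ^ i dvd f" "degree f \<le> m" "m < i"
  shows "f = 0"
  using assms dvd_imp_degree_le[of "[:0, 1:] ^ i" f] by (fastforce simp: degree_power_eq)

text \<open>
  The possible values \<open>e\<close> at infinity and \<open>e'\<close> at a second point for polynomials of degree at most \<open>m\<close>
  vanishing to order \<open>i\<close> at \<open>0\<close>, the values being scaled such that \<open>x\<^sup>m\<close> has the values \<open>(1, 1)\<close>.
\<close>
definition side :: "nat \<Rightarrow> nat \<Rightarrow> 'a::field \<Rightarrow> 'a \<Rightarrow> bool" where
  "side m i e e' \<longleftrightarrow> i < m \<or> i = m \<and> e = e' \<or> i > m \<and> e = 0 \<and> e' = 0"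

text \<open>The data for order exactly \<open>i\<close>. If \<open>i + 1 = m\<close> a linear
  cofactor remains, and its constant term is proportional to \<open>e' - e\<close>; with two or more
  free degrees there is no constraint.\<close>

definition side_exact :: "nat \<Rightarrow> nat \<Rightarrow> 'a::field \<Rightarrow> 'a \<Rightarrow> bool" where
  "side_exact m i e e' \<longleftrightarrow> i + 2 \<le> m \<or> i + 1 = m \<and> e \<noteq> e' \<or> i = m \<and> e = e' \<and> e \<noteq> 0"

lemma side_exact_iff:
  fixes s :: "'a::field"
  assumes s: "s \<noteq> 0"
  shows "side_exact m i e e' \<longleftrightarrow> (\<exists>f. degree f \<le> m \<and> [:0, 1:] ^ i dvd f \<and> \<not> [:0, 1:] ^ Suc i dvd f \<and>
    coeff f m = e \<and> poly f s = s ^ m * e')" (is "_ \<longleftrightarrow> (\<exists>f. ?P f)")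
proof
  assume se: "side_exact m i e e'"
  have *: "\<exists>f. ?P f" if "i \<le> m" "degree w \<le> m - i" "coeff w 0 \<noteq> 0" "coeff w (m - i) = e"
    "poly w s = s ^ (m - i) * e'" for w
  proof -
    have "s ^ m = s ^ i * s ^ (m - i)" using that(1) by (simp flip: power_add)
    then have "?P (monom 1 i * w)"
      using that by (auto simp: degree_monom_mult_le_iff X_power_dvd_monom_mult X_Suc_dvd_iff coeff_monom_mult poly_monom simp del: power_Suc)
    then show ?thesis ..
  qed
  consider "i + 2 \<le> m" | "i + 1 = m" "e \<noteq> e'" | "i = m" "e = e'" "e \<noteq> 0"
    using se unfolding side_exact_def by blast
  then show "\<exists>f. ?P f"
  proof cases
    case 1
    define n where "n = m - i"
    have n: "n \<ge> 2" using 1 by (simp add: n_def)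
    \<comment> \<open>The cofactor is \<open>e x^n + A x + 1\<close>: the constant term keeps the
      order exact, the first term fixes the value at infinity, and \<open>A\<close> adjusts the
      value at \<open>s\<close>. This needs \<open>n \<ge> 2\<close>.\<close>
    define A where "A = (s ^ n * (e' - e) - 1) / s"
    have "degree (monom e n + [:1, A:]) \<le> n"
      using n by (intro degree_add_le degree_monom_le) auto
    moreover have "coeff (monom e n + [:1, A:]) 0 = 1" using n by simp
    moreover have "coeff (monom e n + [:1, A:]) n = e"
      using n by (auto simp: coeff_pCons split: nat.splits)
    moreover have "s * A = s ^ n * (e' - e) - 1" using s by (simp add: A_def)
    then have "poly (monom e n + [:1, A:]) s = s ^ n * e'"
      by (simp add: poly_monom) (simp add: algebra_simps)
    ultimately show ?thesis using 1 unfolding n_def by (intro *[of "monom e (m - i) + [:1, A:]"]) auto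
  next
    case 2
    then have "m - i = 1" by simp
    then show ?thesis using 2 s by (intro *[of "[:s * (e' - e), e:]"]) (auto simp: algebra_simps)
  next
    case 3
    then show ?thesis by (intro *[of "[:e:]"]) auto
  qed
next
  assume "\<exists>f. ?P f"
  then obtain f where f: "?P f" ..
  then have "f \<noteq> 0" by auto
  then have im: "i \<le> m" using f X_power_dvd_imp_0[of i f m] by force
  obtain w where w: "f = monom 1 i * w" using f by (auto simp: X_power_dvd_iff)
  have dw: "degree w \<le> m - i" and w0: "coeff w 0 \<noteq> 0" and we: "coeff w (m - i) = e"
    using f im unfolding w by (auto simp: degree_monom_mult_le_iff X_Suc_dvd_iff coeff_monom_mult simp del: power_Suc)
  have "s ^ m = s ^ i * s ^ (m - i)" using im by (simp flip: power_add)
  then have ws: "poly w s = s ^ (m - i) * e'" using f s unfolding w by (simp add: poly_monom)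
  consider "i + 2 \<le> m" | "m = i + 1" | "m = i" using im by linarith
  then show "side_exact m i e e'"
  proof cases
    case 2
    then have "degree w \<le> 1" using dw by simp
    then have "coeff w (Suc (Suc n)) = 0" for n by (intro coeff_eq_0) simp
    then have "w = [:coeff w 0, coeff w 1:]"
      by (intro poly_eqI) (simp add: coeff_pCons split: nat.splits)
    then obtain b c where bc: "w = [:b, c:]" by blast
    have c: "c = e" and b: "b + s * c = s * e'" "b \<noteq> 0" using we ws w0 2 by (simp_all add: bc)
    have "e \<noteq> e'"
    proof
      assume "e = e'"
      then have "b + s * c = 0 + s * c" using b(1) c by simp
      then show False using b(2) by (simp only: add_right_cancel)
    qed
    then show ?thesis using 2 by (simp add: side_exact_def)
  next
    case 3
    then obtain b where "w = [:b:]" using dw by (auto elim: degree_eq_zeroE)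
    then show ?thesis using 3 we ws w0 by (simp add: side_exact_def)
  qed (simp add: side_exact_def)
qed

text \<open>For \<open>i < m\<close> the exact order can be taken as \<open>m - 1\<close> if the two
  values differ and as \<open>m\<close> if they agree and are nonzero. The zero polynomial accounts
  for the remaining disjunct.\<close>

lemma side_iff_exact: "side m i e e' \<longleftrightarrow> (\<exists>i'\<ge>i. side_exact m i' e e') \<or> e = 0 \<and> e' = 0"
  unfolding side_def side_exact_def
  by (cases i m rule: linorder_cases; cases "e = e'"; cases "e = 0") (auto intro: exI[of _ "m - 1"] exI[of _ m])

lemma exact_power_dvd:
  fixes f :: "'a::field poly"
  assumes "f \<noteq> 0" "[:0, 1:] ^ i dvd f"
  obtains i' where "i \<le> i'" "[:0, 1:] ^ i' dvd f" "\<not> [:0, 1:] ^ Suc i' dvd f"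
proof -
  have bound: "i' \<le> degree f" if "[:0, 1:] ^ i' dvd f" for i'
    using dvd_imp_degree_le[OF that assms(1)] by (simp add: degree_power_eq)
  let ?P = "\<lambda>i'. [:0, 1:] ^ i' dvd f"
  define i' where "i' = Greatest ?P"
  have "[:0, 1:] ^ i' dvd f" unfolding i'_def by (rule GreatestI_nat[of ?P i "degree f"]) (use assms bound in auto)
  moreover have "i \<le> i'" unfolding i'_def by (rule Greatest_le_nat[of ?P i "degree f"]) (use assms bound in auto)
  moreover have "\<not> [:0, 1:] ^ Suc i' dvd f"
  proof
    assume "[:0, 1:] ^ Suc i' dvd f"
    then have "Suc i' \<le> i'" unfolding i'_def by (rule Greatest_le_nat[of ?P _ "degree f"]) (use bound in auto)
    then show False by simp
  qed
  ultimately show thesis using that by blast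
qed

lemma side_iff:
  fixes s :: "'a::field"
  assumes s: "s \<noteq> 0"
  shows "side m i e e' \<longleftrightarrow>
    (\<exists>f. degree f \<le> m \<and> [:0, 1:] ^ i dvd f \<and> coeff f m = e \<and> poly f s = s ^ m * e')" (is "_ \<longleftrightarrow> ?R")
proof
  assume "side m i e e'"
  then consider i' where "i \<le> i'" "side_exact m i' e e'" | "e = 0" "e' = 0"
    unfolding side_iff_exact by blast
  then show ?R
  proof cases
    case 1
    have "[:0, 1 :: 'a:] ^ i dvd [:0, 1:] ^ i'" using 1(1) by (rule le_imp_power_dvd)
    then show ?thesis using 1(2) unfolding side_exact_iff[OF s] by (blast intro: dvd_trans)
  next
    case 2
    then show ?thesis by (intro exI[of _ 0]) simp
  qed
next
  assume ?R
  then obtain f where f: "degree f \<le> m" "[:0, 1:] ^ i dvd f" "coeff f m = e" "poly f s = s ^ m * e'" by blast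
  show "side m i e e'"
  proof (cases "f = 0")
    case True
    then show ?thesis using f(3,4) s unfolding side_iff_exact by simp
  next
    case False
    then obtain i' where "i \<le> i'" "[:0, 1:] ^ i' dvd f" "\<not> [:0, 1:] ^ Suc i' dvd f"
      using f(2) by (rule exact_power_dvd)
    then have "side_exact m i' e e'" using f unfolding side_exact_iff[OF s] by blast
    then show ?thesis using \<open>i \<le> i'\<close> unfolding side_iff_exact by blast
  qed
qed

text \<open>
  The corresponding data for concurrent tangents, which meet at infinity: \<open>c\<close> and \<open>e\<close> are the
  two leading coefficients.
\<close>
definition cside :: "nat \<Rightarrow> nat \<Rightarrow> 'a::field \<Rightarrow> 'a \<Rightarrow> bool" where
  "cside m i c e \<longleftrightarrow> i < m \<or> i = m \<and> e = 0 \<or> i > m \<and> c = 0 \<and> e = 0"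

text \<open>For \<open>i + 1 = m\<close> the polynomial is \<open>x^(m-1) (e + c x)\<close>, so the
  second coefficient decides whether the order is exact.\<close>

definition cside_exact :: "nat \<Rightarrow> nat \<Rightarrow> 'a::field \<Rightarrow> 'a \<Rightarrow> bool" where
  "cside_exact m i c e \<longleftrightarrow> i + 2 \<le> m \<or> i + 1 = m \<and> e \<noteq> 0 \<or> i = m \<and> e = 0 \<and> c \<noteq> 0"

lemma cside_exact_iff:
  fixes c e :: "'a::field"
  assumes m: "m \<ge> 1"
  shows "cside_exact m i c e \<longleftrightarrow> (\<exists>f. degree f \<le> m \<and> [:0, 1:] ^ i dvd f \<and> \<not> [:0, 1:] ^ Suc i dvd f \<and>
    coeff f m = c \<and> coeff f (m - 1) = e)" (is "_ \<longleftrightarrow> (\<exists>f. ?P f)")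
proof
  assume ce: "cside_exact m i c e"
  have *: "\<exists>f. ?P f" if "i \<le> m" "degree w \<le> m - i" "coeff w 0 \<noteq> 0" "coeff w (m - i) = c"
    "(if i \<le> m - 1 then coeff w (m - 1 - i) else 0) = e" for w
  proof -
    have "?P (monom 1 i * w)"
      using that by (auto simp: degree_monom_mult_le_iff X_power_dvd_monom_mult X_Suc_dvd_iff coeff_monom_mult simp del: power_Suc)
    then show ?thesis ..
  qed
  from ce consider "i + 2 \<le> m" | "i + 1 = m" "e \<noteq> 0" | "i = m" "e = 0" "c \<noteq> 0"
    unfolding cside_exact_def by blast
  then show "\<exists>f. ?P f"
  proof cases
    case 1
    let ?w = "monom c (m - i) + monom e (m - 1 - i) + 1"
    have "degree ?w \<le> m - i"
      using 1 by (intro degree_add_le degree_monom_le order.trans[OF degree_monom_le]) auto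
    moreover have "coeff ?w 0 = 1" using 1 by simp
    moreover have "coeff ?w (m - i) = c" "coeff ?w (m - 1 - i) = e" using 1 by (auto simp: Polynomial.coeff_1)
    ultimately show ?thesis using 1 by (intro *[of ?w]) auto
  next
    case 2
    then show ?thesis by (intro *[of "[:e, c:]"]) auto
  next
    case 3
    then show ?thesis using m by (intro *[of "[:c:]"]) auto
  qed
next
  assume "\<exists>f. ?P f"
  then obtain f where f: "?P f" ..
  then have "f \<noteq> 0" by auto
  then have im: "i \<le> m" using f X_power_dvd_imp_0[of i f m] by force
  obtain w where w: "f = monom 1 i * w" using f by (auto simp: X_power_dvd_iff)
  have w0: "coeff w 0 \<noteq> 0" using f unfolding w by (simp add: X_Suc_dvd_iff del: power_Suc)
  consider "i + 2 \<le> m" | "m = i + 1" | "m = i" using im by linarith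
  then show "cside_exact m i c e"
    using f w0 m unfolding w by cases (auto simp: cside_exact_def coeff_monom_mult)
qed

lemma cside_iff_exact:
  assumes "m \<ge> 1"
  shows "cside m i c e \<longleftrightarrow> (\<exists>i'\<ge>i. cside_exact m i' c e) \<or> c = 0 \<and> e = 0"
  using assms unfolding cside_def cside_exact_def
  by (cases i m rule: linorder_cases; cases "c = 0"; cases "e = 0") (auto intro: exI[of _ "m - 1"] exI[of _ m])

lemma cside_iff:
  fixes c e :: "'a::field"
  assumes m: "m \<ge> 1"
  shows "cside m i c e \<longleftrightarrow>
    (\<exists>f. degree f \<le> m \<and> [:0, 1:] ^ i dvd f \<and> coeff f m = c \<and> coeff f (m - 1) = e)" (is "_ \<longleftrightarrow> ?R")
proof
  assume "cside m i c e"
  then consider i' where "i \<le> i'" "cside_exact m i' c e" | "c = 0" "e = 0"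
    unfolding cside_iff_exact[OF m] by blast
  then show ?R
  proof cases
    case 1
    have "[:0, 1 :: 'a:] ^ i dvd [:0, 1:] ^ i'" using 1(1) by (rule le_imp_power_dvd)
    then show ?thesis using 1(2) unfolding cside_exact_iff[OF m] by (blast intro: dvd_trans)
  next
    case 2
    then show ?thesis by (intro exI[of _ 0]) simp
  qed
next
  assume ?R
  then obtain f where f: "degree f \<le> m" "[:0, 1:] ^ i dvd f" "coeff f m = c" "coeff f (m - 1) = e" by blast
  show "cside m i c e"
  proof (cases "f = 0")
    case True
    then show ?thesis using f(3,4) unfolding cside_iff_exact[OF m] by simp
  next
    case False
    then obtain i' where "i \<le> i'" "[:0, 1:] ^ i' dvd f" "\<not> [:0, 1:] ^ Suc i' dvd f"
      using f(2) by (rule exact_power_dvd)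
    then have "cside_exact m i' c e" using f unfolding cside_exact_iff[OF m] by blast
    then show ?thesis using \<open>i \<le> i'\<close> unfolding cside_iff_exact[OF m] by blast
  qed
qed

section \<open>The basepoint criterion\<close>

text \<open>
  The parameter \<open>dm\<close> stands for the condition that the type of the triangle divides \<open>m\<close>.
\<close>
definition crit :: "nat \<Rightarrow> bool \<Rightarrow> nat \<Rightarrow> nat \<Rightarrow> nat \<Rightarrow> bool" where
  "crit m dm i j k \<longleftrightarrow> i > m \<or>
     i = m \<and> (j > m \<or> k > m \<or> j = m \<and> k = m \<and> \<not> dm) \<or>
     i + 1 = m \<and> (j > m \<and> k \<ge> m \<or> j \<ge> m \<and> k > m \<or> j = m \<and> k = m \<and> dm)"

lemma crit_commute: "crit m dm i j k \<longleftrightarrow> crit m dm i k j"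
  unfolding crit_def by auto

text \<open>Splits the complement into the cases in which \<open>glue_triangle\<close> can name one
  explicit witness each.\<close>

lemma not_crit_cases:
  "\<not> crit m dm i j k \<longleftrightarrow> i + 2 \<le> m \<or> i + 1 = m \<and> j < m \<and> k \<le> m \<or> i + 1 = m \<and> j < m \<and> k > m \<or>
     i + 1 = m \<and> j \<ge> m \<and> k < m \<or> i + 1 = m \<and> j = m \<and> k = m \<and> \<not> dm \<or>
     i = m \<and> j < m \<and> k \<le> m \<or> i = m \<and> j = m \<and> k < m \<or> i = m \<and> j = m \<and> k = m \<and> dm"
proof -
  consider "i + 2 \<le> m" | "i + 1 = m" | "i = m" | "m < i" by linarith
  then show ?thesis
    by cases (cases j m rule: linorder_cases; cases k m rule: linorder_cases; simp add: crit_def)+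
qed

lemma side_scale: "s \<noteq> 0 \<Longrightarrow> side m i e e' \<Longrightarrow> side m i (s * e') (s * e)"
  unfolding side_def by auto

text \<open>\<open>x\<close>, \<open>y\<close>, \<open>z\<close> are the scaled values at the three
  corners, and \<open>\<mu>\<close> is the product of the ratios around the triangle. It matters
  only if the other two sides have order exactly \<open>m\<close>: they force
  \<open>x = \<mu> * y\<close>, while the first side asks for \<open>x = y \<noteq> 0\<close> if
  \<open>i = m\<close> and for \<open>x \<noteq> y\<close> if \<open>i + 1 = m\<close>.\<close>

lemma glue_triangle:
  fixes \<mu> :: "'a::field"
  assumes "\<mu> \<noteq> 0"
  shows "(\<exists>x y z. side_exact m i x y \<and> side m j x (\<mu> * z) \<and> side m k y z) \<longleftrightarrow> \<not> crit m (\<mu> = 1) i j k"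
    (is "(\<exists>x y z. ?P x y z) \<longleftrightarrow> _")
proof
  assume "\<not> crit m (\<mu> = 1) i j k"
  then consider "i + 2 \<le> m" | "i + 1 = m" "j < m" "k \<le> m" | "i + 1 = m" "j < m" "k > m"
    | "i + 1 = m" "j \<ge> m" "k < m" | "i + 1 = m" "j = m" "k = m" "\<mu> \<noteq> 1"
    | "i = m" "j < m" "k \<le> m" | "i = m" "j = m" "k < m" | "i = m" "j = m" "k = m" "\<mu> = 1"
    unfolding not_crit_cases by blast
  then show "\<exists>x y z. ?P x y z"
  proof cases
    case 1
    then have "?P 0 0 0" by (auto simp: side_exact_def side_def)
    then show ?thesis by blast
  next
    case 2
    then have "?P 0 1 1" by (auto simp: side_exact_def side_def)
    then show ?thesis by blast
  next
    case 3
    then have "?P 1 0 0" by (auto simp: side_exact_def side_def)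
    then show ?thesis by blast
  next
    case 4
    then have "?P 0 1 0" by (auto simp: side_exact_def side_def)
    then show ?thesis by blast
  next
    case 5
    then have "?P \<mu> 1 1" by (auto simp: side_exact_def side_def)
    then show ?thesis by blast
  next
    case 6
    then have "?P 1 1 1" by (auto simp: side_exact_def side_def)
    then show ?thesis by blast
  next
    case 7
    then have "?P 1 1 (inverse \<mu>)" using assms by (auto simp: side_exact_def side_def)
    then show ?thesis by blast
  next
    case 8
    then have "?P 1 1 1" by (auto simp: side_exact_def side_def)
    then show ?thesis by blast
  qed
next
  assume "\<exists>x y z. ?P x y z"
  then obtain x y z where P: "?P x y z" by blast
  show "\<not> crit m (\<mu> = 1) i j k"
    using P assms unfolding side_exact_def side_def crit_def by auto
qed

text \<open>Relabelling the corners so that the second side comes first reverses the direction of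
  travel, so \<open>\<mu>\<close> turns into its inverse; the condition \<open>\<mu> = 1\<close> is
  unaffected.\<close>

lemma glue_triangle1:
  fixes \<mu> :: "'a::field"
  assumes "\<mu> \<noteq> 0"
  shows "(\<exists>x y z. side m i x y \<and> side_exact m j x (\<mu> * z) \<and> side m k y z) \<longleftrightarrow> \<not> crit m (\<mu> = 1) j i k"
    (is "?L \<longleftrightarrow> _")
proof -
  let ?R = "\<exists>x y z. side_exact m j x y \<and> side m i x (inverse \<mu> * z) \<and> side m k y z"
  have "?L \<longleftrightarrow> ?R"
  proof
    assume ?L
    then obtain x y z where "side m i x y" "side_exact m j x (\<mu> * z)" "side m k y z" by blast
    then show ?R using side_scale[OF assms, of m k y z] assms
      by - (rule exI[of _ x], rule exI[of _ "\<mu> * z"], rule exI[of _ "\<mu> * y"], simp add: mult.assoc[symmetric])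
  next
    assume ?R
    then obtain x y z where "side_exact m j x y" "side m i x (inverse \<mu> * z)" "side m k y z" by blast
    then show ?L using side_scale[of "inverse \<mu>" m k y z] assms
      by - (rule exI[of _ x], rule exI[of _ "inverse \<mu> * z"], rule exI[of _ "inverse \<mu> * y"], simp add: mult.assoc[symmetric])
  qed
  also have "?R \<longleftrightarrow> \<not> crit m (inverse \<mu> = 1) j i k"
    using assms by (intro glue_triangle) simp
  finally show ?thesis by simp
qed

text \<open>Starting at the third side keeps the direction of travel and hence
  \<open>\<mu>\<close>.\<close>

lemma glue_triangle2:
  fixes \<mu> :: "'a::field"
  assumes "\<mu> \<noteq> 0"
  shows "(\<exists>x y z. side m i x y \<and> side m j x (\<mu> * z) \<and> side_exact m k y z) \<longleftrightarrow> \<not> crit m (\<mu> = 1) k i j"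
    (is "?L \<longleftrightarrow> _")
proof -
  let ?R = "\<exists>x y z. side_exact m k x y \<and> side m i x (\<mu> * z) \<and> side m j y z"
  have "?L \<longleftrightarrow> ?R"
  proof
    assume ?L
    then obtain x y z where "side m i x y" "side m j x (\<mu> * z)" "side_exact m k y z" by blast
    then show ?R using side_scale[of 1 m i x y] side_scale[of "inverse \<mu>" m j x "\<mu> * z"] assms
      by - (rule exI[of _ y], rule exI[of _ z], rule exI[of _ "inverse \<mu> * x"], simp add: mult.assoc[symmetric])
  next
    assume ?R
    then obtain x y z where "side_exact m k x y" "side m i x (\<mu> * z)" "side m j y z" by blast
    then show ?L using side_scale[of 1 m i x "\<mu> * z"] side_scale[of \<mu> m j y z] assms
      by - (rule exI[of _ "\<mu> * z"], rule exI[of _ x], rule exI[of _ y], simp add: mult.assoc[symmetric])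
  qed
  also have "?R \<longleftrightarrow> \<not> crit m (\<mu> = 1) k i j"
    using assms by (rule glue_triangle)
  finally show ?thesis .
qed

text \<open>The three sides share the value \<open>c\<close> at their common point, and their
  derivatives there satisfy one linear relation. There is no circuit, hence no ratio to
  compare.\<close>

lemma glue_concurrent:
  fixes A B C :: "'a::field"
  assumes "A \<noteq> 0" "B \<noteq> 0" "C \<noteq> 0"
  shows "(\<exists>c x y z. cside_exact m i c x \<and> cside m j c y \<and> cside m k c z \<and> A * x + B * y + C * z = 0)
    \<longleftrightarrow> \<not> crit m True i j k" (is "(\<exists>c x y z. ?P c x y z) \<longleftrightarrow> _")
proof
  assume "\<not> crit m True i j k"
  then consider "i + 2 \<le> m" | "i + 1 = m" "j < m" | "i + 1 = m" "k < m" | "i = m" "j \<le> m" "k \<le> m"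
    unfolding not_crit_cases by fastforce
  then show "\<exists>c x y z. ?P c x y z"
  proof cases
    case 1
    then have "?P 0 0 0 0" by (auto simp: cside_exact_def cside_def)
    then show ?thesis by blast
  next
    case 2
    then have "?P 0 1 (- A / B) 0" using assms by (auto simp: cside_exact_def cside_def)
    then show ?thesis by blast
  next
    case 3
    then have "?P 0 1 0 (- A / C)" using assms by (auto simp: cside_exact_def cside_def)
    then show ?thesis by blast
  next
    case 4
    then have "?P 1 0 0 0" by (auto simp: cside_exact_def cside_def)
    then show ?thesis by blast
  qed
next
  assume "\<exists>c x y z. ?P c x y z"
  then obtain c x y z where P: "?P c x y z" by blast
  show "\<not> crit m True i j k"
    using P assms unfolding cside_exact_def cside_def crit_def by auto
qed

lemma mult_order_dvd_iff:
  fixes x :: "'a::field"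
  assumes "n > 0" "x ^ n = 1"
  shows "x ^ m = 1 \<longleftrightarrow> mult_order x dvd m"
proof -
  define d where "d = mult_order x"
  have d: "d > 0" "x ^ d = 1"
    using LeastI[of "\<lambda>n. 0 < n \<and> x ^ n = 1" n] assms by (auto simp: d_def mult_order_def)
  have "x ^ m = (x ^ d) ^ (m div d) * x ^ (m mod d)"
    by (simp flip: power_mult power_add)
  then have m: "x ^ m = x ^ (m mod d)" by (simp add: d)
  show ?thesis
  proof
    assume "x ^ m = 1"
    then have "x ^ (m mod d) = 1" using m by simp
    moreover have "m mod d < d" using d by simp
    ultimately have "m mod d = 0"
      using not_less_Least[of "m mod d" "\<lambda>n. 0 < n \<and> x ^ n = 1"] by (auto simp: d_def mult_order_def)
    then show "mult_order x dvd m" by (auto simp: d_def)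
  next
    assume "mult_order x dvd m"
    then show "x ^ m = 1" using d by (auto simp: d_def power_mult)
  qed
qed

lemma coeff_mult_top:
  fixes p r :: "'a::comm_semiring_1 poly"
  assumes "degree p \<le> n" "degree r \<le> k"
  shows "coeff (p * r) (n + k) = coeff p n * coeff r k"
proof -
  have "coeff (p * r) (n + k) = (\<Sum>i\<le>n + k. if i = n then coeff p n * coeff r k else 0)"
    unfolding coeff_mult
  proof (intro sum.cong refl)
    fix i assume "i \<in> {..n + k}"
    then show "coeff p i * coeff r (n + k - i) = (if i = n then coeff p n * coeff r k else 0)"
      using assms by (cases i n rule: linorder_cases) (auto simp: coeff_eq_0)
  qed
  then show ?thesis by simp
qed

context standard_triangle
begin

lemma degree_poly_line:
  fixes F :: "'a poly poly"
  assumes td: "total_degree_le m F" and L: "degree L \<le> 1"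
  shows "degree (poly F L) \<le> m"
proof -
  have F: "poly F L = (\<Sum>j\<le>m. coeff F j * L ^ j)"
    by (rule poly_sum_atMost[OF total_degree_le_degree[OF td]])
  have "degree (coeff F j * L ^ j) \<le> m" if "j \<le> m" for j
  proof -
    have "degree (coeff F j * L ^ j) \<le> degree (coeff F j) + degree (L ^ j)" by (rule degree_mult_le)
    also have "degree (L ^ j) \<le> j"
      using degree_power_le[of L j] mult_le_mono1[OF L, of j] by linarith
    also have "degree (coeff F j) \<le> m - j" by (rule total_degree_le_degree_coeff[OF td])
    finally show ?thesis using that by simp
  qed
  then show ?thesis unfolding F by (intro degree_sum_le) auto
qed

text \<open>This is the value at the point where the line meets infinity, so it depends only on the
  top form and the slope.\<close>

lemma coeff_poly_line:
  fixes a b :: 'a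
  assumes td: "total_degree_le m F"
  shows "coeff (poly F [:b, a:]) m = (\<Sum>j\<le>m. coeff (coeff F j) (m - j) * a ^ j)"
proof -
  have F: "poly F [:b, a:] = (\<Sum>j\<le>m. coeff F j * [:b, a:] ^ j)"
    by (rule poly_sum_atMost[OF total_degree_le_degree[OF td]])
  have "coeff (coeff F j * [:b, a:] ^ j) m = coeff (coeff F j) (m - j) * a ^ j" if "j \<le> m" for j
  proof -
    have "degree ([:b, a:] ^ j) \<le> j"
      using degree_power_le[of "[:b, a:]" j] by (cases "a = 0") auto
    moreover have "coeff ([:b, a:] ^ j) j = a ^ j"
    proof (induction j)
      case (Suc j)
      have "degree ([:b, a:] ^ j) \<le> j" using degree_power_le[of "[:b, a:]" j] by (cases "a = 0") auto
      then have "coeff ([:b, a:] ^ j) (Suc j) = 0" by (simp add: coeff_eq_0)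
      then show ?case using Suc by simp
    qed simp
    ultimately show ?thesis
      using coeff_mult_top[of "coeff F j" "m - j" "[:b, a:] ^ j" j] that
        total_degree_le_degree_coeff[OF td, of j] by simp
  qed
  then show ?thesis unfolding F coeff_sum by (intro sum.cong) auto
qed

text \<open>
  The first two restrictions determine the form up to multiples of the product of their tangent
  lines; \<open>g\<close> is the cofactor needed to adjust the third one.
\<close>
lemma sidesI:
  assumes m: "m \<ge> 2" and deg: "degree f0 \<le> m" "degree f1 \<le> m" "coeff f0 m = coeff f1 m"
    and g: "degree g \<le> m - 2"
    and f2: "pcompose f2 [:- \<alpha>, 1:] = f1 + tline \<alpha> \<beta> * (poly (hpoly (m - 1) f0) (tline \<alpha> \<beta>) + g)"
  shows "sides m f0 f1 f2"
proof -
  define G where "G = hpoly (m - 1) f0 + [:g:]"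
  \<comment> \<open>The form is \<open>f1 + y * G\<close>. Multiplied by y,
    \<open>hpoly (m - 1) f0\<close> supplies every term of the prescribed top form except
    \<open>x^m\<close>, which comes from \<open>f1\<close>; the summand \<open>g\<close> stays below
    the top degree.\<close>
  define F where "F = pCons f1 G"
  have "total_degree_le (m - 1) G"
    unfolding G_def using g m by (intro total_degree_le_add total_degree_le_hpoly total_degree_le_const) auto
  then have G: "i + j \<le> m - 1" if "coeff (coeff G j) i \<noteq> 0" for i j
    using that by (auto simp: total_degree_le_def)
  have "total_degree_le m F"
    unfolding total_degree_le_def F_def using deg(2) G m
    by (fastforce simp: coeff_pCons split: nat.splits dest: le_degree)
  moreover have "f0 = top_form m F"
  proof (rule poly_eqI)
    fix i
    consider "i > m" | "i = m" | j where "m = i + Suc j" by (metis less_iff_Suc_add linorder_neqE_nat add_Suc_right)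
    then show "coeff f0 i = coeff (top_form m F) i"
    proof cases
      case 1
      then show ?thesis using deg(1) by (simp add: coeff_top coeff_eq_0)
    next
      case 2
      then show ?thesis using deg(3) by (simp add: coeff_top F_def)
    next
      case 3
      have "coeff (coeff [:g:] j) i = 0"
        using g 3 m by (auto simp: coeff_pCons coeff_eq_0 split: nat.splits)
      then show ?thesis using 3 by (simp add: coeff_top F_def G_def coeff_hpoly del: coeff_pCons_Suc) (simp add: coeff_hpoly)
    qed
  qed
  moreover have "f1 = poly F 0" by (simp add: F_def)
  moreover have "f2 = pcompose (poly F (tline \<alpha> \<beta>)) [:\<alpha>, 1:]"
  proof -
    have "poly F (tline \<alpha> \<beta>) = pcompose f2 [:- \<alpha>, 1:]" by (simp add: F_def G_def f2)
    then have "pcompose (poly F (tline \<alpha> \<beta>)) [:\<alpha>, 1:] = pcompose f2 (pcompose [:- \<alpha>, 1:] [:\<alpha>, 1:])"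
      by (simp add: pcompose_assoc)
    then show ?thesis by (simp add: pcompose_pCons)
  qed
  ultimately show ?thesis unfolding sides_def by blast
qed

lemma degree_tline: "degree (tline \<alpha> \<beta>) \<le> 1"
  by (simp add: tline_def)

lemma sides_degree:
  assumes "sides m f0 f1 f2"
  shows "degree f0 \<le> m" "degree f1 \<le> m" "degree f2 \<le> m" "coeff f0 m = coeff f1 m"
proof -
  obtain F where F: "total_degree_le m F" "f0 = top_form m F" "f1 = poly F 0"
    "f2 = pcompose (poly F (tline \<alpha> \<beta>)) [:\<alpha>, 1:]"
    using assms unfolding sides_def by blast
  show "degree f0 \<le> m" "degree f1 \<le> m" using F degree_top degree_poly_line[OF F(1), of 0] by auto
  show "degree f2 \<le> m" using degree_poly_line[OF F(1) degree_tline] F(4) by (simp add: degree_pcompose)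
  show "coeff f0 m = coeff f1 m" by (simp add: F coeff_top poly_0_coeff_0)
qed

lemma coeff_pcompose_shift:
  assumes "degree p \<le> m"
  shows "coeff (pcompose p [:c, 1 :: 'a:]) m = coeff p m"
proof (cases "degree p = m")
  case True
  then show ?thesis using lead_coeff_comp[of "[:c, 1:]" p] by (simp add: degree_pcompose)
next
  case False
  then show ?thesis using assms by (simp add: coeff_eq_0 degree_pcompose)
qed

end

lemma degree_le_if_coeff_0:
  assumes "degree p \<le> Suc n" "coeff p (Suc n) = 0"
  shows "degree p \<le> n"
  using assms by (metis le_SucE leading_coeff_0_iff degree_0 zero_le)

context standard_triangle
begin

lemma triangle_1_minus_nz:
  assumes "\<alpha> = \<beta>"
  shows "1 - \<alpha> \<noteq> 0"
proof
  assume "1 - \<alpha> = 0"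
  then have "\<alpha> = 1" by simp
  then have "(1 :: 'a) ^ (q + 1) = 1 ^ q + 1" using curve assms by simp
  then have "1 + 0 = 1 + (1 :: 'a)" by (simp only: power_one add_0_right)
  then show False by (simp only: add_left_cancel) simp
qed

text \<open>For \<open>\<alpha> = \<beta>\<close> the curve equation says that the norm of
  \<open>\<alpha>\<close> equals its trace, so the norm of \<open>1 - \<alpha>\<close> is 1. This is
  why the type divides \<open>q + 1\<close>.\<close>

lemma one_minus_power:
  assumes "\<alpha> = 0 \<or> \<alpha> = \<beta>"
  shows "(1 - \<alpha>) ^ (q + 1) = 1"
  using assms
proof
  assume "\<alpha> = \<beta>"
  have "(1 - \<alpha>) ^ (q + 1) = (1 - \<alpha> ^ q) * (1 - \<alpha>)"
    using frob_q(2)[of 1 \<alpha>] by simp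
  also have "\<dots> = 1 - \<alpha> - \<alpha> ^ q + \<alpha> ^ (q + 1)" by (simp add: algebra_simps)
  also have "\<dots> = 1" using curve \<open>\<alpha> = \<beta>\<close> by simp
  finally show ?thesis .
qed simp

text \<open>The tangents are \<open>Z = 0\<close>, \<open>y = 0\<close> and
  \<open>y = \<alpha>^q (x - 1)\<close>, with corners \<open>(1 : 0 : 0)\<close>,
  \<open>(1 : \<alpha>^q : 0)\<close> and \<open>(1 : 0 : 1)\<close>; the three equations express
  agreement there. The coordinate on the third line is centred at \<open>x = \<alpha>\<close>, so
  the last corner sits at \<open>1 - \<alpha>\<close>.\<close>

lemma sides_triangle_iff:
  assumes eq: "\<alpha> = \<beta>" and m: "m \<ge> 2"
  shows "sides m f0 f1 f2 \<longleftrightarrow> degree f0 \<le> m \<and> degree f1 \<le> m \<and> degree f2 \<le> m \<and>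
    coeff f0 m = coeff f1 m \<and> coeff f2 m = (\<alpha> ^ q) ^ m * poly f0 (inverse (\<alpha> ^ q)) \<and>
    poly f1 1 = poly f2 (1 - \<alpha>)" (is "_ \<longleftrightarrow> ?R")
proof -
  define a where "a = \<alpha> ^ q"
  have a: "a \<noteq> 0" using \<beta>_nz eq by (simp add: a_def)
  have L: "tline \<alpha> \<beta> = [:- a, a:]" by (simp add: tline_def a_def eq)
  have f0_sum: "a ^ m * poly f (inverse a) = (\<Sum>j\<le>m. coeff f (m - j) * a ^ j)" if "degree f \<le> m" for f
  proof -
    have "a ^ m * poly f (inverse a) = (\<Sum>i\<le>m. coeff f i * a ^ (m - i))"
      unfolding poly_sum_atMost[OF that] sum_distrib_left
    proof (intro sum.cong refl)
      fix i assume "i \<in> {..m}"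
      then have "a ^ m = a ^ (m - i) * a ^ i" by (simp flip: power_add)
      then show "a ^ m * (coeff f i * inverse a ^ i) = coeff f i * a ^ (m - i)"
        using a by (simp add: power_inverse[symmetric] field_simps)
    qed
    also have "\<dots> = (\<Sum>j\<le>m. coeff f (m - j) * a ^ j)"
      by (rule sum.reindex_bij_witness[of _ "\<lambda>j. m - j" "\<lambda>j. m - j"]) auto
    finally show ?thesis .
  qed
  show ?thesis
  proof
    assume s: "sides m f0 f1 f2"
    note deg = sides_degree[OF s]
    obtain F where F: "total_degree_le m F" "f0 = top_form m F" "f1 = poly F 0"
      "f2 = pcompose (poly F (tline \<alpha> \<beta>)) [:\<alpha>, 1:]"
      using s unfolding sides_def by blast
    have "coeff f2 m = coeff (poly F [:- a, a:]) m"
      unfolding F(4) L[symmetric] by (rule coeff_pcompose_shift[OF degree_poly_line[OF F(1) degree_tline]])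
    also have "\<dots> = (\<Sum>j\<le>m. coeff f0 (m - j) * a ^ j)"
      unfolding coeff_poly_line[OF F(1)] F(2) by (intro sum.cong refl) (simp add: coeff_top)
    finally have "coeff f2 m = a ^ m * poly f0 (inverse a)" using f0_sum[OF deg(1)] by simp
    moreover have "poly f1 1 = poly f2 (1 - \<alpha>)"
      by (cases F) (simp add: F(3,4) L poly_pcompose)
    ultimately show ?R using deg by (simp add: a_def)
  next
    assume R: ?R
    define Hu where "Hu = poly (hpoly (m - 1) f0) (tline \<alpha> \<beta>)"
    define h2 where "h2 = pcompose f2 [:- \<alpha>, 1:]"
    \<comment> \<open>\<open>N\<close> is what the third restriction still lacks. It vanishes at
      both corners of that line: at infinity, which lowers its degree, and at \<open>x = 1\<close>,
      which lets the tangent divide it with a quotient of degree at most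
      \<open>m - 2\<close>.\<close>
    define N where "N = h2 - f1 - tline \<alpha> \<beta> * Hu"
    have dHu: "degree Hu \<le> m - 1"
      unfolding Hu_def by (rule degree_poly_line[OF total_degree_le_hpoly degree_tline])
    have cHu: "a * coeff Hu (m - 1) = (\<Sum>j\<le>m. coeff f0 (m - j) * a ^ j) - coeff f0 m"
    proof -
      have "a * coeff Hu (m - 1) = (\<Sum>j\<le>m - 1. coeff f0 (m - Suc j) * a ^ Suc j)"
        unfolding Hu_def L coeff_poly_line[OF total_degree_le_hpoly] sum_distrib_left
        by (intro sum.cong refl) (simp add: coeff_hpoly)
      moreover have "(\<Sum>j\<le>Suc (m - 1). coeff f0 (m - j) * a ^ j) =
          coeff f0 m + (\<Sum>j\<le>m - 1. coeff f0 (m - Suc j) * a ^ Suc j)"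
        by (subst sum.atMost_Suc_shift) simp
      ultimately show ?thesis using m by simp
    qed
    have dLH: "degree (tline \<alpha> \<beta> * Hu) \<le> m"
      using degree_mult_le[of "tline \<alpha> \<beta>" Hu] degree_tline dHu m by linarith
    have dN: "degree N \<le> m"
      unfolding N_def using R dLH by (intro degree_diff_le) (auto simp: h2_def degree_pcompose)
    have "coeff (tline \<alpha> \<beta> * Hu) (1 + (m - 1)) = a * coeff Hu (m - 1)"
      using coeff_mult_top[OF degree_tline dHu] by (simp add: L)
    moreover have "coeff h2 m = coeff f2 m" unfolding h2_def using R by (intro coeff_pcompose_shift) blast
    ultimately have "coeff N m = 0"
      using R m f0_sum[of f0] cHu by (simp add: N_def a_def)
    then have dN1: "degree N \<le> m - 1" using degree_le_if_coeff_0[of N "m - 1"] dN m by simp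
    have "poly N 1 = 0" using R by (simp add: N_def h2_def L poly_pcompose)
    then obtain g0 where g0: "N = [:- 1, 1:] * g0" by (auto simp: poly_eq_0_iff_dvd elim: dvdE)
    have "degree g0 \<le> m - 2"
    proof (cases "g0 = 0")
      case False
      then have "degree N = 1 + degree g0" unfolding g0 by (subst degree_mult_eq) auto
      then show ?thesis using dN1 by simp
    qed simp
    then have "degree (smult (inverse a) g0) \<le> m - 2" using degree_smult_le le_trans by blast
    moreover have "tline \<alpha> \<beta> * smult (inverse a) g0 = N"
    proof -
      have "tline \<alpha> \<beta> = smult a [:- 1, 1:]" by (simp add: L)
      then show ?thesis
        unfolding g0 using a by (simp only: mult_smult_left mult_smult_right smult_smult) simp
    qed
    then have "h2 = f1 + tline \<alpha> \<beta> * (Hu + smult (inverse a) g0)"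
      by (simp only: distrib_left) (simp add: N_def)
    ultimately show "sides m f0 f1 f2"
      using R m unfolding h2_def Hu_def by (intro sidesI) auto
  qed
qed

text \<open>The tangents \<open>Z = 0\<close>, \<open>y = 0\<close> and
  \<open>y = - \<beta>^q\<close> all pass through \<open>(1 : 0 : 0)\<close>. The forms must share
  their value there, and since three directions in a plane are linearly dependent, so must be their
  first derivatives, the coefficients at \<open>m - 1\<close>.\<close>

lemma sides_concurrent_iff:
  assumes \<alpha>: "\<alpha> = 0" and m: "m \<ge> 2"
  shows "sides m f0 f1 f2 \<longleftrightarrow> degree f0 \<le> m \<and> degree f1 \<le> m \<and> degree f2 \<le> m \<and>
    coeff f0 m = coeff f1 m \<and> coeff f2 m = coeff f1 m \<and>
    coeff f2 (m - 1) = coeff f1 (m - 1) - \<beta> ^ q * coeff f0 (m - 1)" (is "_ \<longleftrightarrow> ?R")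
proof -
  define b where "b = - (\<beta> ^ q)"
  have b: "b \<noteq> 0" using \<beta>_nz by (simp add: b_def)
  have L: "tline \<alpha> \<beta> = [:b:]" using q_ge_2 by (simp add: tline_def b_def \<alpha>)
  have L': "tline \<alpha> \<beta> = [:b, 0:]" by (simp add: L)
  have tail: "total_degree_le (n - 1) G" if "total_degree_le n (pCons c G)" for n c and G :: "'a poly poly"
    unfolding total_degree_le_def
  proof (intro allI impI)
    fix i j assume "coeff (coeff G j) i \<noteq> 0"
    then have "coeff (coeff (pCons c G) (Suc j)) i \<noteq> 0" by simp
    then show "i + j \<le> n - 1" using that unfolding total_degree_le_def by fastforce
  qed
  show ?thesis
  proof
    assume s: "sides m f0 f1 f2"
    note deg = sides_degree[OF s]
    obtain F where F: "total_degree_le m F" "f0 = top_form m F" "f1 = poly F 0"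
      "f2 = pcompose (poly F (tline \<alpha> \<beta>)) [:\<alpha>, 1:]"
      using s unfolding sides_def by blast
    obtain c F' where F': "F = pCons c F'" by (cases F)
    obtain c' G where G: "F' = pCons c' G" by (cases F')
    have td: "total_degree_le (m - 1) F'" using tail F(1) unfolding F' by blast
    then have td2: "total_degree_le (m - 1 - 1) G" using tail unfolding G by blast
    have dG: "degree (poly G [:b:]) \<le> m - 1 - 1" by (rule degree_poly_line[OF td2]) simp
    have dc': "degree c' \<le> m - 1" using total_degree_le_degree_coeff[OF td, of 0] by (simp add: G)
    have f2: "f2 = f1 + smult b c' + smult (b * b) (poly G [:b:])"
      unfolding F(3,4) L F' G by (simp add: \<alpha> pcompose_idR algebra_simps)
    have c': "coeff c' (m - 1) = coeff f0 (m - 1)" using m by (simp add: F(2) coeff_top F' G)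
    have "coeff c' m = 0" using dc' m by (intro coeff_eq_0) simp
    moreover have "coeff (poly G [:b:]) m = 0" "coeff (poly G [:b:]) (m - 1) = 0"
      using dG m by (auto intro!: coeff_eq_0)
    ultimately show ?R using deg c' by (simp add: f2 b_def)
  next
    assume R: ?R
    define Hu where "Hu = poly (hpoly (m - 1) f0) (tline \<alpha> \<beta>)"
    define N where "N = f2 - f1 - tline \<alpha> \<beta> * Hu"
    have dHu: "degree Hu \<le> m - 1"
      unfolding Hu_def by (rule degree_poly_line[OF total_degree_le_hpoly degree_tline])
    have "coeff Hu (m - 1) = (\<Sum>j\<le>m - 1. if j = 0 then coeff f0 (m - 1) else 0)"
      unfolding Hu_def L' coeff_poly_line[OF total_degree_le_hpoly]
      by (intro sum.cong refl) (auto simp: coeff_hpoly)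
    then have cHu: "coeff Hu (m - 1) = coeff f0 (m - 1)" by simp
    have "degree (tline \<alpha> \<beta> * Hu) \<le> m - 1"
      using degree_smult_le[of b Hu] dHu by (simp add: L)
    then have "degree N \<le> m"
      unfolding N_def using R by (intro degree_diff_le) auto
    moreover have "coeff Hu m = 0" using dHu m by (intro coeff_eq_0) simp
    then have "coeff N m = 0" using R by (simp add: N_def L)
    ultimately have "degree N \<le> m - 1" using degree_le_if_coeff_0[of N "m - 1"] m by simp
    moreover have "coeff N (m - 1) = 0" using R cHu by (simp add: N_def L b_def)
    moreover have "Suc (m - 2) = m - 1" using m by simp
    ultimately have "degree N \<le> m - 2" using degree_le_if_coeff_0[of N "m - 2"] by simp
    then have "degree (smult (inverse b) N) \<le> m - 2" using degree_smult_le le_trans by blast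
    moreover have "tline \<alpha> \<beta> * smult (inverse b) N = N" using b by (simp add: L)
    then have "f2 = f1 + tline \<alpha> \<beta> * (Hu + smult (inverse b) N)"
      by (simp only: distrib_left) (simp add: N_def)
    then have "pcompose f2 [:- \<alpha>, 1:] = f1 + tline \<alpha> \<beta> * (Hu + smult (inverse b) N)"
      by (simp add: \<alpha> pcompose_idR)
    ultimately show "sides m f0 f1 f2"
      using R m unfolding Hu_def by (intro sidesI) auto
  qed
qed

text \<open>Every side is scaled as in \<open>side\<close>. The last corner has coordinate 1 on the
  second line and \<open>1 - \<alpha>\<close> on the third, which leaves the factor
  \<open>(1 - \<alpha>)^m\<close>; on the first line the powers of \<open>\<alpha>^q\<close> cancel.
  The predicates stay abstract so that conditions on exact and on least order are both
  covered.\<close>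

lemma ex_sides_triangle:
  assumes eq: "\<alpha> = \<beta>" and m: "m \<ge> 2"
  shows "(\<exists>f0 f1 f2. sides m f0 f1 f2 \<and> A0 f0 \<and> A1 f1 \<and> A2 f2) \<longleftrightarrow>
    (\<exists>x y z.
      (\<exists>f. degree f \<le> m \<and> A0 f \<and> coeff f m = x \<and> poly f (inverse (\<alpha> ^ q)) = inverse (\<alpha> ^ q) ^ m * y) \<and>
      (\<exists>f. degree f \<le> m \<and> A1 f \<and> coeff f m = x \<and> poly f 1 = 1 ^ m * ((1 - \<alpha>) ^ m * z)) \<and>
      (\<exists>f. degree f \<le> m \<and> A2 f \<and> coeff f m = y \<and> poly f (1 - \<alpha>) = (1 - \<alpha>) ^ m * z))"
    (is "?L \<longleftrightarrow> ?R")
proof -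
  have nz: "\<alpha> ^ q \<noteq> 0" "(1 - \<alpha>) ^ m \<noteq> 0" using \<beta>_nz eq triangle_1_minus_nz[OF eq] by auto
  show ?thesis
  proof
    assume ?L
    then obtain f0 f1 f2 where s: "sides m f0 f1 f2" and A: "A0 f0" "A1 f1" "A2 f2" by blast
    note s = s[unfolded sides_triangle_iff[OF assms]]
    show ?R
      by (rule exI[of _ "coeff f0 m"], rule exI[of _ "coeff f2 m"],
          rule exI[of _ "poly f2 (1 - \<alpha>) / (1 - \<alpha>) ^ m"], intro conjI,
          rule exI[of _ f0], use s A nz in \<open>simp add: field_simps\<close>,
          rule exI[of _ f1], use s A nz in simp,
          rule exI[of _ f2], use s A nz in simp)
  next
    assume ?R
    then obtain x y z f0 f1 f2 where f0: "degree f0 \<le> m" "A0 f0" "coeff f0 m = x"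
        "poly f0 (inverse (\<alpha> ^ q)) = inverse (\<alpha> ^ q) ^ m * y"
      and f1: "degree f1 \<le> m" "A1 f1" "coeff f1 m = x" "poly f1 1 = 1 ^ m * ((1 - \<alpha>) ^ m * z)"
      and f2: "degree f2 \<le> m" "A2 f2" "coeff f2 m = y" "poly f2 (1 - \<alpha>) = (1 - \<alpha>) ^ m * z"
      by blast
    have "(\<alpha> ^ q) ^ m * (inverse (\<alpha> ^ q) ^ m * y) = y"
      using nz by (simp add: power_inverse)
    then have "sides m f0 f1 f2" unfolding sides_triangle_iff[OF assms] using f0 f1 f2 by simp
    then show ?L using f0 f1 f2 by blast
  qed
qed

lemma ex_sides_concurrent:
  assumes \<alpha>: "\<alpha> = 0" and m: "m \<ge> 2"
  shows "(\<exists>f0 f1 f2. sides m f0 f1 f2 \<and> A0 f0 \<and> A1 f1 \<and> A2 f2) \<longleftrightarrow>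
    (\<exists>c x y z.
      (\<exists>f. degree f \<le> m \<and> A0 f \<and> coeff f m = c \<and> coeff f (m - 1) = x) \<and>
      (\<exists>f. degree f \<le> m \<and> A1 f \<and> coeff f m = c \<and> coeff f (m - 1) = y) \<and>
      (\<exists>f. degree f \<le> m \<and> A2 f \<and> coeff f m = c \<and> coeff f (m - 1) = z) \<and>
      \<beta> ^ q * x + (- 1) * y + 1 * z = 0)" (is "?L \<longleftrightarrow> ?R")
proof
  assume ?L
  then obtain f0 f1 f2 where s: "sides m f0 f1 f2" and A: "A0 f0" "A1 f1" "A2 f2" by blast
  note s = s[unfolded sides_concurrent_iff[OF assms]]
  show ?R
    by (rule exI[of _ "coeff f0 m"], rule exI[of _ "coeff f0 (m - 1)"],
        rule exI[of _ "coeff f1 (m - 1)"], rule exI[of _ "coeff f2 (m - 1)"], intro conjI,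
        rule exI[of _ f0], use s A in simp, rule exI[of _ f1], use s A in simp,
        rule exI[of _ f2], use s A in simp, use s in simp)
next
  assume ?R
  then obtain c x y z f0 f1 f2 where f0: "degree f0 \<le> m" "A0 f0" "coeff f0 m = c" "coeff f0 (m - 1) = x"
    and f1: "degree f1 \<le> m" "A1 f1" "coeff f1 m = c" "coeff f1 (m - 1) = y"
    and f2: "degree f2 \<le> m" "A2 f2" "coeff f2 m = c" "coeff f2 (m - 1) = z"
    and glue: "\<beta> ^ q * x + (- 1) * y + 1 * z = 0"
    by blast
  have "z = y - \<beta> ^ q * x" using glue by (simp add: algebra_simps)
  then have "sides m f0 f1 f2" unfolding sides_concurrent_iff[OF assms] using f0 f1 f2 by simp
  then show ?L using f0 f1 f2 by blast
qed

lemma ex_sides_iff_not_crit: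
  assumes std: "\<alpha> = 0 \<or> \<alpha> = \<beta>" and m: "m \<ge> 2"
  defines "dm \<equiv> mult_order (1 - \<alpha>) dvd m"
  shows "(\<exists>f0 f1 f2. sides m f0 f1 f2 \<and> ([:0, 1:] ^ i dvd f0 \<and> \<not> [:0, 1:] ^ Suc i dvd f0) \<and>
      [:0, 1:] ^ j dvd f1 \<and> [:0, 1:] ^ k dvd f2) \<longleftrightarrow> \<not> crit m dm i j k" (is ?T0)
    and "(\<exists>f0 f1 f2. sides m f0 f1 f2 \<and> [:0, 1:] ^ i dvd f0 \<and>
      ([:0, 1:] ^ j dvd f1 \<and> \<not> [:0, 1:] ^ Suc j dvd f1) \<and> [:0, 1:] ^ k dvd f2) \<longleftrightarrow> \<not> crit m dm j i k" (is ?T1)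
    and "(\<exists>f0 f1 f2. sides m f0 f1 f2 \<and> [:0, 1:] ^ i dvd f0 \<and>
      [:0, 1:] ^ j dvd f1 \<and> ([:0, 1:] ^ k dvd f2 \<and> \<not> [:0, 1:] ^ Suc k dvd f2)) \<longleftrightarrow> \<not> crit m dm k i j" (is ?T2)
proof -
  have dm: "(1 - \<alpha>) ^ m = 1 \<longleftrightarrow> dm"
    unfolding dm_def using one_minus_power[OF std] by (intro mult_order_dvd_iff[of "q + 1"]) auto
  have "?T0 \<and> ?T1 \<and> ?T2"
  proof (cases "\<alpha> = 0")
    case False
    then have eq: "\<alpha> = \<beta>" using std by simp
    have s: "inverse (\<alpha> ^ q) \<noteq> 0" "(1 :: 'a) \<noteq> 0" "1 - \<alpha> \<noteq> 0"
      using False triangle_1_minus_nz[OF eq] by auto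
    then have \<mu>: "(1 - \<alpha>) ^ m \<noteq> 0" by simp
    show ?thesis
      unfolding ex_sides_triangle[OF eq m] unfolding conj_assoc side_iff[OF s(1), symmetric]
        side_iff[OF s(2), symmetric] side_iff[OF s(3), symmetric] side_exact_iff[OF s(1), symmetric]
        side_exact_iff[OF s(2), symmetric] side_exact_iff[OF s(3), symmetric]
        glue_triangle[OF \<mu>] glue_triangle1[OF \<mu>] glue_triangle2[OF \<mu>] dm by simp
  next
    case True
    \<comment> \<open>Here \<open>1 - \<alpha> = 1\<close> has order 1, which divides every
      level.\<close>
    have dm: "dm = True" using dm True by simp
    have m1: "m \<ge> 1" using m by simp
    have nz: "\<beta> ^ q \<noteq> 0" "(- 1 :: 'a) \<noteq> 0" "(1 :: 'a) \<noteq> 0" using \<beta>_nz by auto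
    let ?C = "\<lambda>i c x. cside m i c (x :: 'a)" and ?E = "\<lambda>i c x. cside_exact m i c (x :: 'a)"
    have 1: "(\<exists>c x y z. ?C i c x \<and> ?E j c y \<and> ?C k c z \<and> \<beta> ^ q * x + (- 1) * y + 1 * z = 0) \<longleftrightarrow>
        (\<exists>c y x z. ?E j c y \<and> ?C i c x \<and> ?C k c z \<and> (- 1) * y + \<beta> ^ q * x + 1 * z = 0)"
      by (simp only: add.commute[of "\<beta> ^ q * _"]) blast
    have 2: "(\<exists>c x y z. ?C i c x \<and> ?C j c y \<and> ?E k c z \<and> \<beta> ^ q * x + (- 1) * y + 1 * z = 0) \<longleftrightarrow>
        (\<exists>c z x y. ?E k c z \<and> ?C i c x \<and> ?C j c y \<and> 1 * z + \<beta> ^ q * x + (- 1) * y = 0)"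
      by (simp only: add.assoc[symmetric] add.commute[of _ "1 * _"]) blast
    show ?thesis
      unfolding ex_sides_concurrent[OF True m] unfolding conj_assoc cside_iff[OF m1, symmetric]
        cside_exact_iff[OF m1, symmetric] 1 2 dm
        glue_concurrent[OF nz] glue_concurrent[OF nz(2,1,3)] glue_concurrent[OF nz(3,1,2)] by simp
  qed
  then show ?T0 ?T1 ?T2 by blast+
qed

text \<open>A basepoint is the absence of a form with exactly the prescribed order at the point and
  at least the prescribed orders at the other two.\<close>

theorem has_basepoint_iff_crit:
  assumes std: "\<alpha> = 0 \<or> \<alpha> = \<beta>" and m: "a1 + b1 + c1 \<ge> 2"
    and ijk: "i \<le> q + 1" "j \<le> q + 1" "k \<le> q + 1"
  defines "D \<equiv> Df ((int q + 1) * int a1 - int i) ((int q + 1) * int b1 - int j) ((int q + 1) * int c1 - int k)"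
    and "dm \<equiv> mult_order (1 - \<alpha>) dvd (a1 + b1 + c1)"
  shows "i \<le> q \<Longrightarrow> has_basepoint D Pinf \<longleftrightarrow> crit (a1 + b1 + c1) dm i j k"
    and "j \<le> q \<Longrightarrow> has_basepoint D P0 \<longleftrightarrow> crit (a1 + b1 + c1) dm j i k"
    and "k \<le> q \<Longrightarrow> has_basepoint D P1 \<longleftrightarrow> crit (a1 + b1 + c1) dm k i j"
  using ex_sides_iff_not_crit[OF std m, of i j k]
  unfolding D_def dm_def
  by (simp_all only: has_basepoint_Pinf_iff[OF ijk] has_basepoint_P0_iff[OF ijk] has_basepoint_P1_iff[OF ijk]) blast+

end

section \<open>Counting\<close>

text \<open>
  The coefficient \<open>a\<close> is written as \<open>(q + 1) * ceil_quot q a - deficit q a\<close> with a deficit between \<open>1\<close>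
  and \<open>q + 1\<close> (not between \<open>0\<close> and \<open>q\<close>), so that \<open>ceil_quot q a\<close> is always positive.
\<close>
definition ceil_quot :: "nat \<Rightarrow> nat \<Rightarrow> nat" where
  "ceil_quot q a = a div (q + 1) + 1"

definition deficit :: "nat \<Rightarrow> nat \<Rightarrow> nat" where
  "deficit q a = (q + 1) - a mod (q + 1)"

lemma deficit_bounds: "1 \<le> deficit q a" "deficit q a \<le> q + 1"
  using mod_less_divisor[of "q + 1" a] unfolding deficit_def by linarith+

lemma ceil_quot_ge: "1 \<le> ceil_quot q a"
  by (simp add: ceil_quot_def)

lemma ceil_quot_deficit: "a + deficit q a = (q + 1) * ceil_quot q a"
proof -
  have "a mod (q + 1) < q + 1" by simp
  then show ?thesis using mult_div_mod_eq[of "q + 1" a] by (simp add: ceil_quot_def deficit_def)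
qed

lemma bij_ceil_quot_deficit: "bij_betw (\<lambda>a. (ceil_quot q a, deficit q a)) UNIV ({1..} \<times> {1..q + 1})"
proof (rule bij_betwI[where g = "\<lambda>(x, i). (q + 1) * x - i"])
  show "(\<lambda>a. (ceil_quot q a, deficit q a)) \<in> UNIV \<rightarrow> {1..} \<times> {1..q + 1}"
    using ceil_quot_ge deficit_bounds by auto
  show "(\<lambda>(x, i). (q + 1) * x - i) \<in> {1..} \<times> {1..q + 1} \<rightarrow> UNIV" by simp
  show "(case (ceil_quot q a, deficit q a) of (x, i) \<Rightarrow> (q + 1) * x - i) = a" for a
    using ceil_quot_deficit[of a q] by simp
  fix p :: "nat \<times> nat" assume "p \<in> {1..} \<times> {1..q + 1}"
  then obtain x i where p: "p = (Suc x, i)" "1 \<le> i" "i \<le> q + 1"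
    by (cases p) (auto dest!: Suc_le_D)
  have e: "(q + 1) * Suc x - i = (q + 1 - i) + (q + 1) * x" using p by simp
  have "q + 1 - i < q + 1" using p by simp
  then have d: "((q + 1) * Suc x - i) div (q + 1) = x" "((q + 1) * Suc x - i) mod (q + 1) = q + 1 - i"
    unfolding e by (simp_all only: div_mult_self2 mod_mult_self2 div_less mod_less)
  then show "(ceil_quot q (case p of (x, i) \<Rightarrow> (q + 1) * x - i), deficit q (case p of (x, i) \<Rightarrow> (q + 1) * x - i)) = p"
    unfolding p(1) ceil_quot_def deficit_def prod.case d using p(2,3) by simp
qed

text \<open>The ways to distribute a level over the three positive quotients; their number is the
  weight \<open>(m - 1) (m - 2) / 2\<close>.\<close>

definition compositions :: "nat \<Rightarrow> (nat \<times> nat \<times> nat) set" where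
  "compositions m = {(x, y, z). 1 \<le> x \<and> 1 \<le> y \<and> 1 \<le> z \<and> x + y + z = m}"

lemma compositions:
  shows finite_compositions: "finite (compositions m)"
    and card_compositions: "m \<ge> 1 \<Longrightarrow> real (card (compositions m)) = (real m - 1) * (real m - 2) / 2"
proof -
  define B where "B = Sigma {1..m - 1} (\<lambda>x. {1..m - 1 - x})"
  have "compositions m = (\<lambda>(x, y). (x, y, m - x - y)) ` B"
    unfolding compositions_def B_def by (force simp: image_iff)
  moreover have inj: "inj_on (\<lambda>(x, y). (x, y, m - x - y)) B" by (auto intro: inj_onI)
  moreover have "finite B" by (simp add: B_def)
  ultimately show "finite (compositions m)" by simp
  assume m: "m \<ge> 1"
  have "card (compositions m) = card B"
    using \<open>compositions m = _\<close> card_image[OF inj] by simp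
  also have "\<dots> = (\<Sum>x\<in>{1..m - 1}. m - 1 - x)" by (simp add: B_def)
  also have "\<dots> = (\<Sum>x<m - 1. m - 1 - Suc x)"
    by (rule sum.reindex_bij_witness[of _ Suc "\<lambda>x. x - 1"]) auto
  also have "\<dots> = (\<Sum>x<m - 1. x)" by (rule sum.nat_diff_reindex)
  finally have c: "card (compositions m) = (\<Sum>x<m - 1. x)" .
  have s: "real (\<Sum>x<n. x) = real n * (real n - 1) / 2" for n
    by (induction n) (simp_all add: field_simps)
  then show "real (card (compositions m)) = (real m - 1) * (real m - 2) / 2"
    unfolding c s using m by (simp add: of_nat_diff algebra_simps)
qed

text \<open>Quotients and deficits vary independently, and the criterion sees the quotients only
  through their sum. The bound on the level makes the set finite.\<close>

lemma card_by_level: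
  fixes \<Phi> :: "nat \<Rightarrow> nat \<Rightarrow> nat \<Rightarrow> nat \<Rightarrow> bool"
  assumes bound: "\<And>m i j k. \<Phi> m i j k \<Longrightarrow> i \<le> q + 1 \<Longrightarrow> m \<le> q + 1"
  defines "A \<equiv> {(a, b, c). \<Phi> (ceil_quot q a + ceil_quot q b + ceil_quot q c) (deficit q a) (deficit q b) (deficit q c)}"
  shows "finite A"
    and "real (card A) = (\<Sum>m=1..q + 1. (real m - 1) * (real m - 2) / 2 *
      (\<Sum>i=1..q + 1. \<Sum>j=1..q + 1. \<Sum>k=1..q + 1. of_bool (\<Phi> m i j k)))"
proof -
  define C where "C m = {(i, j, k). i \<in> {1..q + 1} \<and> j \<in> {1..q + 1} \<and> k \<in> {1..q + 1} \<and> \<Phi> m i j k}" for m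
  define B where "B = (\<Union>m\<in>{1..q + 1}. compositions m \<times> C m)"
  define f where "f = (\<lambda>(a, b, c). ((ceil_quot q a, ceil_quot q b, ceil_quot q c), (deficit q a, deficit q b, deficit q c)))"
  have finC: "finite (C m)" for m
    by (rule finite_subset[of _ "{1..q + 1} \<times> {1..q + 1} \<times> {1..q + 1}"]) (auto simp: C_def)
  have finB: "finite B"
    unfolding B_def by (intro finite_UN_I finite_cartesian_product finC finite_compositions) simp
  have inj1: "a = a'" if "ceil_quot q a = ceil_quot q a'" "deficit q a = deficit q a'" for a a'
    using bij_betw_imp_inj_on[OF bij_ceil_quot_deficit, of q] that unfolding inj_def by blast
  have surj1: "\<exists>a. ceil_quot q a = x \<and> deficit q a = i" if "1 \<le> x" "1 \<le> i" "i \<le> q + 1" for x i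
  proof -
    have "(x, i) \<in> range (\<lambda>a. (ceil_quot q a, deficit q a))"
      unfolding bij_betw_imp_surj_on[OF bij_ceil_quot_deficit] using that by simp
    then show ?thesis by blast
  qed
  have "bij_betw f A B"
    unfolding bij_betw_def
  proof (intro conjI equalityI subsetI)
    show "inj_on f A" unfolding inj_on_def f_def using inj1 by auto
    fix p assume "p \<in> f ` A"
    then obtain a b c where p: "p = f (a, b, c)" "(a, b, c) \<in> A" by auto
    have "1 \<le> ceil_quot q a" "1 \<le> ceil_quot q b" "1 \<le> ceil_quot q c" by (rule ceil_quot_ge)+
    then show "p \<in> B"
      using p bound[of "ceil_quot q a + ceil_quot q b + ceil_quot q c" "deficit q a" "deficit q b" "deficit q c"] deficit_bounds
      unfolding B_def A_def f_def C_def compositions_def by auto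
  next
    fix p assume "p \<in> B"
    then obtain x y z i j k where p: "p = ((x, y, z), (i, j, k))" "1 \<le> x" "1 \<le> y" "1 \<le> z"
      "i \<in> {1..q + 1}" "j \<in> {1..q + 1}" "k \<in> {1..q + 1}" "\<Phi> (x + y + z) i j k"
      unfolding B_def C_def compositions_def by auto
    obtain a where a: "ceil_quot q a = x \<and> deficit q a = i" using surj1[of x i] p by auto
    obtain b where b: "ceil_quot q b = y \<and> deficit q b = j" using surj1[of y j] p by auto
    obtain c where c: "ceil_quot q c = z \<and> deficit q c = k" using surj1[of z k] p by auto
    show "p \<in> f ` A" using p a b c unfolding A_def f_def by (intro image_eqI[of _ _ "(a, b, c)"]) auto
  qed
  then have fin: "finite A" and card: "card A = card B"
    using bij_betw_finite bij_betw_same_card finB by blast+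
  show "finite A" by (rule fin)
  have "card B = (\<Sum>m\<in>{1..q + 1}. card (compositions m \<times> C m))"
    unfolding B_def using finC finite_compositions
    by (intro card_UN_disjoint) (auto simp: compositions_def)
  then have "real (card A) = (\<Sum>m\<in>{1..q + 1}. real (card (compositions m)) * real (card (C m)))"
    by (simp add: card card_cartesian_product)
  also have "\<dots> = (\<Sum>m\<in>{1..q + 1}. (real m - 1) * (real m - 2) / 2 *
      (\<Sum>i=1..q + 1. \<Sum>j=1..q + 1. \<Sum>k=1..q + 1. of_bool (\<Phi> m i j k)))"
  proof (intro sum.cong refl arg_cong2[where f = "(*)"] card_compositions)
    fix m :: nat assume "m \<in> {1..q + 1}"
    then show "1 \<le> m" by simp
    have "C m = {p \<in> {1..q + 1} \<times> {1..q + 1} \<times> {1..q + 1}. case p of (i, j, k) \<Rightarrow> \<Phi> m i j k}"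
      by (auto simp: C_def)
    then have "real (card (C m)) =
        (\<Sum>p\<in>{1..q + 1} \<times> {1..q + 1} \<times> {1..q + 1}. of_bool (case p of (i, j, k) \<Rightarrow> \<Phi> m i j k))"
      by (simp add: sum_of_bool_eq Int_def)
    also have "\<dots> = (\<Sum>i=1..q + 1. \<Sum>j=1..q + 1. \<Sum>k=1..q + 1. of_bool (\<Phi> m i j k))"
      by (simp only: sum.cartesian_product split_def)
    finally show "real (card (C m)) = (\<Sum>i=1..q + 1. \<Sum>j=1..q + 1. \<Sum>k=1..q + 1. of_bool (\<Phi> m i j k))" .
  qed
  finally show "real (card A) = (\<Sum>m=1..q + 1. (real m - 1) * (real m - 2) / 2 *
      (\<Sum>i=1..q + 1. \<Sum>j=1..q + 1. \<Sum>k=1..q + 1. of_bool (\<Phi> m i j k)))" .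
qed

text \<open>The last factor is a difference of reals and is zero for \<open>N = n + 2\<close>, when
  no argument reaches \<open>n + 3\<close>.\<close>

lemma sum_pieces:
  fixes F :: "nat \<Rightarrow> real"
  assumes "n + 2 \<le> N" "\<And>i. i \<le> n \<Longrightarrow> F i = F n" "\<And>i. n + 3 \<le> i \<Longrightarrow> F i = F (n + 3)"
  shows "(\<Sum>i=1..N. F i) = real n * F n + F (n + 1) + F (n + 2) + (real N - real n - 2) * F (n + 3)"
proof -
  have "{1..N} = {1..n} \<union> {n + 1, n + 2} \<union> {n + 3..N}" using assms(1) by auto
  then have "(\<Sum>i=1..N. F i) = (\<Sum>i=1..n. F i) + (F (n + 1) + F (n + 2)) + (\<Sum>i=n + 3..N. F i)"
    by (subst \<open>{1..N} = _\<close>, subst sum.union_disjoint) (auto simp: sum.union_disjoint)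
  moreover have "(\<Sum>i=1..n. F i) = (\<Sum>i=1..n. F n)" by (intro sum.cong refl assms(2)) auto
  moreover have "(\<Sum>i=n + 3..N. F i) = (\<Sum>i=n + 3..N. F (n + 3))" by (intro sum.cong refl assms(3)) auto
  ultimately show ?thesis using assms(1) by (simp add: of_nat_diff algebra_simps)
qed

text \<open>
  The criterion at level \<open>n + 2\<close> distinguishes only arguments at most \<open>n\<close>, equal to \<open>n + 1\<close>, equal to
  \<open>n + 2\<close>, and at least \<open>n + 3\<close>.
\<close>
definition pieces :: "nat \<Rightarrow> nat \<Rightarrow> (nat \<Rightarrow> real) \<Rightarrow> real" where
  "pieces n N F = real n * F n + F (n + 1) + F (n + 2) + (real N - real n - 2) * F (n + 3)"

lemma triple_sum_pieces:
  fixes c :: "nat \<Rightarrow> nat \<Rightarrow> nat \<Rightarrow> real"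
  assumes N: "n + 2 \<le> N1" "n + 2 \<le> N2" "n + 2 \<le> N3"
    and low: "\<And>i. i \<le> n \<Longrightarrow> c i = c n" "\<And>i j. j \<le> n \<Longrightarrow> c i j = c i n" "\<And>i j k. k \<le> n \<Longrightarrow> c i j k = c i j n"
    and high: "\<And>i. n + 3 \<le> i \<Longrightarrow> c i = c (n + 3)" "\<And>i j. n + 3 \<le> j \<Longrightarrow> c i j = c i (n + 3)"
      "\<And>i j k. n + 3 \<le> k \<Longrightarrow> c i j k = c i j (n + 3)"
  shows "(\<Sum>i=1..N1. \<Sum>j=1..N2. \<Sum>k=1..N3. c i j k) =
    pieces n N1 (\<lambda>i. pieces n N2 (\<lambda>j. pieces n N3 (c i j)))"
proof -
  have k: "(\<Sum>k=1..N3. c i j k) = pieces n N3 (c i j)" for i j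
    unfolding pieces_def by (rule sum_pieces[OF N(3) low(3) high(3)])
  have j: "(\<Sum>j=1..N2. pieces n N3 (c i j)) = pieces n N2 (\<lambda>j. pieces n N3 (c i j))" for i
    unfolding pieces_def[of n N2] by (rule sum_pieces[OF N(2)]) (drule low(2) high(2), erule arg_cong)+
  have "(\<Sum>i=1..N1. pieces n N2 (\<lambda>j. pieces n N3 (c i j))) =
      pieces n N1 (\<lambda>i. pieces n N2 (\<lambda>j. pieces n N3 (c i j)))"
    unfolding pieces_def[of n N1] by (rule sum_pieces[OF N(1)]) (drule low(1) high(1), simp only:)+
  then show ?thesis by (simp only: k j)
qed

lemma sum_restrict:
  fixes F :: "nat \<Rightarrow> real"
  shows "(\<Sum>i=1..q + 1. of_bool (i \<le> q) * F i) = (\<Sum>i=1..q. F i)"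
  by (rule sum.mono_neutral_cong_right) auto

text \<open>Deficit \<open>q + 1\<close> means a coefficient divisible by \<open>q + 1\<close>. It
  never gives a basepoint at its point, because it can be rewritten with deficit 0 one level lower,
  where \<open>crit\<close> fails.\<close>

definition crit1 :: "nat \<Rightarrow> nat \<Rightarrow> nat \<Rightarrow> nat \<Rightarrow> nat \<Rightarrow> nat \<Rightarrow> bool" where
  "crit1 q d m i j k \<longleftrightarrow> i \<le> q \<and> crit m (d dvd m) i j k"

text \<open>All \<open>j\<close>, \<open>k\<close> are allowed for \<open>i > m\<close>; for
  \<open>i = m\<close> the square \<open>j, k \<le> m\<close> is excluded; for
  \<open>i = m - 1\<close> the square \<open>j, k \<ge> m\<close> is allowed. The pair
  \<open>j = k = m\<close> counts for \<open>i = m\<close> if \<open>d\<close> does not divide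
  \<open>m\<close> and for \<open>i = m - 1\<close> if it does, so the total is independent of
  \<open>d\<close>.\<close>

lemma count1:
  assumes m: "2 \<le> m" "m \<le> q"
  shows "(\<Sum>i=1..q + 1. \<Sum>j=1..q + 1. \<Sum>k=1..q + 1. of_bool (crit1 q d m i j k)) =
    (real q - m) * (real q + 1)\<^sup>2 + (real q + 1)\<^sup>2 - (real m)\<^sup>2 + (real q + 2 - m)\<^sup>2"
proof -
  obtain n where n: "m = n + 2" using m(1) by (metis le_add_diff_inverse2)
  define dm where "dm \<longleftrightarrow> d dvd m"
  define c :: "nat \<Rightarrow> nat \<Rightarrow> nat \<Rightarrow> real" where "c = (\<lambda>i j k. of_bool (crit (n + 2) dm i j k))"
  have "(\<Sum>i=1..q + 1. \<Sum>j=1..q + 1. \<Sum>k=1..q + 1. of_bool (crit1 q d m i j k)) =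
      (\<Sum>i=1..q. \<Sum>j=1..q + 1. \<Sum>k=1..q + 1. c i j k)"
    by (subst sum_restrict[symmetric], unfold sum_distrib_left, intro sum.cong refl)
      (simp add: c_def crit1_def n dm_def)
  also have "\<dots> = pieces n q (\<lambda>i. pieces n (q + 1) (\<lambda>j. pieces n (q + 1) (c i j)))"
  proof (rule triple_sum_pieces)
    show "n + 2 \<le> q" "n + 2 \<le> q + 1" "n + 2 \<le> q + 1" using m n by auto
  qed (auto simp: c_def crit_def fun_eq_iff)
  also have "\<dots> = (real q - m) * (real q + 1)\<^sup>2 + (real q + 1)\<^sup>2 - (real m)\<^sup>2 + (real q + 2 - m)\<^sup>2"
    by (cases dm) (simp_all add: pieces_def c_def crit_def n power2_eq_square algebra_simps)
  finally show ?thesis .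
qed

definition crit2 :: "nat \<Rightarrow> nat \<Rightarrow> nat \<Rightarrow> nat \<Rightarrow> nat \<Rightarrow> nat \<Rightarrow> bool" where
  "crit2 q d m i j k \<longleftrightarrow> crit1 q d m i j k \<and> crit1 q d m j i k"

definition crit3 :: "nat \<Rightarrow> nat \<Rightarrow> nat \<Rightarrow> nat \<Rightarrow> nat \<Rightarrow> nat \<Rightarrow> bool" where
  "crit3 q d m i j k \<longleftrightarrow> crit2 q d m i j k \<and> crit1 q d m k i j"

text \<open>The terms belong to: both \<open>i\<close> and \<open>j\<close> above \<open>m\<close>;
  one above and one equal to \<open>m\<close>; one above and one equal to \<open>m - 1\<close>,
  which needs \<open>k \<ge> m\<close>; and the pairs \<open>(m, m)\<close>,
  \<open>(m, m - 1)\<close>, \<open>(m - 1, m)\<close>, which need \<open>k > m\<close>. The triple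
  \<open>(m, m, m)\<close> adds the dependence on \<open>d\<close>.\<close>

lemma count2:
  assumes m: "2 \<le> m" "m \<le> q"
  shows "(\<Sum>i=1..q + 1. \<Sum>j=1..q + 1. \<Sum>k=1..q + 1. of_bool (crit2 q d m i j k)) =
    (real q - m)\<^sup>2 * (real q + 1) + 2 * (real q - m) * (real q + 1) + 2 * (real q - m) * (real q + 2 - m)
      + 3 * (real q + 1 - m) + of_bool (\<not> d dvd m)"
proof -
  obtain n where n: "m = n + 2" using m(1) by (metis le_add_diff_inverse2)
  define dm where "dm \<longleftrightarrow> d dvd m"
  define c :: "nat \<Rightarrow> nat \<Rightarrow> nat \<Rightarrow> real" where
    "c = (\<lambda>i j k. of_bool (crit (n + 2) dm i j k \<and> crit (n + 2) dm j i k))"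
  have "(\<Sum>i=1..q + 1. \<Sum>j=1..q + 1. \<Sum>k=1..q + 1. of_bool (crit2 q d m i j k)) =
      (\<Sum>i=1..q. \<Sum>j=1..q. \<Sum>k=1..q + 1. c i j k)"
    by (subst (1 2) sum_restrict[symmetric], unfold sum_distrib_left, intro sum.cong refl)
      (auto simp: c_def crit1_def crit2_def n dm_def)
  also have "\<dots> = pieces n q (\<lambda>i. pieces n q (\<lambda>j. pieces n (q + 1) (c i j)))"
  proof (rule triple_sum_pieces)
    show "n + 2 \<le> q" "n + 2 \<le> q" "n + 2 \<le> q + 1" using m n by auto
  qed (auto simp: c_def crit_def fun_eq_iff)
  also have "\<dots> = (real q - m)\<^sup>2 * (real q + 1) + 2 * (real q - m) * (real q + 1)
      + 2 * (real q - m) * (real q + 2 - m) + 3 * (real q + 1 - m) + of_bool (\<not> dm)"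
    by (cases dm) (simp_all add: pieces_def c_def crit_def n power2_eq_square algebra_simps)
  finally show ?thesis unfolding dm_def .
qed

text \<open>Three entries above \<open>m\<close>; two above and the third \<open>m\<close> or
  \<open>m - 1\<close>; one above and the others a pair from \<open>m\<close>, \<open>m - 1\<close>
  that is not twice \<open>m - 1\<close>, giving 3 positions times 3 pairs; and
  \<open>(m, m, m)\<close> unless \<open>d\<close> divides \<open>m\<close>.\<close>

lemma count3:
  assumes m: "2 \<le> m" "m \<le> q"
  shows "(\<Sum>i=1..q + 1. \<Sum>j=1..q + 1. \<Sum>k=1..q + 1. of_bool (crit3 q d m i j k)) =
    (real q - m) ^ 3 + 6 * (real q - m)\<^sup>2 + 9 * (real q - m) + of_bool (\<not> d dvd m)"
proof -
  obtain n where n: "m = n + 2" using m(1) by (metis le_add_diff_inverse2)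
  define dm where "dm \<longleftrightarrow> d dvd m"
  define c :: "nat \<Rightarrow> nat \<Rightarrow> nat \<Rightarrow> real" where
    "c = (\<lambda>i j k. of_bool (crit (n + 2) dm i j k \<and> crit (n + 2) dm j i k \<and> crit (n + 2) dm k i j))"
  have "(\<Sum>i=1..q + 1. \<Sum>j=1..q + 1. \<Sum>k=1..q + 1. of_bool (crit3 q d m i j k)) =
      (\<Sum>i=1..q. \<Sum>j=1..q. \<Sum>k=1..q. c i j k)"
    by (subst (1 2 3) sum_restrict[symmetric], unfold sum_distrib_left, intro sum.cong refl)
      (auto simp: c_def crit1_def crit2_def crit3_def n dm_def)
  also have "\<dots> = pieces n q (\<lambda>i. pieces n q (\<lambda>j. pieces n q (c i j)))"
  proof (rule triple_sum_pieces)
    show "n + 2 \<le> q" "n + 2 \<le> q" "n + 2 \<le> q" using m n by auto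
  qed (auto simp: c_def crit_def fun_eq_iff)
  also have "\<dots> = (real q - m) ^ 3 + 6 * (real q - m)\<^sup>2 + 9 * (real q - m) + of_bool (\<not> dm)"
    by (cases dm) (simp_all add: pieces_def c_def crit_def n power2_eq_square power3_eq_cube algebra_simps)
  finally show ?thesis unfolding dm_def .
qed

lemma count1_top:
  assumes "d dvd q + 1" "q \<ge> 1"
  shows "(\<Sum>i=1..q + 1. \<Sum>j=1..q + 1. \<Sum>k=1..q + 1. of_bool (crit1 q d (q + 1) i j k)) = (1 :: real)"
proof -
  have b: "crit1 q d (q + 1) i j k \<longleftrightarrow> i = q \<and> j = q + 1 \<and> k = q + 1"
    if "j \<in> {1..q + 1}" "k \<in> {1..q + 1}" for i j k
    using that assms unfolding crit1_def crit_def by auto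
  have "(\<Sum>i=1..q + 1. \<Sum>j=1..q + 1. \<Sum>k=1..q + 1. of_bool (crit1 q d (q + 1) i j k)) =
      (\<Sum>i=1..q + 1. \<Sum>j=1..q + 1. \<Sum>k=1..q + 1. if q + 1 = k then (if q + 1 = j then (if q = i then 1 else 0) else 0) else (0 :: real))"
    by (intro sum.cong refl, subst b) auto
  also have "\<dots> = (\<Sum>i=1..q + 1. \<Sum>j=1..q + 1. if q + 1 = j then (if q = i then 1 else 0) else (0 :: real))"
    by (intro sum.cong refl) (subst sum.delta', auto)
  also have "\<dots> = (\<Sum>i=1..q + 1. if q = i then 1 else (0 :: real))"
    by (intro sum.cong refl) (subst sum.delta', auto)
  also have "\<dots> = 1" using assms(2) by (subst sum.delta') auto
  finally show ?thesis .
qed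

lemma not_crit2_top: "\<not> crit2 q d (q + 1) i j k"
  unfolding crit2_def crit1_def crit_def by auto

text \<open>The counts at a level are polynomials in \<open>m\<close> of degree at most 3, apart
  from the divisibility term, so this sums all three of them.\<close>

lemma sum_weighted_cubic:
  "(\<Sum>m=1..N. (real m - 1) * (real m - 2) / 2 * (c0 + c1 * m + c2 * (real m)\<^sup>2 + c3 * real m ^ 3)) =
    c0 * (real N ^ 3 / 6 - real N ^ 2 / 2 + real N / 3) +
    c1 * (real N ^ 4 / 8 - real N ^ 3 / 4 - real N ^ 2 / 8 + real N / 4) +
    c2 * (real N ^ 5 / 10 - real N ^ 4 / 8 - real N ^ 3 / 4 + real N ^ 2 / 8 + 3 * real N / 20) +
    c3 * (real N ^ 6 / 12 - real N ^ 5 / 20 - 7 * real N ^ 4 / 24 + 5 * real N ^ 2 / 24 + real N / 20)"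
proof (induction N)
  case (Suc N)
  have "(\<Sum>m=1..Suc N. (real m - 1) * (real m - 2) / 2 * (c0 + c1 * m + c2 * (real m)\<^sup>2 + c3 * real m ^ 3)) =
      (\<Sum>m=1..N. (real m - 1) * (real m - 2) / 2 * (c0 + c1 * m + c2 * (real m)\<^sup>2 + c3 * real m ^ 3)) +
      real N * (real N - 1) / 2 * (c0 + c1 * (1 + real N) + c2 * (1 + real N)\<^sup>2 + c3 * (1 + real N) ^ 3)"
    by simp
  then show ?case unfolding Suc.IH by (simp add: field_simps power_numeral_reduce)
qed simp

text \<open>The origin of \<open>h_fun\<close>: from the total weight of the levels up to
  \<open>q\<close> the multiples of \<open>d\<close> are removed, which are \<open>d * l\<close> for
  \<open>l < e\<close> with \<open>q + 1 = d * e\<close>.\<close>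

lemma sum_not_dvd:
  assumes "d dvd q + 1"
  shows "(\<Sum>m=1..q. (real m - 1) * (real m - 2) / 2 * of_bool (\<not> d dvd m)) = h_fun d q"
proof -
  obtain e where e: "q + 1 = d * e" using assms by blast
  then have pos: "d > 0" "e > 0" by (metis Suc_eq_plus1 mult_eq_0_iff nat.distinct(1) gr0I)+
  let ?w = "\<lambda>m. (real m - 1) * (real m - 2) / 2"
  have "(\<Sum>m=1..q. ?w m * of_bool (\<not> d dvd m)) = (\<Sum>m=1..q. ?w m) - (\<Sum>m=1..q. ?w m * of_bool (d dvd m))"
    unfolding sum_subtractf[symmetric] by (intro sum.cong refl) auto
  also have "(\<Sum>m=1..q. ?w m) = real q ^ 3 / 6 - real q ^ 2 / 2 + real q / 3"
    using sum_weighted_cubic[where N = q and ?c0.0 = 1 and ?c1.0 = 0 and ?c2.0 = 0 and ?c3.0 = 0] by simp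
  also have "(\<Sum>m=1..q. ?w m * of_bool (d dvd m)) = (\<Sum>l=1..e - 1. ?w (d * l))"
  proof -
    have "(\<Sum>m=1..q. ?w m * of_bool (d dvd m)) = (\<Sum>m\<in>{m\<in>{1..q}. d dvd m}. ?w m)"
      by (rule sum.mono_neutral_cong_right) auto
    also have "\<dots> = (\<Sum>l=1..e - 1. ?w (d * l))"
    proof (rule sum.reindex_bij_witness[of _ "\<lambda>l. d * l" "\<lambda>m. m div d"])
      fix l assume l: "l \<in> {1..e - 1}"
      have "l < e" using l pos(2) unfolding atLeastAtMost_iff by linarith
      then have "d * l < d * e" using pos by simp
      then have "d * l < q + 1" by (simp only: e)
      then have "d * l \<le> q" by simp
      then show "d * l \<in> {m \<in> {1..q}. d dvd m}" using l pos by simp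
      show "d * l div d = l" using pos by simp
    next
      fix m assume m: "m \<in> {m \<in> {1..q}. d dvd m}"
      then obtain l where l: "m = d * l" by auto
      have "d * l < d * e" using m unfolding l e[symmetric] by simp
      then have "l \<noteq> 0" "l < e" using m l by auto
      then show "m div d \<in> {1..e - 1}" using l pos by simp
    qed auto
    finally show ?thesis .
  qed
  also have "(\<Sum>l=1..e - 1. ?w (d * l)) = (\<Sum>l=1..e - 1. (real d * real l)\<^sup>2 / 2 - 3 * real d * real l / 2 + 1)"
    by (intro sum.cong refl) (simp add: field_simps power2_eq_square)
  also have "\<dots> = real d ^ 2 * ((real e - 1) * real e * (2 * real e - 1)) / 12
      - 3 * real d * (real e * (real e - 1)) / 4 + (real e - 1)"
  proof -
    have "(\<Sum>l=1..n. (real d * real l)\<^sup>2 / 2 - 3 * real d * real l / 2 + 1) =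
        real d ^ 2 * (real n * (real n + 1) * (2 * real n + 1)) / 12
        - 3 * real d * ((real n + 1) * real n) / 4 + real n" for n
      by (induction n) (simp_all add: field_simps power2_eq_square)
    from this[of "e - 1"] show ?thesis using pos by (simp add: of_nat_diff algebra_simps)
  qed
  finally have 1: "(\<Sum>m=1..q. ?w m * of_bool (\<not> d dvd m)) =
      real q ^ 3 / 6 - real q ^ 2 / 2 + real q / 3 - (real d ^ 2 * ((real e - 1) * real e * (2 * real e - 1)) / 12
      - 3 * real d * (real e * (real e - 1)) / 4 + (real e - 1))" .
  have "real q + 1 = real d * real e" using e by (metis of_nat_1 of_nat_add of_nat_mult)
  then have q: "real q = real d * real e - 1" by simp
  show ?thesis unfolding 1 h_fun_def q using pos
    by (simp add: field_simps power2_eq_square power3_eq_cube)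
qed

text \<open>\<open>crit\<close> implies \<open>m \<le> i + 1\<close>; with \<open>i \<le> q\<close>
  this makes every count finite.\<close>

lemma crit1_level: "crit1 q d m i j k \<Longrightarrow> m \<le> q + 1"
  unfolding crit1_def crit_def by auto

text \<open>Level 1 has weight 0, so the formulas valid from \<open>m = 2\<close> on suffice. The
  weight of level \<open>q + 1\<close> is \<open>q (q - 1) / 2\<close>.\<close>

lemma sum_levels:
  fixes F P :: "nat \<Rightarrow> real"
  assumes "\<And>m. 2 \<le> m \<Longrightarrow> m \<le> q \<Longrightarrow> F m = P m"
    and "F (q + 1) = T"
  shows "(\<Sum>m=1..q + 1. (real m - 1) * (real m - 2) / 2 * F m) =
    (\<Sum>m=1..q. (real m - 1) * (real m - 2) / 2 * P m) + real q * (real q - 1) / 2 * T"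
proof -
  have "(\<Sum>m=1..q. (real m - 1) * (real m - 2) / 2 * F m) = (\<Sum>m=1..q. (real m - 1) * (real m - 2) / 2 * P m)"
  proof (intro sum.cong refl)
    fix m assume "m \<in> {1..q}"
    then show "(real m - 1) * (real m - 2) / 2 * F m = (real m - 1) * (real m - 2) / 2 * P m"
      using assms(1)[of m] by (cases "m = 1") auto
  qed
  then show ?thesis using assms(2) by simp
qed

context
  fixes q d :: nat
  assumes d: "d dvd q + 1" and q: "q \<ge> 1"
begin

abbreviation level :: "nat \<Rightarrow> nat \<Rightarrow> nat \<Rightarrow> nat" where
  "level a b c \<equiv> ceil_quot q a + ceil_quot q b + ceil_quot q c"

lemma card_crit1:
  "finite {(a, b, c). crit1 q d (level a b c) (deficit q a) (deficit q b) (deficit q c)}"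
  "real (card {(a, b, c). crit1 q d (level a b c) (deficit q a) (deficit q b) (deficit q c)}) =
    1 / 24 * (real q ^ 6 - 2 * real q ^ 5 + 4 * real q ^ 3 - real q ^ 2 - 2 * real q)"
proof -
  note * = card_by_level[of "crit1 q d" q, OF crit1_level]
  show "finite {(a, b, c). crit1 q d (level a b c) (deficit q a) (deficit q b) (deficit q c)}" by (rule *(1))
  \<comment> \<open>The count is expanded in powers of \<open>m\<close> to match
    \<open>sum_weighted_cubic\<close>; the squares of \<open>m\<close> cancel.\<close>
  have E: "(\<Sum>m=1..q. (real m - 1) * (real m - 2) / 2 *
      ((real q - m) * (real q + 1)\<^sup>2 + (real q + 1)\<^sup>2 - (real m)\<^sup>2 + (real q + 2 - m)\<^sup>2)) =
    (\<Sum>m=1..q. (real m - 1) * (real m - 2) / 2 *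
      ((real q * (real q + 1)\<^sup>2 + (real q + 1)\<^sup>2 + (real q + 2)\<^sup>2)
        + (- ((real q + 1)\<^sup>2) - 2 * (real q + 2)) * m + 0 * (real m)\<^sup>2 + 0 * real m ^ 3))"
    by (intro sum.cong refl arg_cong2[where f = "(*)"]) (simp add: power2_eq_square algebra_simps)
  have "(\<Sum>i=1..q + 1. \<Sum>j=1..q + 1. \<Sum>k=1..q + 1. of_bool (crit1 q d (q + 1) i j k)) = (1 :: real)"
    by (rule count1_top[OF d q])
  note top_sum = this
  have "real (card {(a, b, c). crit1 q d (level a b c) (deficit q a) (deficit q b) (deficit q c)}) =
      (\<Sum>m=1..q + 1. (real m - 1) * (real m - 2) / 2 *
        (\<Sum>i=1..q + 1. \<Sum>j=1..q + 1. \<Sum>k=1..q + 1. of_bool (crit1 q d m i j k)))"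
    by (rule *(2))
  also have "\<dots> = (\<Sum>m=1..q. (real m - 1) * (real m - 2) / 2 *
      ((real q - m) * (real q + 1)\<^sup>2 + (real q + 1)\<^sup>2 - (real m)\<^sup>2 + (real q + 2 - m)\<^sup>2))
      + real q * (real q - 1) / 2 * 1"
    by (rule sum_levels) (rule count1, assumption, assumption, rule top_sum)
  finally show "real (card {(a, b, c). crit1 q d (level a b c) (deficit q a) (deficit q b) (deficit q c)}) =
      1 / 24 * (real q ^ 6 - 2 * real q ^ 5 + 4 * real q ^ 3 - real q ^ 2 - 2 * real q)"
    unfolding E sum_weighted_cubic by (simp add: field_simps power_numeral_reduce)
qed

lemma card_crit2:
  "finite {(a, b, c). crit2 q d (level a b c) (deficit q a) (deficit q b) (deficit q c)}"
  "real (card {(a, b, c). crit2 q d (level a b c) (deficit q a) (deficit q b) (deficit q c)}) =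
    1 / 120 * (2 * real q ^ 6 + real q ^ 5 - 20 * real q ^ 4 - 25 * real q ^ 3
      + 138 * real q ^ 2 - 96 * real q) + h_fun d q"
proof -
  have "crit2 q d m i j k \<Longrightarrow> m \<le> q + 1" for m i j k using crit1_level by (auto simp: crit2_def)
  note * = card_by_level[of "crit2 q d" q, OF this]
  show "finite {(a, b, c). crit2 q d (level a b c) (deficit q a) (deficit q b) (deficit q c)}" by (rule *(1))
  have E: "(\<Sum>m=1..q. (real m - 1) * (real m - 2) / 2 *
      ((real q - m)\<^sup>2 * (real q + 1) + 2 * (real q - m) * (real q + 1) + 2 * (real q - m) * (real q + 2 - m)
      + 3 * (real q + 1 - m) + of_bool (\<not> d dvd m))) =
    (\<Sum>m=1..q. (real m - 1) * (real m - 2) / 2 *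
      (((real q)\<^sup>2 * (real q + 1) + 2 * real q * (real q + 1) + 2 * real q * (real q + 2) + 3 * (real q + 1))
        + (- 2 * real q * (real q + 1) - 2 * (real q + 1) - 2 * (real q + 2) - 2 * real q - 3) * m
        + ((real q + 1) + 2) * (real m)\<^sup>2 + 0 * real m ^ 3)) +
    (\<Sum>m=1..q. (real m - 1) * (real m - 2) / 2 * of_bool (\<not> d dvd m))"
    unfolding sum.distrib[symmetric] distrib_left[symmetric]
    by (intro sum.cong refl arg_cong2[where f = "(*)"]) (simp add: power2_eq_square algebra_simps)
  have "(\<Sum>i=1..q + 1. \<Sum>j=1..q + 1. \<Sum>k=1..q + 1. of_bool (crit2 q d (q + 1) i j k)) = (0 :: real)"
    by (simp add: not_crit2_top[simplified])
  note top_sum = this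
  have "real (card {(a, b, c). crit2 q d (level a b c) (deficit q a) (deficit q b) (deficit q c)}) =
      (\<Sum>m=1..q + 1. (real m - 1) * (real m - 2) / 2 *
        (\<Sum>i=1..q + 1. \<Sum>j=1..q + 1. \<Sum>k=1..q + 1. of_bool (crit2 q d m i j k)))"
    by (rule *(2))
  also have "\<dots> = (\<Sum>m=1..q. (real m - 1) * (real m - 2) / 2 *
      ((real q - m)\<^sup>2 * (real q + 1) + 2 * (real q - m) * (real q + 1) + 2 * (real q - m) * (real q + 2 - m)
        + 3 * (real q + 1 - m) + of_bool (\<not> d dvd m)))
      + real q * (real q - 1) / 2 * 0"
    by (rule sum_levels) (rule count2, assumption, assumption, rule top_sum)
  finally show "real (card {(a, b, c). crit2 q d (level a b c) (deficit q a) (deficit q b) (deficit q c)}) =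
      1 / 120 * (2 * real q ^ 6 + real q ^ 5 - 20 * real q ^ 4 - 25 * real q ^ 3
        + 138 * real q ^ 2 - 96 * real q) + h_fun d q"
    unfolding E sum_weighted_cubic sum_not_dvd[OF d] by (simp add: field_simps power_numeral_reduce)
qed

lemma card_crit3:
  "finite {(a, b, c). crit3 q d (level a b c) (deficit q a) (deficit q b) (deficit q c)}"
  "real (card {(a, b, c). crit3 q d (level a b c) (deficit q a) (deficit q b) (deficit q c)}) =
    1 / 120 * (real q ^ 6 + 3 * real q ^ 5 - 15 * real q ^ 4 - 75 * real q ^ 3
      + 254 * real q ^ 2 - 168 * real q) + h_fun d q"
proof -
  have "crit3 q d m i j k \<Longrightarrow> m \<le> q + 1" for m i j k using crit1_level by (auto simp: crit3_def crit2_def)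
  note * = card_by_level[of "crit3 q d" q, OF this]
  show "finite {(a, b, c). crit3 q d (level a b c) (deficit q a) (deficit q b) (deficit q c)}" by (rule *(1))
  have top: "\<not> crit3 q d (q + 1) i j k" for i j k using not_crit2_top by (simp add: crit3_def)
  have E: "(\<Sum>m=1..q. (real m - 1) * (real m - 2) / 2 *
      ((real q - m) ^ 3 + 6 * (real q - m)\<^sup>2 + 9 * (real q - m) + of_bool (\<not> d dvd m))) =
    (\<Sum>m=1..q. (real m - 1) * (real m - 2) / 2 *
      ((real q ^ 3 + 6 * (real q)\<^sup>2 + 9 * real q) + (- 3 * (real q)\<^sup>2 - 12 * real q - 9) * m
        + (3 * real q + 6) * (real m)\<^sup>2 + (- 1) * real m ^ 3)) +
    (\<Sum>m=1..q. (real m - 1) * (real m - 2) / 2 * of_bool (\<not> d dvd m))"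
    unfolding sum.distrib[symmetric] distrib_left[symmetric]
    by (intro sum.cong refl arg_cong2[where f = "(*)"]) (simp add: power2_eq_square power3_eq_cube algebra_simps)
  have "(\<Sum>i=1..q + 1. \<Sum>j=1..q + 1. \<Sum>k=1..q + 1. of_bool (crit3 q d (q + 1) i j k)) = (0 :: real)"
    by (simp add: top[simplified])
  note top_sum = this
  have "real (card {(a, b, c). crit3 q d (level a b c) (deficit q a) (deficit q b) (deficit q c)}) =
      (\<Sum>m=1..q + 1. (real m - 1) * (real m - 2) / 2 *
        (\<Sum>i=1..q + 1. \<Sum>j=1..q + 1. \<Sum>k=1..q + 1. of_bool (crit3 q d m i j k)))"
    by (rule *(2))
  also have "\<dots> = (\<Sum>m=1..q. (real m - 1) * (real m - 2) / 2 *
      ((real q - m) ^ 3 + 6 * (real q - m)\<^sup>2 + 9 * (real q - m) + of_bool (\<not> d dvd m)))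
      + real q * (real q - 1) / 2 * 0"
    by (rule sum_levels) (rule count3, assumption, assumption, rule top_sum)
  finally show "real (card {(a, b, c). crit3 q d (level a b c) (deficit q a) (deficit q b) (deficit q c)}) =
      1 / 120 * (real q ^ 6 + 3 * real q ^ 5 - 15 * real q ^ 4 - 75 * real q ^ 3
        + 254 * real q ^ 2 - 168 * real q) + h_fun d q"
    unfolding E sum_weighted_cubic sum_not_dvd[OF d] by (simp add: field_simps power_numeral_reduce)
qed

end

section \<open>Basepoints of effective divisors\<close>

text \<open>Packages all three criteria for one ordering of the points, so that they can be carried
  through permutations and automorphisms as a whole.\<close>

definition basepoints_by_levels ::
  "nat \<Rightarrow> nat \<Rightarrow> 'a::square_field geom_point \<Rightarrow> 'a geom_point \<Rightarrow> 'a geom_point \<Rightarrow> bool" where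
  "basepoints_by_levels q d A B C \<longleftrightarrow> (\<forall>a b c.
     (has_basepoint (div_of A B C a b c) A \<longleftrightarrow> crit1 q d (ceil_quot q a + ceil_quot q b + ceil_quot q c) (deficit q a) (deficit q b) (deficit q c)) \<and>
     (has_basepoint (div_of A B C a b c) B \<longleftrightarrow> crit1 q d (ceil_quot q a + ceil_quot q b + ceil_quot q c) (deficit q b) (deficit q a) (deficit q c)) \<and>
     (has_basepoint (div_of A B C a b c) C \<longleftrightarrow> crit1 q d (ceil_quot q a + ceil_quot q b + ceil_quot q c) (deficit q c) (deficit q a) (deficit q b)))"

lemma crit1_commute: "crit1 q d m i j k \<longleftrightarrow> crit1 q d m i k j"
  unfolding crit1_def using crit_commute by blast

lemma div_of_swap: "div_of A B C a b c = div_of B A C b a c" "div_of A B C a b c = div_of A C B a c b"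
  by (simp_all add: div_of_def add_ac)

lemma effective_divisors_swap:
  "effective_divisors A B C = effective_divisors B A C" "effective_divisors A B C = effective_divisors A C B"
proof -
  show "effective_divisors A B C = effective_divisors B A C"
    unfolding effective_divisors_def div_of_swap(1)[of A B C] by blast
  show "effective_divisors A B C = effective_divisors A C B"
    unfolding effective_divisors_def div_of_swap(2)[of A B C] by blast
qed

lemma basepoints_by_levels_swap:
  assumes "basepoints_by_levels q d A B C"
  shows "basepoints_by_levels q d B A C" and "basepoints_by_levels q d A C B"
proof -
  show "basepoints_by_levels q d B A C"
    unfolding basepoints_by_levels_def
  proof (intro allI)
    fix a b c
    have *: "crit1 q d m k i j = crit1 q d m k j i" for m i j k by (rule crit1_commute)
    show "(has_basepoint (div_of B A C a b c) B \<longleftrightarrow> crit1 q d (ceil_quot q a + ceil_quot q b + ceil_quot q c) (deficit q a) (deficit q b) (deficit q c)) \<and>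
      (has_basepoint (div_of B A C a b c) A \<longleftrightarrow> crit1 q d (ceil_quot q a + ceil_quot q b + ceil_quot q c) (deficit q b) (deficit q a) (deficit q c)) \<and>
      (has_basepoint (div_of B A C a b c) C \<longleftrightarrow> crit1 q d (ceil_quot q a + ceil_quot q b + ceil_quot q c) (deficit q c) (deficit q a) (deficit q b))"
      using assms[unfolded basepoints_by_levels_def, rule_format, of b a c] *[of _ "deficit q c" "deficit q a" "deficit q b"]
      unfolding div_of_swap(1)[of B A C a b c] add.commute[of "ceil_quot q b" "ceil_quot q a"] by blast
  qed
  show "basepoints_by_levels q d A C B"
    unfolding basepoints_by_levels_def
  proof (intro allI)
    fix a b c
    have e: "ceil_quot q a + ceil_quot q c + ceil_quot q b = ceil_quot q a + ceil_quot q b + ceil_quot q c" by simp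
    show "(has_basepoint (div_of A C B a b c) A \<longleftrightarrow> crit1 q d (ceil_quot q a + ceil_quot q b + ceil_quot q c) (deficit q a) (deficit q b) (deficit q c)) \<and>
      (has_basepoint (div_of A C B a b c) C \<longleftrightarrow> crit1 q d (ceil_quot q a + ceil_quot q b + ceil_quot q c) (deficit q b) (deficit q a) (deficit q c)) \<and>
      (has_basepoint (div_of A C B a b c) B \<longleftrightarrow> crit1 q d (ceil_quot q a + ceil_quot q b + ceil_quot q c) (deficit q c) (deficit q a) (deficit q b))"
      using assms[unfolded basepoints_by_levels_def, rule_format, of a c b]
        crit1_commute[of q d _ "deficit q a" "deficit q b" "deficit q c"]
      unfolding div_of_swap(2)[of A C B a b c] e by blast
  qed
qed

context standard_triangle
begin

lemma not_crit_0: "m \<ge> 2 \<Longrightarrow> \<not> crit m dm 0 j k"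
  unfolding crit_def by auto

lemma int_eq_ceil_quot_deficit: "int a = (int q + 1) * int (ceil_quot q a) - int (deficit q a)"
proof -
  have "int (a + deficit q a) = int ((q + 1) * ceil_quot q a)" by (simp only: ceil_quot_deficit)
  then show ?thesis by (simp add: algebra_simps)
qed

lemma int_eq_ceil_quot: "deficit q a = q + 1 \<Longrightarrow> int a = (int q + 1) * int (ceil_quot q a - 1) - int 0"
  using int_eq_ceil_quot_deficit[of a] ceil_quot_ge[of q a] by (simp add: of_nat_diff algebra_simps)

text \<open>For deficit \<open>q + 1\<close> at the tested point the coefficient is written with
  deficit 0 and a quotient smaller by one. The other two quotients are positive, so the degree is
  still at least 2.\<close>

lemma basepoints_by_levels_standard:
  assumes std: "\<alpha> = 0 \<or> \<alpha> = \<beta>"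
  shows "basepoints_by_levels q (mult_order (1 - \<alpha>)) Pinf P0 P1"
  unfolding basepoints_by_levels_def
proof (intro allI conjI)
  fix a b c
  define d where "d = mult_order (1 - \<alpha>)"
  have D: "div_of Pinf P0 P1 a b c = Df (int a) (int b) (int c)" by (simp add: div_of_def)
  have ge: "1 \<le> ceil_quot q a" "1 \<le> ceil_quot q b" "1 \<le> ceil_quot q c" by (rule ceil_quot_ge)+
  have le: "deficit q a \<le> q + 1" "deficit q b \<le> q + 1" "deficit q c \<le> q + 1" by (rule deficit_bounds)+
  note crits = has_basepoint_iff_crit[OF std, of "ceil_quot q a" "ceil_quot q b" "ceil_quot q c" "deficit q a" "deficit q b" "deficit q c",
      folded int_eq_ceil_quot_deficit D d_def]
  show "has_basepoint (div_of Pinf P0 P1 a b c) Pinf \<longleftrightarrow>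
      crit1 q d (ceil_quot q a + ceil_quot q b + ceil_quot q c) (deficit q a) (deficit q b) (deficit q c)"
  proof (cases "deficit q a \<le> q")
    case True
    then show ?thesis using crits(1) ge le by (simp add: crit1_def)
  next
    case False
    then have deficit: "deficit q a = q + 1" using le by simp
    have m: "ceil_quot q a - 1 + ceil_quot q b + ceil_quot q c \<ge> 2" using ge by linarith
    note * = has_basepoint_iff_crit(1)[OF std m _ le(2,3), of 0, folded int_eq_ceil_quot_deficit int_eq_ceil_quot[OF deficit] D]
    show ?thesis using * not_crit_0[OF m] deficit by (simp add: crit1_def)
  qed
  show "has_basepoint (div_of Pinf P0 P1 a b c) P0 \<longleftrightarrow>
      crit1 q d (ceil_quot q a + ceil_quot q b + ceil_quot q c) (deficit q b) (deficit q a) (deficit q c)"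
  proof (cases "deficit q b \<le> q")
    case True
    then show ?thesis using crits(2) ge le by (simp add: crit1_def)
  next
    case False
    then have deficit: "deficit q b = q + 1" using le by simp
    have m: "ceil_quot q a + (ceil_quot q b - 1) + ceil_quot q c \<ge> 2" using ge by linarith
    note * = has_basepoint_iff_crit(2)[OF std m le(1) _ le(3), of 0, folded int_eq_ceil_quot_deficit int_eq_ceil_quot[OF deficit] D]
    show ?thesis using * not_crit_0[OF m] deficit by (simp add: crit1_def)
  qed
  show "has_basepoint (div_of Pinf P0 P1 a b c) P1 \<longleftrightarrow>
      crit1 q d (ceil_quot q a + ceil_quot q b + ceil_quot q c) (deficit q c) (deficit q a) (deficit q b)"
  proof (cases "deficit q c \<le> q")
    case True
    then show ?thesis using crits(3) ge le by (simp add: crit1_def)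
  next
    case False
    then have deficit: "deficit q c = q + 1" using le by simp
    have m: "ceil_quot q a + ceil_quot q b + (ceil_quot q c - 1) \<ge> 2" using ge by linarith
    note * = has_basepoint_iff_crit(3)[OF std m le(1,2), of 0, folded int_eq_ceil_quot_deficit int_eq_ceil_quot[OF deficit] D]
    show ?thesis using * not_crit_0[OF m] deficit by (simp add: crit1_def)
  qed
qed

lemma mult_order_dvd:
  assumes "\<alpha> = 0 \<or> \<alpha> = \<beta>"
  shows "mult_order (1 - \<alpha>) dvd q + 1"
  using mult_order_dvd_iff[of "q + 1" "1 - \<alpha>" "q + 1"] one_minus_power[OF assms] by simp

end

section \<open>Automorphisms\<close>

context
  fixes \<sigma> :: "'a::square_field geom_point \<Rightarrow> 'a geom_point" and \<phi> :: "'a herm_field \<Rightarrow> 'a herm_field"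
  assumes \<sigma>: "bij_betw \<sigma> herm_curve herm_curve"
    and \<phi>: "herm_field_automorphism \<phi>"
    and val: "\<forall>S\<in>herm_curve. \<forall>f z. has_value f (\<sigma> S) z \<longleftrightarrow> has_value (\<phi> f) S z"
begin

lemma aut_bij: "bij \<phi>" and aut_add: "\<phi> (f + g) = \<phi> f + \<phi> g" and aut_mult: "\<phi> (f * g) = \<phi> f * \<phi> g"
  using \<phi> unfolding herm_field_automorphism_def by blast+

lemma aut_eq_iff: "\<phi> f = \<phi> g \<longleftrightarrow> f = g"
  using aut_bij by (meson bij_is_inj inj_eq)

lemma aut_surj: "\<exists>f. g = \<phi> f"
  using aut_bij by (meson bij_is_surj surjE)

lemma aut_all: "(\<forall>f. Pr (\<phi> f)) \<longleftrightarrow> (\<forall>g. Pr g)"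
  using aut_surj by metis

lemma aut_0: "\<phi> 0 = 0"
proof -
  have "\<phi> 0 + \<phi> 0 = \<phi> 0 + 0" using aut_add[of 0 0] by (simp only: add_0_right)
  then show ?thesis by (simp only: add_left_cancel)
qed

lemma aut_eq_0_iff: "\<phi> f = 0 \<longleftrightarrow> f = 0"
  using aut_eq_iff[of f 0] by (simp add: aut_0)

lemma aut_1: "\<phi> 1 = 1"
  using aut_mult[of 1 1] aut_eq_0_iff[of 1] by simp

lemma aut_inverse: "\<phi> (inverse f) = inverse (\<phi> f)"
proof (cases "f = 0")
  case False
  then have "\<phi> f * \<phi> (inverse f) = 1" by (simp add: aut_1 flip: aut_mult)
  then show ?thesis by (simp add: inverse_unique)
qed (simp add: aut_0)

lemma aut_power: "\<phi> (f ^ n) = \<phi> f ^ n"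
  by (induction n) (simp_all add: aut_1 aut_mult)

lemma aut_powi: "\<phi> (f powi n) = \<phi> f powi n"
  by (simp add: power_int_def aut_power aut_inverse)

context
  fixes S :: "'a geom_point"
  assumes S: "S \<in> herm_curve"
begin

lemma aut_local_ring: "f \<in> local_ring (\<sigma> S) \<longleftrightarrow> \<phi> f \<in> local_ring S"
  using val S by (simp add: local_ring_def)

lemma aut_max_ideal: "f \<in> max_ideal (\<sigma> S) \<longleftrightarrow> \<phi> f \<in> max_ideal S"
  using val S by (simp add: max_ideal_def)

lemma aut_uniformizer: "uniformizer (\<sigma> S) t \<longleftrightarrow> uniformizer S (\<phi> t)"
proof -
  have 1: "f \<in> {t * g |g. g \<in> local_ring (\<sigma> S)} \<longleftrightarrow> \<phi> f \<in> {\<phi> t * g |g. g \<in> local_ring S}" for f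
  proof
    assume "\<phi> f \<in> {\<phi> t * g |g. g \<in> local_ring S}"
    then obtain g where g: "\<phi> f = \<phi> t * g" "g \<in> local_ring S" by blast
    obtain h where h: "g = \<phi> h" using aut_surj by blast
    have "f = t * h" using g(1) by (simp add: h aut_eq_iff flip: aut_mult)
    then show "f \<in> {t * g |g. g \<in> local_ring (\<sigma> S)}" using g(2) h aut_local_ring by blast
  qed (auto simp: aut_mult aut_local_ring)
  show ?thesis
    unfolding uniformizer_def set_eq_iff aut_max_ideal 1 by (rule aut_all)
qed

text \<open>Local rings, uniformizers and hence orders are built from \<open>has_value\<close> and
  the field operations alone, and the comorphism respects both.\<close>

lemma aut_ord_at: "ord_at (\<sigma> S) f = ord_at S (\<phi> f)"
proof -
  have "(\<exists>t u. uniformizer (\<sigma> S) t \<and> u \<in> local_ring (\<sigma> S) \<and> inverse u \<in> local_ring (\<sigma> S) \<and> u \<noteq> 0 \<and> f = u * t powi n) \<longleftrightarrow>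
      (\<exists>t u. uniformizer S t \<and> u \<in> local_ring S \<and> inverse u \<in> local_ring S \<and> u \<noteq> 0 \<and> \<phi> f = u * t powi n)" for n
  proof
    assume "\<exists>t u. uniformizer (\<sigma> S) t \<and> u \<in> local_ring (\<sigma> S) \<and> inverse u \<in> local_ring (\<sigma> S) \<and> u \<noteq> 0 \<and> f = u * t powi n"
    then obtain t u where "uniformizer (\<sigma> S) t" "u \<in> local_ring (\<sigma> S)" "inverse u \<in> local_ring (\<sigma> S)" "u \<noteq> 0" "f = u * t powi n"
      by blast
    then show "\<exists>t u. uniformizer S t \<and> u \<in> local_ring S \<and> inverse u \<in> local_ring S \<and> u \<noteq> 0 \<and> \<phi> f = u * t powi n"
      by (intro exI[of _ "\<phi> t"] exI[of _ "\<phi> u"])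
        (simp add: aut_uniformizer aut_local_ring aut_inverse aut_eq_0_iff aut_mult aut_powi)
  next
    assume "\<exists>t u. uniformizer S t \<and> u \<in> local_ring S \<and> inverse u \<in> local_ring S \<and> u \<noteq> 0 \<and> \<phi> f = u * t powi n"
    then obtain t' u' where *: "uniformizer S t'" "u' \<in> local_ring S" "inverse u' \<in> local_ring S" "u' \<noteq> 0" "\<phi> f = u' * t' powi n"
      by blast
    obtain t u where tu: "t' = \<phi> t" "u' = \<phi> u" using aut_surj by meson
    have "f = u * t powi n" using *(5) by (simp add: tu aut_eq_iff flip: aut_mult aut_powi)
    then show "\<exists>t u. uniformizer (\<sigma> S) t \<and> u \<in> local_ring (\<sigma> S) \<and> inverse u \<in> local_ring (\<sigma> S) \<and> u \<noteq> 0 \<and> f = u * t powi n"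
      using * unfolding tu
      by (intro exI[of _ t] exI[of _ u]) (simp add: aut_uniformizer aut_local_ring aut_inverse aut_eq_0_iff)
  qed
  then show ?thesis unfolding ord_at_def by simp
qed

end

lemma aut_rr_space:
  assumes "\<And>S. S \<in> herm_curve \<Longrightarrow> Poly_Mapping.lookup D' (\<sigma> S) = Poly_Mapping.lookup D S"
  shows "f \<in> rr_space D' \<longleftrightarrow> \<phi> f \<in> rr_space D"
proof -
  have "(\<forall>S\<in>herm_curve. ord_at S f \<ge> - Poly_Mapping.lookup D' S) \<longleftrightarrow>
      (\<forall>S\<in>herm_curve. ord_at (\<sigma> S) f \<ge> - Poly_Mapping.lookup D' (\<sigma> S))"
    by (subst bij_betw_imp_surj_on[OF \<sigma>, symmetric]) simp
  also have "\<dots> \<longleftrightarrow> (\<forall>S\<in>herm_curve. ord_at S (\<phi> f) \<ge> - Poly_Mapping.lookup D S)"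
    using assms aut_ord_at by simp
  finally show ?thesis unfolding rr_space_def by (auto simp: aut_eq_0_iff)
qed

lemma aut_has_basepoint:
  assumes D: "\<And>S. S \<in> herm_curve \<Longrightarrow> Poly_Mapping.lookup D' (\<sigma> S) = Poly_Mapping.lookup D S"
    and S: "S \<in> herm_curve"
  shows "has_basepoint D' (\<sigma> S) \<longleftrightarrow> has_basepoint D S"
proof -
  have "Poly_Mapping.lookup (D' - Poly_Mapping.single (\<sigma> S) 1) (\<sigma> S') =
      Poly_Mapping.lookup (D - Poly_Mapping.single S 1) S'" if "S' \<in> herm_curve" for S'
    using D[OF that] inj_on_eq_iff[OF bij_betw_imp_inj_on[OF \<sigma>] S that]
    by (auto simp: lookup_minus lookup_single when_def)
  then have "f \<in> rr_space (D' - Poly_Mapping.single (\<sigma> S) 1) \<longleftrightarrow>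
      \<phi> f \<in> rr_space (D - Poly_Mapping.single S 1)" for f
    by (rule aut_rr_space)
  moreover have "f \<in> rr_space D' \<longleftrightarrow> \<phi> f \<in> rr_space D" for f
    using D by (rule aut_rr_space)
  ultimately have rr: "f \<in> rr_space D' \<longleftrightarrow> \<phi> f \<in> rr_space D"
    "f \<in> rr_space (D' - Poly_Mapping.single (\<sigma> S) 1) \<longleftrightarrow> \<phi> f \<in> rr_space (D - Poly_Mapping.single S 1)" for f
    by blast+
  show ?thesis unfolding has_basepoint_def set_eq_iff rr by (rule aut_all)
qed

lemma aut_basepoints_by_levels:
  assumes "basepoints_by_levels q d (\<sigma> A) (\<sigma> B) (\<sigma> C)" and ABC: "A \<in> herm_curve" "B \<in> herm_curve" "C \<in> herm_curve"
  shows "basepoints_by_levels q d A B C"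
proof -
  have "Poly_Mapping.lookup (div_of (\<sigma> A) (\<sigma> B) (\<sigma> C) a b c) (\<sigma> S) = Poly_Mapping.lookup (div_of A B C a b c) S"
    if "S \<in> herm_curve" for S a b c
    using inj_on_eq_iff[OF bij_betw_imp_inj_on[OF \<sigma>] _ that] ABC
    by (simp add: div_of_def lookup_add lookup_single when_def)
  then have "has_basepoint (div_of (\<sigma> A) (\<sigma> B) (\<sigma> C) a b c) (\<sigma> S) \<longleftrightarrow> has_basepoint (div_of A B C a b c) S"
    if "S \<in> herm_curve" for S a b c
    using that by (intro aut_has_basepoint)
  then show ?thesis using assms(1) ABC unfolding basepoints_by_levels_def by simp
qed

end

section \<open>The three counts\<close>

lemma inj_div_of:
  assumes "A \<noteq> B" "A \<noteq> C" "B \<noteq> C"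
  shows "inj (\<lambda>(a, b, c). div_of A B C a b c)"
proof (rule injI)
  fix p p' :: "nat \<times> nat \<times> nat"
  assume e: "(case p of (a, b, c) \<Rightarrow> div_of A B C a b c) = (case p' of (a, b, c) \<Rightarrow> div_of A B C a b c)"
  obtain a b c a' b' c' where p: "p = (a, b, c)" "p' = (a', b', c')" by (metis surj_pair)
  have "Poly_Mapping.lookup (div_of A B C a b c) S = Poly_Mapping.lookup (div_of A B C a' b' c') S" for S
    using e by (simp add: p)
  from this[of A] this[of B] this[of C] assms show "p = p'"
    by (simp add: p div_of_def lookup_add lookup_single when_def)
qed

text \<open>Parts (a) and (b) count divisors, whereas the criterion is about coefficient
  triples.\<close>

lemma card_effective_divisors:
  assumes "A \<noteq> B" "A \<noteq> C" "B \<noteq> C"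
  shows "finite {D \<in> effective_divisors A B C. Pr D} \<longleftrightarrow> finite {(a, b, c). Pr (div_of A B C a b c)}"
    and "card {D \<in> effective_divisors A B C. Pr D} = card {(a, b, c). Pr (div_of A B C a b c)}"
proof -
  let ?f = "\<lambda>(a, b, c). div_of A B C a b c"
  have "{D \<in> effective_divisors A B C. Pr D} = ?f ` {(a, b, c). Pr (div_of A B C a b c)}"
    unfolding effective_divisors_def by force
  moreover have "inj_on ?f Z" for Z
    using inj_div_of[OF assms] by (rule inj_on_subset) simp
  ultimately show "finite {D \<in> effective_divisors A B C. Pr D} \<longleftrightarrow> finite {(a, b, c). Pr (div_of A B C a b c)}"
    and "card {D \<in> effective_divisors A B C. Pr D} = card {(a, b, c). Pr (div_of A B C a b c)}"
    by (simp_all add: finite_image_iff card_image)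
qed

lemma distinct_triple_cases:
  assumes "A \<in> {x, y, z}" "B \<in> {x, y, z}" "C \<in> {x, y, z}" "A \<noteq> B" "A \<noteq> C" "B \<noteq> C"
  shows "A = x \<and> B = y \<and> C = z \<or> A = x \<and> B = z \<and> C = y \<or> A = y \<and> B = x \<and> C = z \<or>
    A = y \<and> B = z \<and> C = x \<or> A = z \<and> B = x \<and> C = y \<or> A = z \<and> B = y \<and> C = x"
  using assms by (elim insertE emptyE; simp)

theorem proposition19:
  fixes q d :: nat
    and T :: "'a::square_field geom_point set"
    and P Q R :: "'a geom_point"
  assumes "primepow q"
    and "CARD('a) = q\<^sup>2"
    and "T = {P, Q, R}"
    and "hermitian_triangle T"
    and "has_type T d"
  shows
    "(\<forall>S\<in>T. finite {D \<in> effective_divisors P Q R. has_basepoint D S} \<and>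
        real (card {D \<in> effective_divisors P Q R. has_basepoint D S}) =
          1 / 24 * (real q ^ 6 - 2 * real q ^ 5 + 4 * real q ^ 3 - real q ^ 2 - 2 * real q)) \<and>
     (\<forall>S\<in>T. \<forall>S'\<in>T. S \<noteq> S' \<longrightarrow>
        finite {D \<in> effective_divisors P Q R. has_basepoint D S \<and> has_basepoint D S'} \<and>
        real (card {D \<in> effective_divisors P Q R. has_basepoint D S \<and> has_basepoint D S'}) =
          1 / 120 * (2 * real q ^ 6 + real q ^ 5 - 20 * real q ^ 4 - 25 * real q ^ 3
            + 138 * real q ^ 2 - 96 * real q) + h_fun d q) \<and>
     finite (pure_gaps P Q R) \<and>
        real (card (pure_gaps P Q R)) =
          1 / 120 * (real q ^ 6 + 3 * real q ^ 5 - 15 * real q ^ 4 - 75 * real q ^ 3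
            + 254 * real q ^ 2 - 168 * real q) + h_fun d q"
proof -
  interpret hermitian q "TYPE('a)"
    by unfold_locales (rule assms)+
  have T: "T \<subseteq> herm_curve" "card T = 3"
    using assms(4) by (auto simp: hermitian_triangle_def rational_points_def)
  have neq: "P \<noteq> Q" "P \<noteq> R" "Q \<noteq> R"
    using T(2) unfolding assms(3) by (auto simp: card_insert_if split: if_splits)
  have PQR: "P \<in> herm_curve" "Q \<in> herm_curve" "R \<in> herm_curve"
    using T(1) assms(3) by auto
  obtain \<sigma> \<alpha> \<beta> where aut: "herm_automorphism \<sigma>" and \<sigma>T: "\<sigma> ` T = {P_inf, P_aff 0 0, P_aff \<alpha> \<beta>}"
    and std: "\<alpha> = 0 \<or> \<alpha> = \<beta>" and d: "mult_order (1 - \<alpha>) = d"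
    using assms(5) unfolding has_type_def by blast
  obtain \<phi> where \<sigma>: "bij_betw \<sigma> herm_curve herm_curve" and \<phi>: "herm_field_automorphism \<phi>"
    and val: "\<forall>S\<in>herm_curve. \<forall>f z. has_value f (\<sigma> S) z \<longleftrightarrow> has_value (\<phi> f) S z"
    using aut unfolding herm_automorphism_def by blast
  have inj: "inj_on \<sigma> T" using \<sigma> T(1) by (meson bij_betw_imp_inj_on inj_on_subset)
  then have card3: "card {P_inf, P_aff 0 0, P_aff \<alpha> \<beta>} = 3"
    using card_image[OF inj] T(2) by (simp only: \<sigma>T)
  \<comment> \<open>\<open>has_type\<close> does not state the curve equation for
    \<open>\<alpha>\<close> and \<open>\<beta>\<close>; it follows because the point is the image of
    a point of the curve.\<close>
  have "P_aff \<alpha> \<beta> \<in> \<sigma> ` T" by (simp only: \<sigma>T) simp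
  then have "P_aff \<alpha> \<beta> \<in> herm_curve" using T(1) \<sigma> by (auto simp: bij_betw_def)
  then have "on_curve (to_ac \<alpha>) (to_ac \<beta>)"
    unfolding herm_curve_eq P_aff_eq by (auto simp: aff_eq_iff)
  then have "to_ac (\<alpha> ^ (q + 1)) = to_ac (\<beta> ^ q + \<beta>)" by (simp only: on_curve_def to_ac_power to_ac_add)
  then have \<alpha>\<beta>: "\<alpha> ^ (q + 1) = \<beta> ^ q + \<beta>" by (simp only: to_ac_eq_iff)
  have \<beta>: "\<beta> \<noteq> 0"
  proof
    assume "\<beta> = 0"
    then have "\<alpha> = 0" using std by auto
    then show False using card3 \<open>\<beta> = 0\<close> by (auto simp: card_insert_if split: if_splits)
  qed
  interpret standard_triangle q "TYPE('a)" \<alpha> \<beta>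
    by unfold_locales (rule \<alpha>\<beta> \<beta>)+
  have "basepoints_by_levels q d P_inf P0 P1"
    using basepoints_by_levels_standard[OF std] by (simp only: d)
  note l1 = this
  note l2 = basepoints_by_levels_swap(1)[OF l1] and l3 = basepoints_by_levels_swap(2)[OF l1]
  note l4 = basepoints_by_levels_swap(2)[OF l2] and l5 = basepoints_by_levels_swap(1)[OF l3]
  note l6 = basepoints_by_levels_swap(2)[OF l5]
  \<comment> \<open>The automorphism may send \<open>P\<close>, \<open>Q\<close>, \<open>R\<close>
    to the standard points in any order.\<close>
  have all: "basepoints_by_levels q d A B C"
    if ABC: "{A, B, C} = {P_inf, P0, P1}" "A \<noteq> B" "A \<noteq> C" "B \<noteq> C" for A B C
  proof -
    have "A \<in> {P_inf, P0, P1}" "B \<in> {P_inf, P0, P1}" "C \<in> {P_inf, P0, P1}"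
      unfolding ABC(1)[symmetric] by simp_all
    from distinct_triple_cases[OF this ABC(2-4)] show ?thesis
      by (elim disjE conjE) (simp_all only: l1 l2 l3 l4 l5 l6)
  qed
  have "\<sigma> P \<noteq> \<sigma> Q" "\<sigma> P \<noteq> \<sigma> R" "\<sigma> Q \<noteq> \<sigma> R"
    using inj neq by (auto simp: assms(3) inj_on_def)
  moreover have "{\<sigma> P, \<sigma> Q, \<sigma> R} = {P_inf, P0, P1}" using \<sigma>T by (simp add: assms(3))
  ultimately have "basepoints_by_levels q d (\<sigma> P) (\<sigma> Q) (\<sigma> R)" by (intro all)
  then have level: "basepoints_by_levels q d P Q R"
    using PQR by (rule aut_basepoints_by_levels[OF \<sigma> \<phi> val])
  have dq: "d dvd q + 1" using mult_order_dvd[OF std] d by simp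
  have q1: "q \<ge> 1" using q_ge_2 by simp
  \<comment> \<open>Any two chosen points can be put in the first two positions, so one count for
    each of (a) and (b) is enough.\<close>
  have third: "\<exists>U. basepoints_by_levels q d S S' U \<and> S \<noteq> U \<and> S' \<noteq> U \<and>
      effective_divisors P Q R = effective_divisors S S' U" if SS': "S \<in> T" "S' \<in> T" "S \<noteq> S'" for S S'
  proof -
    consider "S = P" "S' = Q" | "S = P" "S' = R" | "S = Q" "S' = P" | "S = Q" "S' = R"
      | "S = R" "S' = P" | "S = R" "S' = Q"
      using SS' unfolding assms(3) by blast
    then show ?thesis
    proof cases
      case 1
      then show ?thesis using level neq by blast
    next
      case 2
      then show ?thesis using basepoints_by_levels_swap(2)[OF level] effective_divisors_swap(2)[of P Q R] neq by blast
    next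
      case 3
      then show ?thesis using basepoints_by_levels_swap(1)[OF level] effective_divisors_swap(1)[of P Q R] neq by blast
    next
      case 4
      then show ?thesis
        using basepoints_by_levels_swap(2)[OF basepoints_by_levels_swap(1)[OF level]]
          effective_divisors_swap(1)[of P Q R] effective_divisors_swap(2)[of Q P R] neq by blast
    next
      case 5
      then show ?thesis
        using basepoints_by_levels_swap(1)[OF basepoints_by_levels_swap(2)[OF level]]
          effective_divisors_swap(2)[of P Q R] effective_divisors_swap(1)[of P R Q] neq by blast
    next
      case 6
      then show ?thesis
        using basepoints_by_levels_swap(2)[OF basepoints_by_levels_swap(1)[OF basepoints_by_levels_swap(2)[OF level]]]
          effective_divisors_swap(2)[of P Q R] effective_divisors_swap(1)[of P R Q]
          effective_divisors_swap(2)[of R P Q] neq by blast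
    qed
  qed
  show ?thesis
  proof (intro conjI ballI impI)
    fix S assume S: "S \<in> T"
    obtain S' where "S' \<in> T" "S \<noteq> S'" using neq assms(3) S by auto
    then obtain U where U: "basepoints_by_levels q d S S' U" "S \<noteq> U" "S' \<noteq> U"
      "effective_divisors P Q R = effective_divisors S S' U" using third[OF S] by blast
    have "has_basepoint (div_of S S' U a b c) S \<longleftrightarrow>
        crit1 q d (ceil_quot q a + ceil_quot q b + ceil_quot q c) (deficit q a) (deficit q b) (deficit q c)" for a b c
      using U(1) unfolding basepoints_by_levels_def by blast
    note * = card_effective_divisors[OF \<open>S \<noteq> S'\<close> U(2,3), of "\<lambda>D. has_basepoint D S", unfolded this, folded U(4)]
    show "finite {D \<in> effective_divisors P Q R. has_basepoint D S}"
      unfolding * by (rule card_crit1[OF dq q1])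
    show "real (card {D \<in> effective_divisors P Q R. has_basepoint D S}) =
          1 / 24 * (real q ^ 6 - 2 * real q ^ 5 + 4 * real q ^ 3 - real q ^ 2 - 2 * real q)"
      unfolding * by (rule card_crit1[OF dq q1])
  next
    fix S S' assume SS': "S \<in> T" "S' \<in> T" "S \<noteq> S'"
    from third[OF this] obtain U where U: "basepoints_by_levels q d S S' U" "S \<noteq> U" "S' \<noteq> U"
      "effective_divisors P Q R = effective_divisors S S' U" by blast
    have "has_basepoint (div_of S S' U a b c) S \<and> has_basepoint (div_of S S' U a b c) S' \<longleftrightarrow>
        crit2 q d (ceil_quot q a + ceil_quot q b + ceil_quot q c) (deficit q a) (deficit q b) (deficit q c)" for a b c
      using U(1)[unfolded basepoints_by_levels_def, rule_format, of a b c] unfolding crit2_def by simp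
    note * = card_effective_divisors[OF SS'(3) U(2,3), of "\<lambda>D. has_basepoint D S \<and> has_basepoint D S'",
        unfolded this, folded U(4)]
    show "finite {D \<in> effective_divisors P Q R. has_basepoint D S \<and> has_basepoint D S'}"
      unfolding * by (rule card_crit2[OF dq q1])
    show "real (card {D \<in> effective_divisors P Q R. has_basepoint D S \<and> has_basepoint D S'}) =
          1 / 120 * (2 * real q ^ 6 + real q ^ 5 - 20 * real q ^ 4 - 25 * real q ^ 3
            + 138 * real q ^ 2 - 96 * real q) + h_fun d q"
      unfolding * by (rule card_crit2[OF dq q1])
  next
    have "has_basepoint (div_of P Q R a b c) P \<and> has_basepoint (div_of P Q R a b c) Q \<and>
        has_basepoint (div_of P Q R a b c) R \<longleftrightarrow>
        crit3 q d (ceil_quot q a + ceil_quot q b + ceil_quot q c) (deficit q a) (deficit q b) (deficit q c)" for a b c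
      using level[unfolded basepoints_by_levels_def, rule_format, of a b c]
      unfolding crit2_def crit3_def by simp
    then have *: "pure_gaps P Q R =
        {(a, b, c). crit3 q d (ceil_quot q a + ceil_quot q b + ceil_quot q c) (deficit q a) (deficit q b) (deficit q c)}"
      unfolding pure_gaps_def by (simp only:)
    show "finite (pure_gaps P Q R)"
      unfolding * by (rule card_crit3[OF dq q1])
    show "real (card (pure_gaps P Q R)) =
          1 / 120 * (real q ^ 6 + 3 * real q ^ 5 - 15 * real q ^ 4 - 75 * real q ^ 3
            + 254 * real q ^ 2 - 168 * real q) + h_fun d q"
      unfolding * by (rule card_crit3[OF dq q1])
  qed
qed

end
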